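(* Let $p,q$ be distinct primes, $\alpha\ge 1$, $b=p^\alpha q$, and let $\mathcal D\subset\mathbb Z^+$ with $0\in\mathcal D$, $\gcd(\mathcal D)=1$ and $\#\mathcal D=p^\alpha q$. Then $\mathcal D$ is a tile digit set (with respect to $b$) if and only if $\mathcal D$ is a $k$-th order modulo product-form (with respect to $b$) for some $k\ge1$.
   Context: $\mathbb Z^+$ denotes the nonnegative integers. For an integer $b\ge 2$, a set $\mathcal D\subset\mathbb Z^+$ with $\#\mathcal D=b$ is a tile digit set with respect to $b$ if $T(b,\mathcal D)=\{\sum_{k\ge1}b^{-k}d_k:d_k\in\mathcal D\}\subset\mathbb R$ has nonempty interior. $X\oplus Y=\{x+y: x\in X, y\in Y\}$ means all sums are distinct. For finite sets, $X\equiv Y\ (\mathrm{mod}\ n)$ means there is a bijection $X\to Y$ under which corresponding elements are congruent mod $n$; $X\equiv\mathbb Z_b$ means $X\equiv\{0,\dots,b-1\}\ (\mathrm{mod}\ b)$. For finite $\mathcal A\subset\mathbb Z^+$, $P_{\mathcal A}(x)=\sum_{a\in\mathcal A}x^a$. $\Phi_d$ is the $d$-th cyclotomic polynomial. The l.c.m. of the empty set is $1$. All sets below are finite subsets of $\mathbb Z^+$. First-order forms. Let $\mathcal E=\mathcal E_0\oplus\mathcal E_1\oplus\cdots\oplus\mathcal E_r\equiv\mathbb Z_b$ and $0=l_0\le l_1\le\cdots\le l_r$ be integers. The set $\mathcal E_0\oplus b^{l_1}\mathcal E_1\oplus\cdots\oplus b^{l_r}\mathcal E_r$ is a (first-order)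 product-form of $\mathcal E$. Let $S_i=\{d>1: d\mid b,\ \Phi_d(x)\mid P_{\mathcal E_i}(x)\}$, $\Psi_i(x)=\prod_{d\in S_i}\Phi_d(x)$, $K_1^{(i)}(x)=\Psi_0(x)\Psi_1(x^{b^{l_1}})\cdots\Psi_i(x^{b^{l_i}})$ and $n_i=\mathrm{l.c.m.}\{s:\Phi_s(x)\mid K_1^{(i)}(x)\}$ for $0\le i\le r$. If $\mathcal D^{(0)}\equiv\mathcal E_0\ (\mathrm{mod}\ n_0)$ and $\mathcal D^{(i)}\equiv\mathcal D^{(i-1)}\oplus b^{l_i}\mathcal E_i\ (\mathrm{mod}\ n_i)$ for $1\le i\le r$, then $\mathcal D=\mathcal D^{(r)}$ is called a (first-order) modulo product-form with respect to $\mathcal E$; its associated polynomial is $K_{\mathcal D}=K_1^{(r)}$. Higher-order forms. Let $k\ge2$ and let $\mathcal G$ be a $(k-1)$-th order modulo product-form with associated polynomial $K_{\mathcal G}$. Let $\mathcal G=\mathcal G_0\oplus\cdots\oplus\mathcal G_\ell$ be any decomposition (possibly different from the one that generated $\mathcal G$) and $0=r_0\le r_1\le\cdots\le r_\ell$. The set $\mathcal G_0\oplus b^{r_1}\mathcal G_1\oplus\cdots\oplus b^{r_\ell}\mathcal G_\ell$ is a $k$-th order product-form. Let $S_i^{(k)}=\{s:\Phi_s(x)\mid P_{\mathcal G_i}(x),\ \Phi_s(x)\mid K_{\mathcal G}(x)\}$, $K_k^{(i)}(x)=\prod_{j=0}^i\prod_{s\in S_j^{(k)}}\Phi_s(x^{b^{r_j}})$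 and $n_i=\mathrm{l.c.m.}\{s:\Phi_s(x)\mid K_k^{(i)}(x)\}$. If $\mathcal D^{(0)}\equiv\mathcal G_0\ (\mathrm{mod}\ n_0)$ and $\mathcal D^{(i)}\equiv\mathcal D^{(i-1)}\oplus b^{r_i}\mathcal G_i\ (\mathrm{mod}\ n_i)$ for $1\le i\le\ell$, then $\mathcal D=\mathcal D^{(\ell)}$ is a $k$-th order modulo product-form, with associated polynomial $K_{\mathcal D}=K_k^{(\ell)}$. *)

theory Defs
  imports
    "HOL-Analysis.Analysis"
    "HOL-Computational_Algebra.Computational_Algebra"
    "HOL-Number_Theory.Totient"
begin

definition tile_attractor :: "nat \<Rightarrow> nat set \<Rightarrow> real set" where
  "tile_attractor b D =
     {x. \<exists>d :: nat \<Rightarrow> nat. (\<forall>k. d k \<in> D) \<and> x = (\<Sum>k. real (d k) / real b ^ Suc k)}"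

definition tile_digit_set :: "nat \<Rightarrow> nat set \<Rightarrow> bool" where
  "tile_digit_set b D \<longleftrightarrow> b \<ge> 2 \<and> card D = b \<and> interior (tile_attractor b D) \<noteq> {}"

definition sumset :: "nat set \<Rightarrow> nat set \<Rightarrow> nat set" where
  "sumset X Y = (\<lambda>(x, y). x + y) ` (X \<times> Y)"

definition direct :: "nat set \<Rightarrow> nat set \<Rightarrow> bool" where
  "direct X Y \<longleftrightarrow> inj_on (\<lambda>(x, y). x + y) (X \<times> Y)"

text \<open>\<open>direct_decomposition E r Es\<close>: the set \<open>E\<close> is \<open>Es 0 \<oplus> \<dots> \<oplus> Es r\<close>, with all sums distinct.\<close>

definition direct_decomposition :: "nat set \<Rightarrow> nat \<Rightarrow> (nat \<Rightarrow> nat set) \<Rightarrow> bool" where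
  "direct_decomposition E r Es \<longleftrightarrow> bij_betw (\<lambda>e. \<Sum>i\<le>r. e i) (\<Pi>\<^sub>E i\<in>{..r}. Es i) E"

definition set_cong :: "nat \<Rightarrow> nat set \<Rightarrow> nat set \<Rightarrow> bool" where
  "set_cong n X Y \<longleftrightarrow> (\<exists>f. bij_betw f X Y \<and> (\<forall>x\<in>X. [x = f x] (mod n)))"

text \<open>
  All polynomials are taken over the complex numbers. As \<open>cyclotomic d\<close> is monic with integer
  coefficients, dividing an integer polynomial means the same over the integers, the rationals
  and the complex numbers. Indices of cyclotomic polynomials are always required to be
  positive, because the product below is \<open>1\<close> for \<open>d = 0\<close>.
\<close>

definition cyclotomic :: "nat \<Rightarrow> complex poly" where
  "cyclotomic d = (\<Prod>k\<in>totatives d. [:- cis (2 * pi * real k / real d), 1:])"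

definition set_poly :: "nat set \<Rightarrow> complex poly" where
  "set_poly A = (\<Sum>a\<in>A. monom 1 a)"

text \<open>The product over \<open>j \<le> i\<close> and \<open>s \<in> S j\<close> of \<open>cyclotomic s\<close> evaluated at \<open>x ^ (b ^ l j)\<close>.\<close>

definition kernel_poly :: "nat \<Rightarrow> (nat \<Rightarrow> nat) \<Rightarrow> (nat \<Rightarrow> nat set) \<Rightarrow> nat \<Rightarrow> complex poly" where
  "kernel_poly b l S i = (\<Prod>j\<le>i. \<Prod>s\<in>S j. pcompose (cyclotomic s) (monom 1 (b ^ l j)))"

definition cyclotomic_lcm :: "complex poly \<Rightarrow> nat" where
  "cyclotomic_lcm K = Lcm {s. s > 0 \<and> cyclotomic s dvd K}"

text \<open>
  The construction common to all orders: starting from the parts \<open>Es 0, \<dots>, Es r\<close>, the exponents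
  \<open>l\<close> and the sets \<open>S i\<close> of cyclotomic indices, \<open>D\<close> is the last term of a sequence of digit sets
  \<open>Ds 0, \<dots>, Ds r\<close>, each determined only up to congruence.
\<close>

definition modulo_product ::
  "nat \<Rightarrow> nat \<Rightarrow> (nat \<Rightarrow> nat set) \<Rightarrow> (nat \<Rightarrow> nat) \<Rightarrow> (nat \<Rightarrow> nat set) \<Rightarrow> nat set \<Rightarrow> bool" where
  "modulo_product b r Es l S D \<longleftrightarrow>
     (\<exists>Ds :: nat \<Rightarrow> nat set.
        set_cong (cyclotomic_lcm (kernel_poly b l S 0)) (Ds 0) (Es 0) \<and>
        (\<forall>i\<in>{1..r}.
           direct (Ds (i - 1)) ((*) (b ^ l i) ` Es i) \<and>
           set_cong (cyclotomic_lcm (kernel_poly b l S i))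
             (Ds i) (sumset (Ds (i - 1)) ((*) (b ^ l i) ` Es i))) \<and>
        D = Ds r)"

definition first_order_indices :: "nat \<Rightarrow> (nat \<Rightarrow> nat set) \<Rightarrow> nat \<Rightarrow> nat set" where
  "first_order_indices b Es i = {d. d > 1 \<and> d dvd b \<and> cyclotomic d dvd set_poly (Es i)}"

definition higher_order_indices :: "complex poly \<Rightarrow> (nat \<Rightarrow> nat set) \<Rightarrow> nat \<Rightarrow> nat set" where
  "higher_order_indices K Gs i =
     {s. s > 0 \<and> cyclotomic s dvd set_poly (Gs i) \<and> cyclotomic s dvd K}"

text \<open>
  \<open>modulo_product_form b k D K\<close>: the set \<open>D\<close> is a \<open>k\<close>-th order modulo product-form with respect
  to \<open>b\<close>, with associated polynomial \<open>K\<close>. The polynomial depends on the way \<open>D\<close> is generated,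
  hence it is an argument of the relation and not a function of \<open>D\<close>.
\<close>

inductive modulo_product_form :: "nat \<Rightarrow> nat \<Rightarrow> nat set \<Rightarrow> complex poly \<Rightarrow> bool"
  for b :: nat where
  first_order:
    "\<lbrakk>direct_decomposition E r Es; set_cong b E {0..<b};
      l 0 = 0; mono_on {..r} l;
      modulo_product b r Es l (first_order_indices b Es) D\<rbrakk>
     \<Longrightarrow> modulo_product_form b 1 D (kernel_poly b l (first_order_indices b Es) r)"
| higher_order:
    "\<lbrakk>modulo_product_form b k G K;
      direct_decomposition G r Gs;
      l 0 = 0; mono_on {..r} l;
      modulo_product b r Gs l (higher_order_indices K Gs) D\<rbrakk>
     \<Longrightarrow> modulo_product_form b (Suc k) D (kernel_poly b l (higher_order_indices K Gs) r)"

end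

theory Submission
  imports Defs "HOL-Library.Real_Mod"
begin

text \<open>
  The set \<open>Z\<close> of roots of unity at which the mask polynomial of \<open>D\<close> vanishes is closed under
  Galois conjugation, so it amounts to a set of orders \<open>p ^ x * q ^ y\<close>. A set \<open>D\<close> with \<open>b\<close>
  elements is a tile digit set iff for each \<open>n > 0\<close> some \<open>b ^ m\<close>-th root of unity with numerator
  \<open>n\<close> lies in \<open>Z\<close> (Kenyon's criterion, called \<open>blocking\<close> here). Congruences modulo \<open>n\<^sub>i\<close> keep the
  zeros whose order divides \<open>n\<^sub>i\<close>, and therefore modulo product-forms are blocking.

  Conversely, a tile digit set tiles a cyclic group, whose order can be taken to be
  \<open>p ^ c * q ^ d\<close> by Tijdeman's theorem. Sands' theorem on tilings whose order has two prime
  factors then shows that \<open>Z\<close> contains whole columns \<open>p ^ a * q ^ v\<close> and a row \<open>p ^ u * q ^ j\<close>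
  that together meet all diagonals of direction \<open>(\<alpha>, 1)\<close>. The outermost column or row says that
  \<open>D\<close> is, modulo some \<open>L\<close>, a sum of a set and an arithmetic progression whose difference is
  divisible by \<open>b\<close>. Dividing the progression by \<open>b\<close> gives a set \<open>G\<close> with smaller columns and rows,
  from which \<open>D\<close> arises as a modulo product-form of the next order.
\<close>

text \<open>As q occurs only once in b, the zeros of order \<open>q ^ y\<close> have a single
  exponent j, and counting factors p leaves exactly \<alpha> zeros of order \<open>p ^ a\<close>,
  one for each residue of a modulo \<alpha>. So a diagonal through a column can avoid its zeros only
  by meeting the row, and this determines the shape of the zeros. The danger is a zero of mixed
  order standing alone; off the columns, Sands' theorem excludes it by completing the row to its
  left.

  Two obstacles shape the converse. Invariance of D gives a congruence modulo L only, whereas the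
  definition asks for one modulo the l.c.m. of all orders in the new kernel. The induction therefore
  carries a bound on the orders in the kernel besides the form itself. Moreover, the set G must
  again have b elements with distinct sums. This comes from a growth argument: the product of the
  two mask polynomials is blocking, and a blocking polynomial that is nonzero at 1 has at least b
  exponents.\<close>

section \<open>Roots of unity and Fourier inversion on cyclic groups\<close>

definition rt :: "nat \<Rightarrow> nat \<Rightarrow> complex" where
  "rt m k = cis (2 * pi * real k / real m)"

lemma rt_0 [simp]: "rt m 0 = 1"
  by (simp add: rt_def)

lemma rt_add: "rt m (k + l) = rt m k * rt m l"
  by (simp add: rt_def cis_mult add_divide_distrib distrib_left)

lemma rt_power: "rt m k ^ n = rt m (n * k)"
  unfolding rt_def Complex.DeMoivre by (intro arg_cong[where f = cis]) (simp add: field_simps)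

lemma rt_cancel: "c > 0 \<Longrightarrow> rt (c * m) (c * k) = rt m k"
  unfolding rt_def by (intro arg_cong[where f = cis]) (simp add: field_simps)

lemma rt_eq_1_iff: assumes "m > 0" shows "rt m k = 1 \<longleftrightarrow> m dvd k"
proof
  assume "rt m k = 1"
  then obtain n :: int where "2 * pi * real k / real m = of_int n * (2 * pi)"
    unfolding rt_def cis_eq_1_iff by blast
  then have "real k = of_int n * real m"
    using assms by (simp add: field_simps)
  then have "int k = n * int m" by (metis of_int_eq_iff of_int_mult of_int_of_nat_eq)
  then show "m dvd k" by (metis dvd_triv_right int_dvd_int_iff)
next
  assume "m dvd k"
  then obtain j where "k = m * j" by blast
  then show "rt m k = 1" using assms
    unfolding rt_def by (simp add: cis_eq_1_iff) (metis mult.commute of_int_of_nat_eq)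
qed

lemma rt_mod: assumes "m > 0" shows "rt m (k mod m) = rt m k"
proof -
  have "rt m k = rt m (m * (k div m)) * rt m (k mod m)"
    by (metis rt_add mult_div_mod_eq)
  then show ?thesis using assms by (simp add: rt_eq_1_iff)
qed

lemma rt_cong: "m > 0 \<Longrightarrow> [k = l] (mod m) \<Longrightarrow> rt m k = rt m l"
  by (metis rt_mod cong_def)

lemma rt_nonzero [simp]: "rt m k \<noteq> 0"
  by (simp add: rt_def)

lemma rt_eq_iff: assumes "m > 0" shows "rt m k = rt m l \<longleftrightarrow> [k = l] (mod m)"
proof
  assume *: "rt m k = rt m l"
  have "[k' = l'] (mod m)" if "k' \<le> l'" "rt m k' = rt m l'" for k' l'
  proof -
    have "rt m l' = rt m k' * rt m (l' - k')" using that rt_add[of m k' "l' - k'"] by simp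
    then have "rt m (l' - k') = 1" using that by simp
    then obtain j where "l' - k' = m * j" using assms by (auto simp: rt_eq_1_iff)
    then have "l' = k' + m * j" using that by simp
    then show ?thesis by (simp add: cong_def)
  qed
  then show "[k = l] (mod m)" using * by (metis cong_sym nat_le_linear)
qed (use assms rt_cong in blast)

lemma sum_rt: assumes "m > 0"
  shows "(\<Sum>t<m. rt m (k * t)) = (if m dvd k then of_nat m else 0)"
proof -
  have eq: "(\<Sum>t<m. rt m (k * t)) = (\<Sum>t<m. rt m k ^ t)"
    by (simp add: rt_power mult.commute)
  show ?thesis
  proof (cases "m dvd k")
    case True
    then have "rt m k = 1" using assms by (simp add: rt_eq_1_iff)
    then show ?thesis using eq True by simp
  next
    case False
    then have "rt m k \<noteq> 1" using assms by (simp add: rt_eq_1_iff)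
    moreover have "rt m k ^ m = 1" using assms by (simp add: rt_power rt_eq_1_iff)
    ultimately show ?thesis using eq False by (simp add: sum_gp_strict)
  qed
qed

text \<open>Orthogonality of characters: weighting the k-th transform with
  \<open>rt m (k * (m - s))\<close> and summing over k isolates \<open>F s\<close>. The difference
  \<open>m - s\<close> stands for -s.\<close>

lemma dft_inj:
  fixes F :: "nat \<Rightarrow> complex"
  assumes "m > 0" and per: "\<And>t. F (t + m) = F t"
    and zero: "\<And>k. k < m \<Longrightarrow> (\<Sum>t<m. F t * rt m (k * t)) = 0"
  shows "F t = 0"
proof -
  have per': "F (t mod m) = F t" for t
  proof (induction t rule: less_induct)
    case (less t)
    show ?case
    proof (cases "t < m")
      case False
      then have "F ((t - m) mod m) = F (t - m)" using assms(1) less by simp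
      then show ?thesis using False per[of "t - m"] by (simp add: le_mod_geq)
    qed simp
  qed
  define s where "s = t mod m"
  have s: "s < m" using assms by (simp add: s_def)
  have "0 = (\<Sum>k<m. (\<Sum>t<m. F t * rt m (k * t)) * rt m (k * (m - s)))"
    by (simp add: zero)
  also have "\<dots> = (\<Sum>t<m. F t * (\<Sum>k<m. rt m ((t + (m - s)) * k)))"
    unfolding sum_distrib_right sum_distrib_left
    by (subst sum.swap) (simp add: rt_add[symmetric] mult.assoc algebra_simps)
  also have "\<dots> = (\<Sum>t<m. F t * (if t = s then of_nat m else 0))"
  proof (rule sum.cong)
    fix t assume "t \<in> {..<m}"
    then have "m dvd t + (m - s) \<longleftrightarrow> t = s"
    proof -
      have "t + (m - s) < 2 * m" "t + (m - s) > 0" using \<open>t \<in> {..<m}\<close> s by auto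
      moreover have "t + (m - s) = m * n \<Longrightarrow> n > 0 \<and> n < 2" for n
        using calculation by (metis mult.commute gr0I mult_0_right mult_less_cancel2 not_gr0)
      ultimately have "m dvd t + (m - s) \<longleftrightarrow> t + (m - s) = m"
        by (metis One_nat_def Suc_1 dvd_def dvd_refl less_2_cases mult.right_neutral less_numeral_extra(3))
      then show ?thesis using s by auto
    qed
    then show "F t * (\<Sum>k<m. rt m ((t + (m - s)) * k)) = F t * (if t = s then of_nat m else 0)"
      by (simp only: sum_rt[OF assms(1)])
  qed simp
  also have "\<dots> = F s * of_nat m" using s by (simp add: if_distrib cong: if_cong)
  finally have "F s = 0" using assms(1) by simp
  then show ?thesis using per' s_def by metis
qed

section \<open>Galois conjugation of roots of unity\<close>

definition int_eval :: "int poly \<Rightarrow> complex \<Rightarrow> complex" where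
  "int_eval f z = poly (map_poly of_int f) z"

lemma int_eval_0 [simp]: "int_eval 0 z = 0"
  by (simp add: int_eval_def)

lemma int_eval_pCons [simp]: "int_eval (pCons a f) z = of_int a + z * int_eval f z"
  by (simp add: int_eval_def map_poly_pCons)

lemma int_eval_1 [simp]: "int_eval 1 z = 1"
  by (simp add: one_pCons)

lemma int_eval_add [simp]: "int_eval (f + g) z = int_eval f z + int_eval g z"
proof -
  have "map_poly of_int (f + g) = map_poly of_int f + (map_poly of_int g :: complex poly)"
    by (intro poly_eqI) (simp add: coeff_map_poly)
  then show ?thesis by (simp add: int_eval_def)
qed

lemma int_eval_smult [simp]: "int_eval (smult c f) z = of_int c * int_eval f z"
  by (simp add: int_eval_def map_poly_smult)

lemma int_eval_minus [simp]: "int_eval (- f) z = - int_eval f z"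
  using int_eval_smult[of "-1" f z] by simp

lemma int_eval_diff [simp]: "int_eval (f - g) z = int_eval f z - int_eval g z"
  using int_eval_add[of f "- g" z] by simp

lemma int_eval_mult [simp]: "int_eval (f * g) z = int_eval f z * int_eval g z"
  by (induction f) (simp_all add: algebra_simps)

lemma int_eval_power [simp]: "int_eval (f ^ n) z = int_eval f z ^ n"
  by (induction n) simp_all

lemma int_eval_sum: "int_eval (sum f A) z = (\<Sum>a\<in>A. int_eval (f a) z)"
  by (induction A rule: infinite_finite_induct) simp_all

lemma int_eval_monom [simp]: "int_eval (monom c n) z = of_int c * z ^ n"
  by (simp add: int_eval_def map_poly_monom poly_monom)

lemma int_eval_pcompose_monom [simp]: "int_eval (pcompose f (monom 1 k)) z = int_eval f (z ^ k)"
  by (induction f) (simp_all add: pcompose_pCons)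

lemma prime_dvd_power_sum:
  fixes x y :: "'a :: comm_ring_1"
  assumes "prime r"
  shows "of_nat r dvd (x + y) ^ r - (x ^ r + y ^ r)"
proof -
  have r: "r > 0" using assms prime_gt_0_nat by blast
  have "(x + y) ^ r = (\<Sum>k\<le>r. of_nat (r choose k) * x ^ k * y ^ (r - k))"
    by (rule binomial_ring)
  also have "{..r} = insert 0 (insert r {0<..<r})" using r by auto
  finally have "(x + y) ^ r - (x ^ r + y ^ r)
      = (\<Sum>k\<in>{0<..<r}. of_nat (r choose k) * x ^ k * y ^ (r - k))"
    using r by simp
  also have "of_nat r dvd \<dots>"
  proof (rule dvd_sum)
    fix k assume "k \<in> {0<..<r}"
    then have "r dvd (r choose k)"
      using assms by (intro dvd_choose_prime) auto
    then have "(of_nat r :: 'a) dvd of_nat (r choose k)" by (metis dvd_def of_nat_mult)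
    then show "(of_nat r :: 'a) dvd of_nat (r choose k) * x ^ k * y ^ (r - k)"
      by (simp add: mult.assoc)
  qed
  finally show ?thesis .
qed

lemma fermat_int:
  assumes "prime r" shows "int r dvd a ^ r - a"
proof -
  have r: "r > 0" using assms prime_gt_0_nat by blast
  define n where "n = nat (a mod int r)"
  have n: "[a = int n] (mod int r)" using r by (simp add: n_def cong_def)
  have "int r dvd int n ^ r - int n"
  proof (induction n)
    case (Suc n)
    have "int r dvd (int n + 1) ^ r - (int n ^ r + 1 ^ r)"
      using prime_dvd_power_sum[OF assms, of "int n" 1] by simp
    then have "int r dvd ((int n + 1) ^ r - (int n ^ r + 1 ^ r)) + (int n ^ r - int n)"
      using Suc dvd_add by blast
    then show ?case by (simp add: algebra_simps)
  qed (use r in \<open>simp add: zero_power\<close>)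
  then have "[int n ^ r = int n] (mod int r)" by (simp add: cong_iff_dvd_diff)
  then have "[a ^ r = a] (mod int r)" using n by (meson cong_pow cong_sym cong_trans)
  then show ?thesis by (simp add: cong_iff_dvd_diff)
qed

text \<open>Induction over the coefficients: splitting off the constant term costs the mixed
  binomial terms, which are divisible by r, and Fermat's little theorem replaces
  \<open>a ^ r\<close> by a.\<close>

lemma frobenius_poly:
  fixes f :: "int poly"
  assumes "prime r"
  shows "of_nat r dvd f ^ r - pcompose f (monom 1 r)"
proof (induction f)
  case 0
  then show ?case using assms prime_gt_0_nat[OF assms] by (simp add: zero_power)
next
  case (pCons a f)
  let ?X = "monom (1::int) 1"
  have eq: "pCons a f = [:a:] + ?X * f" by (simp add: monom_altdef)
  have 1: "of_nat r dvd (pCons a f) ^ r - ([:a:] ^ r + (?X * f) ^ r)"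
    unfolding eq by (rule prime_dvd_power_sum[OF assms])
  have "of_nat r dvd [:a ^ r - a:]"
  proof -
    obtain c where "a ^ r - a = int r * c" using fermat_int[OF assms, of a] by blast
    then have "[:a ^ r - a:] = of_nat r * [:c:]" by (simp add: of_nat_poly)
    then show ?thesis by (rule dvdI)
  qed
  then have 2: "of_nat r dvd [:a:] ^ r - [:a:]"
    by (simp add: poly_const_pow)
  have 3: "of_nat r dvd ?X ^ r * (f ^ r - pcompose f (monom 1 r))"
    using pCons by simp
  have "(pCons a f) ^ r - pcompose (pCons a f) (monom 1 r)
     = ((pCons a f) ^ r - ([:a:] ^ r + (?X * f) ^ r)) + ([:a:] ^ r - [:a:])
       + ?X ^ r * (f ^ r - pcompose f (monom 1 r))"
    by (simp add: pcompose_pCons power_mult_distrib monom_power algebra_simps)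
  then show ?case using 1 2 3 by (metis dvd_add)
qed

text \<open>Gauss's lemma: passing to primitive parts removes the constant c up to sign.\<close>

lemma dvd_smult_primitive:
  fixes f g :: "int poly"
  assumes "content f = 1" "c \<noteq> 0" "f dvd smult c g"
  shows "f dvd g"
proof -
  have "primitive_part f dvd primitive_part (smult c g)" using assms(3) by blast
  then have "f dvd smult (unit_factor c) (primitive_part g)"
    using assms(1) by (simp add: primitive_part_prim primitive_part_smult)
  then have "f dvd primitive_part g"
    using assms(2) by (cases "c > 0") (auto simp: unit_factor_int_def sgn_if)
  then show ?thesis
    by (metis content_times_primitive_part dvd_smult)
qed

text \<open>A primitive integer polynomial of least degree with root z takes the role of the minimal
  polynomial over the rationals; staying over the integers keeps reduction modulo a prime
  available.\<close>

locale minimal_int_poly =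
  fixes f :: "int poly" and z :: complex and s :: nat
  assumes f: "content f = 1" "int_eval f z = 0"
    and minimal: "\<And>g. int_eval g z = 0 \<Longrightarrow> g = 0 \<or> degree f \<le> degree g"
    and s: "s > 0" "z ^ s = 1"
begin

lemma f_nz: "f \<noteq> 0" using f by auto

lemma dvd_of_root: assumes "int_eval g z = 0" shows "f dvd g"
proof -
  obtain q r where qr: "pseudo_divmod g f = (q, r)" by force
  define c where "c = coeff f (degree f) ^ (Suc (degree g) - degree f)"
  have c: "c \<noteq> 0" using f_nz by (simp add: c_def)
  have eq: "smult c g = f * q + r" and r: "r = 0 \<or> degree r < degree f"
    using pseudo_divmod[OF f_nz qr] by (simp_all add: c_def)
  have "int_eval r z = int_eval (smult c g) z - int_eval (f * q) z" by (simp add: eq)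
  then have "int_eval r z = 0" using assms f by simp
  then have "r = 0" using minimal r by force
  then have "f dvd smult c g" using eq by simp
  then show ?thesis using dvd_smult_primitive f c by blast
qed

text \<open>As f divides the monic \<open>monom 1 s - 1\<close>, its leading coefficient divides 1.
  Hence division by f works over the integers, free of the scaling factor of
  pseudo-division.\<close>

lemma lead_unit: "is_unit (lead_coeff f)"
proof -
  have "f dvd monom 1 s - 1"
    using s by (intro dvd_of_root) simp
  then obtain k where "monom 1 s - 1 = f * k" by blast
  then have "lead_coeff (monom 1 s - 1) = lead_coeff f * lead_coeff k" by (metis lead_coeff_mult)
  then have "lead_coeff f dvd lead_coeff (monom 1 s - 1)" by simp
  moreover have "lead_coeff (monom 1 s - 1 :: int poly) = 1"
  proof -
    have "degree (monom 1 s + - 1 :: int poly) = s"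
      using s by (subst degree_add_eq_left) (auto simp: degree_monom_eq)
    then have "degree (monom 1 s - 1 :: int poly) = s" by simp
    then show ?thesis using s by simp
  qed
  ultimately show ?thesis by simp
qed

lemma division: "\<exists>q r. g = f * q + r \<and> (r = 0 \<or> degree r < degree f)"
proof -
  obtain q r where qr: "pseudo_divmod g f = (q, r)" by force
  define c where "c = coeff f (degree f) ^ (Suc (degree g) - degree f)"
  have "is_unit c" using lead_unit unfolding c_def by (simp add: is_unit_power_iff power_abs)
  then have "c = 1 \<or> c = -1" by (simp add: abs_eq_iff')
  then have cc: "c * c = 1" by auto
  have eq: "smult c g = f * q + r" and r: "r = 0 \<or> degree r < degree f"
    using pseudo_divmod[OF f_nz qr] by (simp_all add: c_def)
  have "smult c (smult c g) = smult c (f * q + r)" by (simp only: eq)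
  then have "g = f * smult c q + smult c r"
    using cc by (simp add: smult_add_right)
  moreover have "smult c r = 0 \<or> degree (smult c r) < degree f" using r by auto
  ultimately show ?thesis by blast
qed

text \<open>The remainder \<open>R k\<close> of \<open>f (x ^ k)\<close> modulo \<open>f\<close> depends only on \<open>k mod s\<close>, hence its
  coefficients are bounded; for a prime \<open>r\<close> the Frobenius map shows that \<open>R r\<close> is divisible by
  \<open>r\<close>, so it vanishes when \<open>r\<close> is large. This is Landau's irreducibility proof for cyclotomic polynomials.\<close>

lemma root_prime_power:
  "\<exists>B. \<forall>r w. prime r \<longrightarrow> r > B \<longrightarrow> w ^ s = 1 \<longrightarrow> int_eval f w = 0 \<longrightarrow> int_eval f (w ^ r) = 0"
proof -
  have "\<forall>k. \<exists>r. \<exists>q. pcompose f (monom 1 k) = f * q + r \<and> (r = 0 \<or> degree r < degree f)"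
    using division by blast
  then obtain R where R: "\<And>k. \<exists>q. pcompose f (monom 1 k) = f * q + R k"
    and Rdeg: "\<And>k. R k = 0 \<or> degree (R k) < degree f"
    by metis
  define B where "B = (\<Sum>k<s. \<Sum>i\<le>degree (R k). \<bar>coeff (R k) i\<bar>)"
  have B: "\<bar>coeff (R k) i\<bar> \<le> B" if "k < s" for k i
  proof (cases "i \<le> degree (R k)")
    case True
    have "\<bar>coeff (R k) i\<bar> \<le> (\<Sum>i\<le>degree (R k). \<bar>coeff (R k) i\<bar>)"
      using True by (intro member_le_sum) auto
    also have "\<dots> \<le> B" unfolding B_def
      using that by (intro member_le_sum[where f = "\<lambda>k. \<Sum>i\<le>degree (R k). \<bar>coeff (R k) i\<bar>"])
        (auto intro: sum_nonneg)
    finally show ?thesis .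
  next
    case False
    then show ?thesis by (simp add: coeff_eq_0 B_def sum_nonneg)
  qed
  have "int_eval f (w ^ r) = 0" if r: "prime r" "r > nat B" and w: "w ^ s = 1" "int_eval f w = 0" for r w
  proof -
    define k where "k = r mod s"
    have k: "k < s" using s by (simp add: k_def)
    have pw: "v ^ r = v ^ k" if "v ^ s = 1" for v :: complex
    proof -
      have "v ^ r = (v ^ s) ^ (r div s) * v ^ k"
        unfolding k_def by (simp flip: power_mult power_add)
      then show ?thesis using that by simp
    qed
    obtain h where h: "f ^ r - pcompose f (monom 1 r) = of_nat r * h"
      using frobenius_poly[OF r(1)] by blast
    obtain q h' where h': "h = f * q + h'" "h' = 0 \<or> degree h' < degree f"
      using division by blast
    obtain q' where q': "pcompose f (monom 1 k) = f * q' + R k" using R by blast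
    have "int_eval (f ^ r - pcompose f (monom 1 r)) z = - int_eval f (z ^ r)"
      using f prime_gt_0_nat[OF r(1)] by simp
    moreover have "int_eval f (z ^ r) = int_eval (R k) z"
    proof -
      have "int_eval f (z ^ r) = int_eval (pcompose f (monom 1 k)) z" using pw[OF s(2)] by simp
      then show ?thesis using q' f by simp
    qed
    moreover have "int_eval (of_nat r * h) z = of_nat r * int_eval h' z"
      using h' f by (simp add: of_nat_poly)
    ultimately have "- int_eval (R k) z = of_nat r * int_eval h' z" by (simp only: h)
    \<comment> \<open>This combination has degree below that of f and vanishes at z, so it is zero
      by minimality; thus r divides all coefficients of \<open>R k\<close>, which are smaller than
      r.\<close>
    then have "int_eval (R k + smult (int r) h') z = 0"
      by (metis int_eval_add int_eval_smult of_int_of_nat_eq add.right_inverse)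
    moreover have "R k + smult (int r) h' = 0 \<or> degree (R k + smult (int r) h') < degree f"
    proof (cases "R k = 0 \<or> h' = 0")
      case True
      then show ?thesis using Rdeg[of k] h'(2) prime_gt_0_nat[OF r(1)] by auto
    next
      case False
      then show ?thesis using Rdeg[of k] h'(2) prime_gt_0_nat[OF r(1)]
        by (intro disjI2 degree_add_less) auto
    qed
    ultimately have "R k + smult (int r) h' = 0" using minimal by force
    then have Rk: "R k = smult (- int r) h'" by (simp add: eq_neg_iff_add_eq_0)
    have "R k = 0"
    proof (rule poly_eqI)
      fix i
      have "int r dvd coeff (R k) i" using Rk by simp
      moreover have "\<bar>coeff (R k) i\<bar> < int r" using B[OF k, of i] r(2) by linarith
      ultimately show "coeff (R k) i = coeff 0 i"
        using dvd_imp_le_int[of "coeff (R k) i" "int r"] by force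
    qed
    then have "int_eval f (w ^ k) = 0" using q' w by (metis add.right_neutral int_eval_mult int_eval_pcompose_monom mult_zero_left)
    then show ?thesis using pw[OF w(1)] by simp
  qed
  then show ?thesis by blast
qed

lemma root_coprime_power:
  assumes "coprime k s" shows "int_eval f (z ^ k) = 0"
proof -
  obtain B where B: "\<And>r w. prime r \<Longrightarrow> r > B \<Longrightarrow> w ^ s = 1 \<Longrightarrow> int_eval f w = 0 \<Longrightarrow> int_eval f (w ^ r) = 0"
    using root_prime_power by blast
  have main: "int_eval f (z ^ m) = 0" if "m > 0" "\<And>r. prime r \<Longrightarrow> r dvd m \<Longrightarrow> r > B" for m
    using that
  proof (induction m rule: less_induct)
    case (less m)
    show ?case
    proof (cases "m = 1")
      case False
      then obtain r where r: "prime r" "r dvd m" using prime_factor_nat by blast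
      then obtain m' where m': "m = r * m'" by blast
      have "m' > 0" "m' < m" using m' less.prems(1) prime_gt_1_nat[OF r(1)] by auto
      then have "int_eval f (z ^ m') = 0" using less m' by auto
      moreover have "(z ^ m') ^ s = 1" using s by (metis power_mult mult.commute power_one)
      ultimately have "int_eval f ((z ^ m') ^ r) = 0" using B r less.prems by blast
      then show ?thesis by (metis m' power_mult mult.commute)
    qed (use f in simp)
  qed
  \<comment> \<open>\<open>k + s * Q\<close> is congruent to k modulo s and has no prime factor up
    to B: such a prime divides exactly one of k and \<open>s * Q\<close>.\<close>
  define Q where "Q = \<Prod>{r. prime r \<and> r \<le> B \<and> \<not> r dvd k}"
  have finQ: "finite {r. prime r \<and> r \<le> B \<and> \<not> r dvd k}" by simp
  have "int_eval f (z ^ (k + s * Q)) = 0"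
  proof (rule main)
    have "Q > 0" unfolding Q_def by (intro prod_pos) (auto simp: prime_gt_0_nat)
    then show "k + s * Q > 0" using s by simp
    fix r assume r: "prime r" "r dvd k + s * Q"
    show "r > B"
    proof (rule ccontr)
      assume "\<not> r > B"
      show False
      proof (cases "r dvd k")
        case True
        then have "r dvd s * Q" using r by (simp add: dvd_add_right_iff)
        moreover have "\<not> r dvd s" using True assms r by (metis coprime_common_divisor not_prime_unit)
        ultimately have "r dvd Q" using r prime_dvd_mult_iff by blast
        then obtain r' where "prime r'" "\<not> r' dvd k" "r dvd r'"
          unfolding Q_def using prime_dvd_prod_iff[OF finQ r(1)] by auto
        then show False using True r primes_dvd_imp_eq by blast
      next
        case False
        then have "r dvd Q" unfolding Q_def
          using finQ r \<open>\<not> r > B\<close> by (intro dvd_prodI[where f = "\<lambda>x. x"]) auto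
        then show False using False r by (simp add: dvd_add_left_iff)
      qed
    qed
  qed
  moreover have "z ^ (k + s * Q) = z ^ k" using s by (simp add: power_add power_mult)
  ultimately show ?thesis by simp
qed

end

lemma galois_int_poly:
  assumes "int_eval P z = 0" "z ^ s = 1" "s > 0" "coprime k s"
  shows "int_eval P (z ^ k) = 0"
proof -
  have "\<exists>g. g \<noteq> 0 \<and> int_eval g z = 0"
  proof (intro exI conjI)
    show "monom 1 s - 1 \<noteq> (0 :: int poly)"
    proof
      assume "monom 1 s - 1 = (0 :: int poly)"
      then have "coeff (monom 1 s :: int poly) s = coeff 1 s" by simp
      then show False using assms(3) by (simp del: One_nat_def)
    qed
    show "int_eval (monom 1 s - 1) z = 0" using assms(2) by simp
  qed
  then obtain g where g: "g \<noteq> 0" "int_eval g z = 0"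
    and gmin: "\<And>h. h \<noteq> 0 \<and> int_eval h z = 0 \<Longrightarrow> degree g \<le> degree h"
    using ex_has_least_nat[of "\<lambda>g. g \<noteq> 0 \<and> int_eval g z = 0" _ degree] by blast
  define f where "f = primitive_part g"
  have "of_int (content g) * int_eval f z = int_eval g z"
    unfolding f_def by (simp flip: int_eval_smult)
  then have "int_eval f z = 0" using g by simp
  then interpret minimal_int_poly f z s
    using g gmin assms by unfold_locales (auto simp: f_def)
  have "f dvd P" using assms(1) by (rule dvd_of_root)
  then show ?thesis using root_coprime_power[OF assms(4)] by auto
qed

section \<open>Zeros of mask polynomials and residue classes\<close>

definition ev :: "nat set \<Rightarrow> complex \<Rightarrow> complex" where
  "ev D z = (\<Sum>a\<in>D. z ^ a)"

lemma poly_set_poly: "poly (set_poly D) z = ev D z"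
  by (simp add: set_poly_def ev_def poly_sum poly_monom)

lemma ev_rt: "ev D (rt m k) = (\<Sum>a\<in>D. rt m (k * a))"
  by (simp add: ev_def rt_power mult.commute)

lemma ev_1 [simp]: "ev D 1 = of_nat (card D)"
  by (simp add: ev_def)

lemma ev_galois_power:
  assumes "ev D z = 0" "z ^ s = 1" "s > 0" "coprime k s"
  shows "ev D (z ^ k) = 0"
proof -
  have *: "int_eval (\<Sum>a\<in>D. monom 1 a) w = ev D w" for w
    by (simp add: int_eval_sum ev_def)
  show ?thesis using galois_int_poly[of "\<Sum>a\<in>D. monom 1 a" z s k] assms by (simp only: *)
qed

lemma ev_galois:
  assumes "m > 0" "coprime k m" "coprime l m" "ev D (rt m k) = 0"
  shows "ev D (rt m l) = 0"
proof -
  obtain x where x: "[k * x = 1] (mod m)" using cong_solve_coprime_nat[OF assms(2)] by auto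
  have kxl: "[k * (x * l) = l] (mod m)"
    using cong_mult[OF x cong_refl[of l]] by (simp add: mult.assoc)
  then have "coprime (k * (x * l)) m" using assms(3) by (metis cong_imp_coprime cong_sym)
  then have "coprime (x * l) m" by simp
  moreover have "rt m k ^ m = 1" using assms(1) by (simp add: rt_power rt_eq_1_iff)
  ultimately have "ev D (rt m k ^ (x * l)) = 0" using assms ev_galois_power by blast
  then show ?thesis using rt_cong[OF assms(1) kxl] by (simp add: rt_power mult.commute)
qed

text \<open>By Galois conjugation a single primitive m-th root of unity decides about all of them
  (\<open>zr_iff\<close>), so zeros are recorded by their order.\<close>

definition zr :: "nat set \<Rightarrow> nat \<Rightarrow> bool" where
  "zr D m \<longleftrightarrow> ev D (rt m 1) = 0"

lemma zr_iff: "m > 0 \<Longrightarrow> coprime k m \<Longrightarrow> zr D m \<longleftrightarrow> ev D (rt m k) = 0"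
  unfolding zr_def using ev_galois[of m] by (meson coprime_1_left)

lemma linear_prod_dvd:
  fixes p :: "complex poly"
  assumes "finite A"
  shows "(\<Prod>a\<in>A. [:- a, 1:]) dvd p \<longleftrightarrow> (\<forall>a\<in>A. poly p a = 0)"
  using assms
proof (induction A arbitrary: p)
  case (insert x A)
  show ?case
  proof
    assume "(\<Prod>a\<in>insert x A. [:- a, 1:]) dvd p"
    then obtain g where "p = (\<Prod>a\<in>insert x A. [:- a, 1:]) * g" by blast
    then show "\<forall>a\<in>insert x A. poly p a = 0" using insert.hyps by (auto simp: poly_prod)
  next
    assume *: "\<forall>a\<in>insert x A. poly p a = 0"
    then obtain g where g: "p = [:- x, 1:] * g" by (auto simp: poly_eq_0_iff_dvd)
    have "poly g a = 0" if "a \<in> A" for a using * insert.hyps that unfolding g by auto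
    then have "(\<Prod>a\<in>A. [:- a, 1:]) dvd g" using insert.IH by blast
    then show "(\<Prod>a\<in>insert x A. [:- a, 1:]) dvd p" using insert.hyps g by (simp add: mult_dvd_mono del: mult_pCons_left)
  qed
qed simp

lemma cyclotomic_altdef:
  assumes "m > 0"
  shows "cyclotomic m = (\<Prod>a\<in>rt m ` totatives m. [:- a, 1:])"
proof -
  have "inj_on (rt m) (totatives m)"
  proof (rule inj_onI)
    fix k l assume kl: "k \<in> totatives m" "l \<in> totatives m" "rt m k = rt m l"
    then have "[k = l] (mod m)" using assms by (simp add: rt_eq_iff)
    moreover have "0 < k" "k \<le> m" "0 < l" "l \<le> m" using kl by (auto simp: totatives_def)
    ultimately show "k = l"
      by (cases "k = m"; cases "l = m") (auto simp: cong_def)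
  qed
  then have "(\<Prod>a\<in>rt m ` totatives m. [:- a, 1:]) = (\<Prod>k\<in>totatives m. [:- rt m k, 1:])"
    by (simp add: prod.reindex)
  then show ?thesis by (simp add: cyclotomic_def rt_def)
qed

lemma poly_cyclotomic_eq_0_iff:
  assumes "m > 0"
  shows "poly (cyclotomic m) z = 0 \<longleftrightarrow> (\<exists>k. coprime k m \<and> z = rt m k)"
proof -
  have "poly (cyclotomic m) z = 0 \<longleftrightarrow> (\<exists>k\<in>totatives m. z = rt m k)"
    by (auto simp: cyclotomic_def poly_prod rt_def)
  also have "\<dots> \<longleftrightarrow> (\<exists>k. coprime k m \<and> z = rt m k)"
  proof
    assume "\<exists>k. coprime k m \<and> z = rt m k"
    then obtain k where k: "coprime k m" "z = rt m k" by blast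
    show "\<exists>k\<in>totatives m. z = rt m k"
    proof (cases "m = 1")
      case True
      then have "z = rt m 1" using k by (simp add: rt_eq_iff cong_def)
      moreover have "1 \<in> totatives m" using True by (simp add: totatives_def)
      ultimately show ?thesis by blast
    next
      case False
      have "coprime (k mod m) m" using k assms by (simp add: coprime_commute)
      moreover from this have "k mod m > 0" using False by (intro Nat.gr0I) auto
      ultimately have "k mod m \<in> totatives m"
        using assms by (auto simp: totatives_def intro: less_imp_le)
      then show ?thesis using k(2) rt_mod[OF assms, of k] by (intro bexI[of _ "k mod m"]) simp
    qed
  qed (auto simp: totatives_def)
  finally show ?thesis .
qed

lemma cyclotomic_dvd_iff_roots:
  assumes "m > 0"
  shows "cyclotomic m dvd P \<longleftrightarrow> (\<forall>k. coprime k m \<longrightarrow> poly P (rt m k) = 0)"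
proof -
  have "cyclotomic m dvd P \<longleftrightarrow> (\<forall>a\<in>rt m ` totatives m. poly P a = 0)"
    unfolding cyclotomic_altdef[OF assms] by (rule linear_prod_dvd) simp
  also have "rt m ` totatives m = {z. poly (cyclotomic m) z = 0}"
    unfolding cyclotomic_altdef[OF assms] by (auto simp: poly_prod)
  finally show ?thesis using poly_cyclotomic_eq_0_iff[OF assms] by auto
qed

lemma cyclotomic_dvd_set_poly: "m > 0 \<Longrightarrow> cyclotomic m dvd set_poly D \<longleftrightarrow> zr D m"
  by (auto simp: cyclotomic_dvd_iff_roots poly_set_poly zr_iff) (simp add: zr_def)

definition cnt :: "nat set \<Rightarrow> nat \<Rightarrow> nat \<Rightarrow> nat" where
  "cnt D m r = card {x \<in> D. [x = r] (mod m)}"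

lemma cnt_cong: "[r = s] (mod m) \<Longrightarrow> cnt D m r = cnt D m s"
  unfolding cnt_def cong_def by simp

lemma cnt_periodic: "cnt D m (t + m) = cnt D m t"
  by (rule cnt_cong) (simp add: cong_def)

lemma ev_cnt:
  assumes "finite D" "m > 0"
  shows "ev D (rt m k) = (\<Sum>t<m. of_nat (cnt D m t) * rt m (k * t))"
proof -
  have "ev D (rt m k) = (\<Sum>t<m. \<Sum>a\<in>{a \<in> D. a mod m = t}. rt m (k * a))"
  proof -
    have "(\<lambda>a. a mod m) ` D \<subseteq> {..<m}" using assms by auto
    then show ?thesis
      unfolding ev_rt using sum.group[OF assms(1) finite_lessThan, of "\<lambda>a. a mod m" m "\<lambda>a. rt m (k * a)"]
      by simp
  qed
  also have "\<dots> = (\<Sum>t<m. of_nat (cnt D m t) * rt m (k * t))"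
  proof (rule sum.cong)
    fix t assume t: "t \<in> {..<m}"
    have "{a \<in> D. a mod m = t} = {a \<in> D. [a = t] (mod m)}" using t by (auto simp: cong_def)
    moreover have "rt m (k * a) = rt m (k * t)" if "a \<in> {a \<in> D. [a = t] (mod m)}" for a
      by (rule rt_cong[OF assms(2) cong_mult[OF cong_refl]]) (use that in simp)
    ultimately have "(\<Sum>a\<in>{a \<in> D. a mod m = t}. rt m (k * a)) = (\<Sum>a\<in>{a \<in> D. [a = t] (mod m)}. rt m (k * t))"
      by (rule sum.cong)
    then show "(\<Sum>a\<in>{a \<in> D. a mod m = t}. rt m (k * a)) = of_nat (cnt D m t) * rt m (k * t)"
      by (simp add: cnt_def)
  qed simp
  finally show ?thesis .
qed

lemma sum_shift_periodic:
  fixes G :: "nat \<Rightarrow> complex"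
  assumes "\<And>t. G (t + m) = G t"
  shows "(\<Sum>t<m. G (t + h)) = (\<Sum>t<m. G t)"
proof (induction h)
  case (Suc h)
  have "(\<Sum>t<m. G (t + Suc h)) = (\<Sum>t<m. G (Suc t + h))" by simp
  also have "\<dots> + G h = (\<Sum>t<Suc m. G (t + h))" by (subst sum.lessThan_Suc_shift) simp
  also have "\<dots> = (\<Sum>t<m. G (t + h)) + G h" using assms[of h] by (simp add: add.commute)
  finally show ?case using Suc by simp
qed simp

lemma ev_cnt_shift:
  assumes "finite D" "m > 0"
  shows "(\<Sum>t<m. of_nat (cnt D m (t + h)) * rt m (k * t)) * rt m (k * h) = ev D (rt m k)"
proof -
  have "(\<Sum>t<m. of_nat (cnt D m (t + h)) * rt m (k * t)) * rt m (k * h)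
      = (\<Sum>t<m. of_nat (cnt D m (t + h)) * rt m (k * (t + h)))"
    by (simp add: sum_distrib_right distrib_left rt_add mult.assoc)
  also have "\<dots> = (\<Sum>t<m. of_nat (cnt D m t) * rt m (k * t))"
  proof (rule sum_shift_periodic[where G = "\<lambda>t. of_nat (cnt D m t) * rt m (k * t)"])
    fix t
    have "rt m (k * (t + m)) = rt m (k * t)"
      using assms by (intro rt_cong) (auto simp: cong_def distrib_left)
    then show "of_nat (cnt D m (t + m)) * rt m (k * (t + m)) = of_nat (cnt D m t) * rt m (k * t)"
      by (simp only: cnt_periodic)
  qed
  finally show ?thesis using ev_cnt[OF assms] by simp
qed

text \<open>Up to a nonzero factor, the transform of the difference of counts at
  \<open>t + h\<close> and t is \<open>ev D (rt m k)\<close> times \<open>1 - rt m (k * h)\<close>,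
  and the latter vanishes exactly when r divides k. Shift invariance is thus the arithmetic form of
  vanishing at all m-th roots of unity that are not h-th roots of unity.\<close>

lemma cnt_shift_invariant_iff:
  assumes "finite D" "m = r * h" "m > 0"
  shows "(\<forall>k. r dvd k \<or> ev D (rt m k) = 0) \<longleftrightarrow> (\<forall>t. cnt D m (t + h) = cnt D m t)"
proof -
  define F where "F t = (of_nat (cnt D m (t + h)) - of_nat (cnt D m t) :: complex)" for t
  have F: "(\<Sum>t<m. F t * rt m (k * t)) * rt m (k * h) = ev D (rt m k) * (1 - rt m (k * h))" for k
    using ev_cnt_shift[OF assms(1,3), of h k] ev_cnt[OF assms(1,3), of k]
    by (simp add: F_def left_diff_distrib sum_subtractf right_diff_distrib)
  have one: "rt m (k * h) = 1 \<longleftrightarrow> r dvd k" for k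
    using assms by (simp add: rt_eq_1_iff)
  show ?thesis
  proof
    assume *: "\<forall>k. r dvd k \<or> ev D (rt m k) = 0"
    have "F t = 0" for t
    proof (rule dft_inj[OF assms(3)])
      show "F (t + m) = F t" for t
        using cnt_periodic[of D m t] cnt_periodic[of D m "t + h"] by (simp add: F_def add_ac)
      show "(\<Sum>t<m. F t * rt m (k * t)) = 0" for k
      proof -
        have "ev D (rt m k) * (1 - rt m (k * h)) = 0" using * one[of k] by auto
        then have "(\<Sum>t<m. F t * rt m (k * t)) * rt m (k * h) = 0" by (simp only: F)
        then show ?thesis by simp
      qed
    qed
    then show "\<forall>t. cnt D m (t + h) = cnt D m t" by (simp add: F_def)
  next
    assume "\<forall>t. cnt D m (t + h) = cnt D m t"
    then have "F t = 0" for t by (simp add: F_def)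
    then have "ev D (rt m k) * (1 - rt m (k * h)) = 0" for k using F[of k] by simp
    then show "\<forall>k. r dvd k \<or> ev D (rt m k) = 0" using one by fastforce
  qed
qed

text \<open>The same computation for the mixed second difference with shifts h and l, whose
  transform carries the factor \<open>(1 - rt m (k * h)) * (1 - rt m (k * l))\<close>.\<close>

lemma cnt_mixed_iff:
  assumes "finite D" "m = p * h" "m = q * l" "m > 0"
  shows "(\<forall>k. p dvd k \<or> q dvd k \<or> ev D (rt m k) = 0) \<longleftrightarrow>
    (\<forall>t. cnt D m t + cnt D m (t + h + l) = cnt D m (t + h) + cnt D m (t + l))"
proof -
  define F where "F t = (of_nat (cnt D m t) - of_nat (cnt D m (t + h)) - of_nat (cnt D m (t + l))
    + of_nat (cnt D m (t + (h + l))) :: complex)" for t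
  have F: "(\<Sum>t<m. F t * rt m (k * t)) * (rt m (k * h) * rt m (k * l))
      = ev D (rt m k) * ((1 - rt m (k * h)) * (1 - rt m (k * l)))" for k
  proof -
    define E where "E h = (\<Sum>t<m. of_nat (cnt D m (t + h)) * rt m (k * t))" for h
    have E: "E h * rt m (k * h) = ev D (rt m k)" for h
      unfolding E_def by (rule ev_cnt_shift[OF assms(1,4)])
    have "(\<Sum>t<m. F t * rt m (k * t)) = E 0 - E h - E l + E (h + l)"
      by (simp add: F_def E_def algebra_simps sum.distrib sum_subtractf)
    moreover have "E (h + l) * (rt m (k * h) * rt m (k * l)) = ev D (rt m k)"
      using E[of "h + l"] by (simp add: distrib_left rt_add)
    moreover have "E 0 = ev D (rt m k)" using E[of 0] by simp
    ultimately show ?thesis using E[of h] E[of l] by algebra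
  qed
  have one: "rt m (k * h) = 1 \<longleftrightarrow> p dvd k" "rt m (k * l) = 1 \<longleftrightarrow> q dvd k" for k
  proof -
    have "h > 0" using assms(2,4) by auto
    moreover have "l > 0" using assms(3,4) by auto
    ultimately have "m dvd k * h \<longleftrightarrow> p dvd k" "m dvd k * l \<longleftrightarrow> q dvd k"
      by (simp add: assms(2), simp add: assms(3))
    then show "rt m (k * h) = 1 \<longleftrightarrow> p dvd k" "rt m (k * l) = 1 \<longleftrightarrow> q dvd k"
      using assms(4) by (simp_all add: rt_eq_1_iff)
  qed
  show ?thesis
  proof
    assume *: "\<forall>k. p dvd k \<or> q dvd k \<or> ev D (rt m k) = 0"
    have F0: "F t = 0" for t
    proof (rule dft_inj[OF assms(4)])
      show "F (t + m) = F t" for t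
        using cnt_periodic[of D m t] cnt_periodic[of D m "t + h"] cnt_periodic[of D m "t + l"]
          cnt_periodic[of D m "t + (h + l)"] by (simp add: F_def add_ac)
      show "(\<Sum>t<m. F t * rt m (k * t)) = 0" for k
      proof -
        have "ev D (rt m k) * ((1 - rt m (k * h)) * (1 - rt m (k * l))) = 0" using * one[of k] by auto
        then have "(\<Sum>t<m. F t * rt m (k * t)) * (rt m (k * h) * rt m (k * l)) = 0" by (simp only: F)
        then show ?thesis by simp
      qed
    qed
    show "\<forall>t. cnt D m t + cnt D m (t + h + l) = cnt D m (t + h) + cnt D m (t + l)"
    proof
      fix t
      have "(of_nat (cnt D m t + cnt D m (t + h + l)) :: complex) = of_nat (cnt D m (t + h) + cnt D m (t + l))"
        using F0[of t] by (simp add: F_def algebra_simps)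
      then show "cnt D m t + cnt D m (t + h + l) = cnt D m (t + h) + cnt D m (t + l)"
        by (simp only: of_nat_eq_iff)
    qed
  next
    assume *: "\<forall>t. cnt D m t + cnt D m (t + h + l) = cnt D m (t + h) + cnt D m (t + l)"
    have "F t = 0" for t
    proof -
      have "(of_nat (cnt D m t + cnt D m (t + h + l)) :: complex) = of_nat (cnt D m (t + h) + cnt D m (t + l))"
        using * by (simp only:)
      then show ?thesis by (simp add: F_def algebra_simps)
    qed
    then have "ev D (rt m k) * ((1 - rt m (k * h)) * (1 - rt m (k * l))) = 0" for k using F[of k] by simp
    then show "\<forall>k. p dvd k \<or> q dvd k \<or> ev D (rt m k) = 0" using one by fastforce
  qed
qed

section \<open>Tilings of finite cyclic groups\<close>

definition tiling :: "nat \<Rightarrow> nat set \<Rightarrow> nat set \<Rightarrow> bool" where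
  "tiling N D C \<longleftrightarrow> N > 0 \<and> finite D \<and> finite C \<and>
     bij_betw (\<lambda>(d, c). (d + c) mod N) (D \<times> C) {..<N}"

lemma tiling_commute: assumes "tiling N D C" shows "tiling N C D"
proof -
  have "bij_betw prod.swap (C \<times> D) (D \<times> C)"
    by (simp add: bij_betw_def inj_on_def product_swap)
  moreover have "bij_betw (\<lambda>(d, c). (d + c) mod N) (D \<times> C) {..<N}"
    using assms by (simp add: tiling_def)
  ultimately have "bij_betw ((\<lambda>(d, c). (d + c) mod N) \<circ> prod.swap) (C \<times> D) {..<N}"
    by (rule bij_betw_trans)
  moreover have "(\<lambda>(d, c). (d + c) mod N) \<circ> prod.swap = (\<lambda>(d, c). (d + c) mod N)"
    by (auto simp: fun_eq_iff add.commute)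
  ultimately show ?thesis using assms by (simp add: tiling_def)
qed

lemma tiling_card: assumes "tiling N D C" shows "card D * card C = N"
  using assms bij_betw_same_card[of _ "D \<times> C" "{..<N}"] by (auto simp: tiling_def card_cartesian_product)

lemma tilingI_surj:
  assumes "N > 0" "finite D" "finite C" "card D * card C = N"
    and "\<And>n. n < N \<Longrightarrow> \<exists>d\<in>D. \<exists>c\<in>C. (d + c) mod N = n"
  shows "tiling N D C"
proof -
  let ?f = "\<lambda>(d, c). (d + c) mod N"
  have im: "?f ` (D \<times> C) = {..<N}"
    using assms(1,5) by (fastforce simp: image_iff)
  moreover have "inj_on ?f (D \<times> C)"
    using assms im by (intro eq_card_imp_inj_on) (auto simp: card_cartesian_product)
  ultimately show ?thesis using assms by (simp add: tiling_def bij_betw_def)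
qed

lemma tiling_unique:
  assumes "tiling N D C" "d \<in> D" "d' \<in> D" "c \<in> C" "c' \<in> C" "[d + c = d' + c'] (mod N)"
  shows "d = d' \<and> c = c'"
proof -
  have "inj_on (\<lambda>(d, c). (d + c) mod N) (D \<times> C)"
    using assms(1) by (simp add: tiling_def bij_betw_def)
  from inj_onD[OF this, of "(d, c)" "(d', c')"] show ?thesis using assms(2-)
    by (auto simp: cong_def)
qed

lemma tiling_cover:
  assumes "tiling N D C" obtains d c where "d \<in> D" "c \<in> C" "[d + c = n] (mod N)"
proof -
  have "n mod N \<in> (\<lambda>(d, c). (d + c) mod N) ` (D \<times> C)"
    using assms by (auto simp: tiling_def bij_betw_def)
  then show ?thesis using that by (auto simp: cong_def)
qed

text \<open>Repeating C with period N enlarges the period. This is how the exponent of p in the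
  period is later made as large as needed.\<close>

lemma tiling_extend:
  assumes "tiling N D C" "k > 0"
  shows "tiling (N * k) D ((\<lambda>(c, i). c + N * i) ` (C \<times> {..<k}))" (is "tiling _ _ ?C'")
proof (rule tilingI_surj)
  have N: "N > 0" "finite D" "finite C" using assms by (auto simp: tiling_def)
  show "N * k > 0" "finite D" "finite ?C'" using N assms by auto
  have ex: "\<exists>d\<in>D. \<exists>c\<in>?C'. (d + c) mod (N * k) = n" if n: "n < N * k" for n
  proof -
    obtain d c where dc: "d \<in> D" "c \<in> C" "[d + c = n] (mod N)" using tiling_cover[OF assms(1)] by metis
    obtain j where j: "[d + c + N * j = n] (mod N * k)"
    proof -
      have "[n + N * k * (d + c) = d + c] (mod N)"
        using dc(3) by (simp add: cong_def mult.assoc)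
      moreover have "d + c \<le> n + N * k * (d + c)" using N(1) assms(2)
        by (simp add: mult.commute trans_le_add2)
      ultimately have "N dvd n + N * k * (d + c) - (d + c)" by (simp add: cong_altdef_nat)
      then obtain j where "n + N * k * (d + c) - (d + c) = N * j" by blast
      then have "n + N * k * (d + c) = d + c + N * j"
        using \<open>d + c \<le> n + N * k * (d + c)\<close> by linarith
      then have "[d + c + N * j = n] (mod N * k)" by (metis cong_def mod_mult_self2)
      then show ?thesis by (rule that)
    qed
    have "[d + (c + N * (j mod k)) = d + c + N * j] (mod N * k)"
      unfolding mult_mod_right cong_def by (simp only: add.assoc[symmetric] mod_add_right_eq)
    then have "(d + (c + N * (j mod k))) mod (N * k) = n"
      using j n by (simp add: cong_def)
    moreover have "c + N * (j mod k) \<in> ?C'" using dc assms(2) by force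
    ultimately show ?thesis using dc by blast
  qed
  show "\<exists>d\<in>D. \<exists>c\<in>?C'. (d + c) mod (N * k) = n" if "n < N * k" for n using ex[OF that] .
  have "card ?C' \<le> card C * k"
    using card_image_le[of "C \<times> {..<k}"] N by (simp add: card_cartesian_product)
  then have "card D * card ?C' \<le> N * k"
    using tiling_card[OF assms(1)] by (metis mult.assoc mult_le_mono2)
  moreover have "N * k \<le> card D * card ?C'"
  proof -
    have "{..<N * k} \<subseteq> (\<lambda>(d, c). (d + c) mod (N * k)) ` (D \<times> ?C')"
      using ex by (fastforce simp: image_iff)
    then have "card {..<N * k} \<le> card ((\<lambda>(d, c). (d + c) mod (N * k)) ` (D \<times> ?C'))"
      by (rule card_mono[rotated]) (use N in auto)
    also have "\<dots> \<le> card (D \<times> ?C')" by (rule card_image_le) (use N in auto)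
    finally show ?thesis by (simp add: card_cartesian_product)
  qed
  ultimately show "card D * card ?C' = N * k" by simp
qed

section \<open>Tijdeman's theorem on dilating one factor of a tiling\<close>

definition ipset :: "nat set \<Rightarrow> int poly" where
  "ipset D = (\<Sum>a\<in>D. monom 1 a)"

lemma dvd_monom_mod: "monom (1::int) N - 1 dvd monom 1 k - monom 1 (k mod N)"
proof -
  have "monom (1::int) N - 1 dvd monom 1 N ^ (k div N) - 1"
    by (simp add: power_diff_1_eq)
  then have "monom (1::int) N - 1 dvd monom 1 (k mod N) * (monom 1 N ^ (k div N) - 1)"
    by (rule dvd_mult)
  moreover have "monom 1 (k mod N) * (monom (1::int) N ^ (k div N) - 1) = monom 1 k - monom 1 (k mod N)"
    by (simp add: monom_power mult_monom algebra_simps)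
  ultimately show ?thesis by simp
qed

lemma poly_reduce_mod:
  fixes Q :: "int poly"
  assumes "N > 0"
  obtains W where "\<And>i. i \<ge> N \<Longrightarrow> coeff W i = 0" "monom 1 N - 1 dvd Q - W"
proof -
  define W where "W = (\<Sum>i\<le>degree Q. monom (coeff Q i) (i mod N))"
  have "coeff W i = 0" if "i \<ge> N" for i
    using that assms unfolding W_def coeff_sum coeff_monom
    by (intro sum.neutral) (metis leD mod_less_divisor)
  moreover have "monom 1 N - 1 dvd Q - W"
  proof -
    have "Q - W = (\<Sum>i\<le>degree Q. smult (coeff Q i) (monom 1 i - monom 1 (i mod N)))"
      unfolding W_def sum_subtractf smult_diff_right smult_monom
      by (simp add: poly_as_sum_of_monoms)
    then show ?thesis by (auto intro!: dvd_sum dvd_smult dvd_monom_mod)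
  qed
  ultimately show ?thesis using that by blast
qed

text \<open>Raising the mask polynomial to the power \<open>r\<close> is the same as multiplying \<open>D\<close> by \<open>r\<close>, modulo \<open>r\<close>.\<close>

lemma tijdeman_prime:
  assumes t: "tiling N D C" and r: "prime r" "\<not> r dvd card D"
  shows "tiling N ((*) r ` D) C"
proof (rule tilingI_surj)
  have N: "N > 0" "finite D" "finite C" using t by (auto simp: tiling_def)
  have r0: "r > 0" using r prime_gt_0_nat by blast
  show "N > 0" "finite ((*) r ` D)" "finite C" using N by auto
  have "card ((*) r ` D) = card D" using r0 by (intro card_image) (simp add: inj_on_def)
  then show "card ((*) r ` D) * card C = N" using tiling_card[OF t] by simp
  fix n assume n: "n < N"
  let ?M = "monom (1::int) N - 1"
  \<comment> \<open>Modulo \<open>monom 1 N - 1\<close>, multiplying U by a polynomial amounts to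
    multiplying it by the value at 1; for \<open>ipset D ^ (r - 1)\<close> this value is a.\<close>
  define a where "a = int (card D) ^ (r - 1)"
  define U where "U = (\<Sum>i<N. monom (1::int) i)"
  have M: "?M = [:-1, 1:] * U"
  proof -
    have "monom (1::int) N - 1 = monom 1 1 ^ N - 1" by (simp add: monom_power)
    also have "\<dots> = (monom 1 1 - 1) * (\<Sum>i<N. monom 1 1 ^ i)" by (rule power_diff_1_eq)
    also have "monom 1 1 - 1 = [:-1, 1::int:]" by (simp add: monom_altdef one_pCons)
    finally show ?thesis by (simp add: U_def monom_power)
  qed
  have 1: "?M dvd ipset D * ipset C - U"
  proof -
    have "U = (\<Sum>(d, c)\<in>D \<times> C. monom 1 ((d + c) mod N))"
    proof -
      have b: "bij_betw (\<lambda>(d, c). (d + c) mod N) (D \<times> C) {..<N}" using t by (simp add: tiling_def)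
      show ?thesis unfolding U_def
        using sum.reindex_bij_betw[OF b, of "monom (1::int)"] by (simp add: case_prod_unfold)
    qed
    moreover have "ipset D * ipset C = (\<Sum>(d, c)\<in>D \<times> C. monom 1 (d + c))"
      by (simp add: ipset_def sum_product sum.cartesian_product mult_monom)
    ultimately have "ipset D * ipset C - U
      = (\<Sum>(d, c)\<in>D \<times> C. monom 1 (d + c) - monom 1 ((d + c) mod N))"
      by (simp add: sum_subtractf case_prod_unfold)
    then show ?thesis by (auto intro!: dvd_sum dvd_monom_mod)
  qed
  have 2: "?M dvd (ipset D ^ (r - 1) - [:a:]) * U"
  proof -
    have "poly (ipset D ^ (r - 1) - [:a:]) 1 = 0"
      by (simp add: a_def ipset_def poly_sum poly_monom)
    then have "[:-1, 1:] dvd ipset D ^ (r - 1) - [:a:]" by (simp only: poly_eq_0_iff_dvd)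
    then show ?thesis unfolding M by (rule mult_dvd_mono) simp
  qed
  have pc: "pcompose (ipset D) (monom 1 r) = (\<Sum>d\<in>D. monom 1 (r * d))"
  proof -
    have "pcompose (monom (1::int) d) (monom 1 r) = monom 1 (r * d)" for d
      by (induction d) (simp_all add: monom_Suc monom_0 pcompose_pCons mult_monom)
    then show ?thesis by (simp add: ipset_def pcompose_sum)
  qed
  obtain H where H: "ipset D ^ r - pcompose (ipset D) (monom 1 r) = of_nat r * H"
    using frobenius_poly[OF r(1)] by blast
  obtain W where W: "\<And>i. i \<ge> N \<Longrightarrow> coeff W i = 0" "?M dvd H * ipset C - W"
    using poly_reduce_mod[OF N(1), of "H * ipset C"] by blast
  define V where "V = (\<Sum>(d, c)\<in>D \<times> C. monom (1::int) ((r * d + c) mod N))"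
  have 3: "?M dvd pcompose (ipset D) (monom 1 r) * ipset C - V"
  proof -
    have "pcompose (ipset D) (monom 1 r) * ipset C = (\<Sum>(d, c)\<in>D \<times> C. monom 1 (r * d + c))"
      unfolding pc by (simp add: ipset_def sum_product sum.cartesian_product mult_monom)
    then have "pcompose (ipset D) (monom 1 r) * ipset C - V
      = (\<Sum>(d, c)\<in>D \<times> C. monom 1 (r * d + c) - monom 1 ((r * d + c) mod N))"
      by (simp add: V_def sum_subtractf case_prod_unfold)
    then show ?thesis by (auto intro!: dvd_sum dvd_monom_mod)
  qed
  \<comment> \<open>Z compares both sides after reducing all exponents modulo N: it has degree less
    than N and is divisible by \<open>monom 1 N - 1\<close>, hence zero. So each coefficient of V
    below N, which counts the representations of n by the dilated set and C, is congruent to a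
    modulo r and cannot be 0.\<close>
  define Z where "Z = [:a:] * U - of_nat r * W - V"
  have "Z = (pcompose (ipset D) (monom 1 r) * ipset C - V) + of_nat r * (H * ipset C - W)
     - ipset D ^ (r - 1) * (ipset D * ipset C - U) - (ipset D ^ (r - 1) - [:a:]) * U"
  proof -
    have "ipset D ^ (r - 1) * (ipset D * ipset C) = ipset D ^ r * ipset C"
      using r0 by (simp add: power_eq_if)
    also have "\<dots> = pcompose (ipset D) (monom 1 r) * ipset C + of_nat r * (H * ipset C)"
      using H by (simp add: algebra_simps)
    finally show ?thesis unfolding Z_def by (simp add: algebra_simps)
  qed
  then have Mdvd: "?M dvd Z" using 1 2 3 W(2) by (simp add: dvd_diff dvd_add)
  have "Z = 0"
  proof (rule ccontr)
    assume "Z \<noteq> 0"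
    then have "degree ?M \<le> degree Z" using Mdvd by (intro dvd_imp_degree_le)
    moreover have "degree (?M + 0) = N"
    proof -
      have "degree (monom (1::int) N + - 1) = N"
        using N by (subst degree_add_eq_left) (auto simp: degree_monom_eq)
      then show ?thesis by simp
    qed
    moreover have "coeff Z i = 0" if "i \<ge> N" for i
    proof -
      have "coeff U i = 0" using that by (simp add: U_def coeff_sum)
      moreover have "coeff V i = 0" using that N
        unfolding V_def coeff_sum case_prod_unfold coeff_monom
        by (intro sum.neutral) (metis leD mod_less_divisor)
      ultimately show ?thesis using W(1)[OF that] by (simp add: Z_def of_nat_poly)
    qed
    ultimately show False using \<open>Z \<noteq> 0\<close> by (metis add.right_neutral leading_coeff_0_iff)
  qed
  moreover have "coeff U n = 1" using n by (simp add: U_def coeff_sum)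
  moreover have "coeff Z n = a * coeff U n - int r * coeff W n - coeff V n"
    by (simp add: Z_def of_nat_poly)
  ultimately have "coeff V n = a - int r * coeff W n" by simp
  moreover have "\<not> int r dvd a"
  proof -
    have "\<not> r dvd card D ^ (r - 1)" using r prime_dvd_power by blast
    then show ?thesis unfolding a_def by (metis int_dvd_int_iff of_nat_power)
  qed
  ultimately have "coeff V n \<noteq> 0" by (metis dvd_triv_left eq_iff_diff_eq_0)
  then obtain x where "x \<in> D \<times> C" "coeff (monom (1::int) ((r * fst x + snd x) mod N)) n \<noteq> 0"
    unfolding V_def coeff_sum case_prod_unfold by (rule sum.not_neutral_contains_not_neutral)
  then obtain d c where "d \<in> D" "c \<in> C" "(r * d + c) mod N = n"
    by (auto split: if_splits)
  then show "\<exists>d\<in>(*) r ` D. \<exists>c\<in>C. (d + c) mod N = n" by blast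
qed

lemma tijdeman:
  assumes "tiling N D C" "k > 0" "coprime k (card D)"
  shows "tiling N ((*) k ` D) C"
  using assms(2,3)
proof (induction k rule: less_induct)
  case (less k)
  show ?case
  proof (cases "k = 1")
    case False
    then obtain r where r: "prime r" "r dvd k" using prime_factor_nat by blast
    then obtain k' where k': "k = r * k'" by blast
    have k'2: "k' > 0" "k' < k" using k' less.prems(1) prime_gt_1_nat[OF r(1)] by auto
    have "coprime k' (card D)" "coprime r (card D)" using less.prems k' by auto
    then have t: "tiling N ((*) k' ` D) C" and "\<not> r dvd card D"
      using less k'2 r(1) by (auto simp: coprime_absorb_left)
    moreover have "card ((*) k' ` D) = card D" using k'2 by (intro card_image) (simp add: inj_on_def)
    ultimately have "tiling N ((*) r ` (*) k' ` D) C" using tijdeman_prime r by simp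
    moreover have "(*) r ` (*) k' ` D = (*) k ` D" by (auto simp: k' image_image mult.assoc)
    ultimately show ?thesis by simp
  qed (use assms(1) in simp)
qed

text \<open>Some k prime to N carries \<open>d1 - d2\<close> to \<open>c1 - c2\<close> modulo N.
  After dilating D by k, which gives a tiling again by \<open>tijdeman\<close>, the sums
  \<open>k * d1 + c2\<close> and \<open>k * d2 + c1\<close> collide.\<close>

lemma tiling_no_common_unit:
  assumes t: "tiling N D C" "N > 1"
    and d: "d1 \<in> D" "d2 \<in> D" "coprime (int d1 - int d2) (int N)"
    and c: "c1 \<in> C" "c2 \<in> C" "coprime (int c1 - int c2) (int N)"
  shows False
proof -
  obtain x where x: "[(int d1 - int d2) * x = 1] (mod int N)"
    using cong_solve_coprime_int[OF d(3)] by auto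
  define k where "k = nat ((x * (int c1 - int c2)) mod int N)"
  have kx: "[int k = x * (int c1 - int c2)] (mod int N)" using t by (simp add: k_def cong_def)
  have kd: "[int k * (int d1 - int d2) = int c1 - int c2] (mod int N)"
  proof -
    have "[int k * (int d1 - int d2) = (x * (int c1 - int c2)) * (int d1 - int d2)] (mod int N)"
      using kx cong_scalar_right by blast
    moreover have "[(int d1 - int d2) * x * (int c1 - int c2) = 1 * (int c1 - int c2)] (mod int N)"
      using x cong_scalar_right by blast
    ultimately show ?thesis by (simp add: ac_simps cong_def)
  qed
  have "coprime (int k * (int d1 - int d2)) (int N)" using kd c(3) by (metis cong_imp_coprime cong_sym)
  then have kN: "coprime k N" by simp
  then have "k > 0" using t(2) by (intro Nat.gr0I) auto
  moreover have "coprime k (card D)" using kN tiling_card[OF t(1)] by auto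
  ultimately have tk: "tiling N ((*) k ` D) C" using tijdeman[OF t(1)] by blast
  have "[int (k * d1 + c2) = int (k * d2 + c1)] (mod int N)"
    using kd by (simp add: cong_iff_dvd_diff algebra_simps)
  then have "[k * d1 + c2 = k * d2 + c1] (mod N)" by (simp only: cong_int_iff)
  then have "k * d1 = k * d2" using tiling_unique[OF tk] d c by blast
  then have "d1 = d2" using \<open>k > 0\<close> by simp
  then show False using d(3) t(2) by simp
qed

section \<open>Sands' theorem for periods with two prime factors\<close>

definition one_class :: "nat \<Rightarrow> nat set \<Rightarrow> bool" where
  "one_class r D \<longleftrightarrow> (\<exists>\<rho>. \<forall>x\<in>D. x mod r = \<rho>)"

text \<open>Take y differing from x modulo p and z differing from x modulo q. If neither pair with x
  differs modulo both primes, then y and z do.\<close>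

lemma unit_difference:
  assumes "prime p" "prime q" "D \<noteq> {}"
    "c > 0 \<Longrightarrow> \<not> one_class p D" "d > 0 \<Longrightarrow> \<not> one_class q D"
  shows "\<exists>x\<in>D. \<exists>y\<in>D. coprime (int x - int y) (int (p ^ c * q ^ d))"
proof -
  obtain x where x: "x \<in> D" using assms(3) by blast
  have diff: "\<exists>y\<in>D. y mod r \<noteq> x mod r" if "\<not> one_class r D" for r
    using that unfolding one_class_def by blast
  have cop: "coprime (int y - int z) (int (r ^ e))" if "prime r" "e > 0 \<Longrightarrow> y mod r \<noteq> z mod r" for y z r e
  proof (cases "e = 0")
    case False
    have "\<not> int r dvd int y - int z"
      using False that(2) by (simp add: mod_eq_dvd_iff[symmetric] flip: zmod_int)
    moreover have "prime (int r)" using that(1) by simp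
    ultimately have "coprime (int r) (int y - int z)" by (intro prime_imp_coprime)
    then show ?thesis by (simp add: coprime_commute)
  qed simp
  have "\<exists>y\<in>D. \<exists>z\<in>D. (c > 0 \<longrightarrow> y mod p \<noteq> z mod p) \<and> (d > 0 \<longrightarrow> y mod q \<noteq> z mod q)"
  proof -
    consider "c = 0" "d = 0" | "c = 0" "d > 0" | "c > 0" "d = 0" | "c > 0" "d > 0" by blast
    then show ?thesis
    proof cases
      case 4
      obtain y where y: "y \<in> D" "y mod p \<noteq> x mod p" using diff assms(4) 4 by blast
      obtain z where z: "z \<in> D" "z mod q \<noteq> x mod q" using diff assms(5) 4 by blast
      show ?thesis
      proof (cases "y mod q \<noteq> x mod q \<or> z mod p \<noteq> x mod p")
        case True
        then show ?thesis using x y z by blast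
      next
        case False
        then have "y mod p \<noteq> z mod p \<and> y mod q \<noteq> z mod q" using y z by simp
        then show ?thesis using y(1) z(1) by blast
      qed
    qed (use x diff assms in blast)+
  qed
  then show ?thesis using cop assms by (metis coprime_mult_right_iff of_nat_mult)
qed

lemma tiling_nonempty: "tiling N D C \<Longrightarrow> D \<noteq> {} \<and> C \<noteq> {}"
  unfolding tiling_def bij_betw_def by auto

text \<open>Otherwise both factors contain a difference prime to the period, which
  \<open>tiling_no_common_unit\<close> forbids.\<close>

lemma sands:
  assumes "prime p" "prime q" "tiling (p ^ c * q ^ d) D C" "c > 0 \<or> d > 0"
  shows "(c > 0 \<and> (one_class p D \<or> one_class p C)) \<or> (d > 0 \<and> (one_class q D \<or> one_class q C))"
proof (rule ccontr)
  assume *: "\<not> ?thesis"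
  have "p ^ c * q ^ d > 1"
    using assms by (metis One_nat_def Suc_lessI mult_eq_1_iff nat_0_less_mult_iff not_gr0
      one_less_power prime_gt_1_nat tiling_def less_numeral_extra(4))
  then show False
    using tiling_no_common_unit[OF assms(3)] unit_difference[OF assms(1,2), of D c d]
      unit_difference[OF assms(1,2), of C c d] tiling_nonempty[OF assms(3)] * by blast
qed

section \<open>Slices of sets and tilings along residue classes\<close>

definition slice :: "nat \<Rightarrow> nat \<Rightarrow> nat set \<Rightarrow> nat set" where
  "slice r i D = {t. i + r * t \<in> D}"

lemma finite_slice: "finite D \<Longrightarrow> r > 0 \<Longrightarrow> finite (slice r i D)"
  unfolding slice_def by (rule finite_subset[of _ "(\<lambda>x. (x - i) div r) ` D"])
    (auto simp: image_iff intro!: bexI[rotated])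

text \<open>As D lies in the class \<rho>, the sums in the class \<open>\<rho> + i\<close> modulo r
  come exactly from the elements of C in the class i; dividing by r leaves a tiling of period
  N.\<close>

lemma tiling_reduce:
  assumes t: "tiling (r * N) D C" and r: "r > 0" and D: "\<And>x. x \<in> D \<Longrightarrow> x mod r = \<rho>" and i: "i < r"
  shows "tiling N (slice r \<rho> D) (slice r i C)"
  unfolding tiling_def
proof (intro conjI)
  have N: "r * N > 0" "finite D" "finite C" using t by (auto simp: tiling_def)
  then show "N > 0" by simp
  show "finite (slice r \<rho> D)" "finite (slice r i C)" using N r finite_slice by auto
  have lift: "[a = b] (mod N)" if "[\<rho> + i + r * a = \<rho> + i + r * b] (mod (r * N))" for a b
  proof -
    have "[r * a = r * b] (mod (r * N))" using that by (simp only: cong_add_lcancel_nat)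
    then show ?thesis using r by (simp add: cong_def flip: mult_mod_right)
  qed
  show "bij_betw (\<lambda>(d, c). (d + c) mod N) (slice r \<rho> D \<times> slice r i C) {..<N}"
    unfolding bij_betw_def
  proof
    show "inj_on (\<lambda>(d, c). (d + c) mod N) (slice r \<rho> D \<times> slice r i C)"
    proof (rule inj_onI, clarify)
      fix a b a' b' assume *: "a \<in> slice r \<rho> D" "b \<in> slice r i C" "a' \<in> slice r \<rho> D" "b' \<in> slice r i C"
        "(a + b) mod N = (a' + b') mod N"
      have "[r * (a + b) = r * (a' + b')] (mod (r * N))"
        using *(5) by (simp add: cong_def mult_mod_right[symmetric])
      then have "[(\<rho> + i) + r * (a + b) = (\<rho> + i) + r * (a' + b')] (mod (r * N))"
        by (simp only: cong_add_lcancel_nat)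
      then have "[(\<rho> + r * a) + (i + r * b) = (\<rho> + r * a') + (i + r * b')] (mod (r * N))"
        by (simp add: algebra_simps)
      then have "\<rho> + r * a = \<rho> + r * a' \<and> i + r * b = i + r * b'"
        using * by (intro tiling_unique[OF t]) (auto simp: slice_def)
      then show "a = a' \<and> b = b'" using r by simp
    qed
    show "(\<lambda>(d, c). (d + c) mod N) ` (slice r \<rho> D \<times> slice r i C) = {..<N}"
    proof (intro equalityI subsetI)
      fix n assume "n \<in> {..<N}"
      obtain d c where dc: "d \<in> D" "c \<in> C" "[d + c = \<rho> + i + r * n] (mod (r * N))"
        using tiling_cover[OF t] by metis
      have dm: "d mod r = \<rho>" using D dc by blast
      have "[d + c = \<rho> + i + r * n] (mod r)" using dc(3) cong_modulus_mult_nat by blast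
      then have "[\<rho> + c = \<rho> + i] (mod r)" using dm by (simp add: cong_def) (metis mod_add_left_eq)
      then have "[c = i] (mod r)" by (simp only: cong_add_lcancel_nat)
      then have cm: "c mod r = i" using i by (simp add: cong_def)
      have d: "d = \<rho> + r * (d div r)" and c: "c = i + r * (c div r)" using dm cm by (metis mod_mult_div_eq)+
      have "[\<rho> + i + r * (d div r + c div r) = \<rho> + i + r * n] (mod (r * N))"
        using dc(3) d c by (metis (no_types, opaque_lifting) add.assoc add.left_commute distrib_left)
      then have "(d div r + c div r) mod N = n" using lift \<open>n \<in> {..<N}\<close> by (auto simp: cong_def)
      moreover have "d div r \<in> slice r \<rho> D" "c div r \<in> slice r i C" using d c dc by (auto simp: slice_def)
      ultimately show "n \<in> (\<lambda>(d, c). (d + c) mod N) ` (slice r \<rho> D \<times> slice r i C)" by force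
    qed (use \<open>N > 0\<close> in auto)
  qed
qed

lemma cnt_slice:
  assumes "r > 0" "i < r"
  shows "cnt (slice r i D) m t = cnt D (r * m) (i + r * t)"
proof -
  have "bij_betw (\<lambda>u. i + r * u) {x \<in> slice r i D. [x = t] (mod m)} {x \<in> D. [x = i + r * t] (mod (r * m))}"
    unfolding bij_betw_def
  proof
    show "inj_on (\<lambda>u. i + r * u) {x \<in> slice r i D. [x = t] (mod m)}" using assms by (auto simp: inj_on_def)
    have iff: "[i + r * u = i + r * t] (mod (r * m)) \<longleftrightarrow> [u = t] (mod m)" for u
      using assms(1) by (simp add: cong_add_lcancel_nat) (simp add: cong_def flip: mult_mod_right)
    show "(\<lambda>u. i + r * u) ` {x \<in> slice r i D. [x = t] (mod m)} = {x \<in> D. [x = i + r * t] (mod (r * m))}"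
    proof (intro equalityI subsetI)
      fix x assume x: "x \<in> {x \<in> D. [x = i + r * t] (mod (r * m))}"
      then have "[x = i + r * t] (mod r)" using cong_modulus_mult_nat by blast
      then have "x mod r = i" using assms by (simp add: cong_def)
      then obtain u where u: "x = i + r * u" by (metis mod_mult_div_eq)
      then show "x \<in> (\<lambda>u. i + r * u) ` {x \<in> slice r i D. [x = t] (mod m)}"
        using x iff unfolding u slice_def by auto
    qed (use iff in \<open>auto simp: slice_def\<close>)
  qed
  then show ?thesis unfolding cnt_def by (rule bij_betw_same_card)
qed

lemma cnt_refine:
  assumes "finite D" "r > 0" "m > 0"
  shows "cnt D m t = (\<Sum>i<r. cnt D (r * m) (t + i * m))"
proof -
  have "{x \<in> D. [x = t] (mod m)} = (\<Union>i<r. {x \<in> D. [x = t + i * m] (mod (r * m))})"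
  proof (intro equalityI subsetI)
    fix x assume x: "x \<in> {x \<in> D. [x = t] (mod m)}"
    have "[x + r * m * t = t] (mod m)" using x by (simp add: cong_def mult.assoc mult.left_commute)
    moreover have "t \<le> x + r * m * t" using assms by (simp add: trans_le_add2)
    ultimately have "m dvd x + r * m * t - t" by (simp add: cong_altdef_nat)
    then obtain j where "x + r * m * t - t = m * j" by blast
    then have "x + r * m * t = t + m * j" using \<open>t \<le> x + r * m * t\<close> by linarith
    then have 1: "[x = t + m * j] (mod (r * m))" by (metis cong_def mod_mult_self2)
    have "[m * j = (j mod r) * m] (mod (r * m))" 
      unfolding mult_mod_left cong_def by (simp add: mult.commute[of m j])
    then have "[t + m * j = t + (j mod r) * m] (mod (r * m))" by (simp only: cong_add_lcancel_nat)
    then have "[x = t + (j mod r) * m] (mod (r * m))" using 1 cong_trans by blast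
    then show "x \<in> (\<Union>i<r. {x \<in> D. [x = t + i * m] (mod (r * m))})" using x assms by auto
  next
    fix x assume "x \<in> (\<Union>i<r. {x \<in> D. [x = t + i * m] (mod (r * m))})"
    then obtain i where "x \<in> D" "[x = t + i * m] (mod (r * m))" by blast
    then have "x \<in> D" "[x = t + i * m] (mod m)" using cong_modulus_mult_nat[of x _ m r] by (auto simp: mult.commute)
    then show "x \<in> {x \<in> D. [x = t] (mod m)}" by (simp add: cong_def)
  qed
  moreover have "card (\<Union>i<r. {x \<in> D. [x = t + i * m] (mod (r * m))}) = (\<Sum>i<r. cnt D (r * m) (t + i * m))"
    unfolding cnt_def
  proof (rule card_UN_disjoint)
    show "\<forall>i\<in>{..<r}. \<forall>j\<in>{..<r}. i \<noteq> j \<longrightarrow>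
       {x \<in> D. [x = t + i * m] (mod (r * m))} \<inter> {x \<in> D. [x = t + j * m] (mod (r * m))} = {}"
    proof (intro ballI impI)
      fix i j assume ij: "i \<in> {..<r}" "j \<in> {..<r}" "i \<noteq> j"
      have False if "[x = t + i * m] (mod (r * m))" "[x = t + j * m] (mod (r * m))" for x
      proof -
        have "[t + i * m = t + j * m] (mod (r * m))" using that cong_sym cong_trans by blast
        then have "[i * m = j * m] (mod (r * m))" by (simp only: cong_add_lcancel_nat)
        moreover have "i * m < r * m" "j * m < r * m" using ij assms by auto
        ultimately show False using ij assms by (simp add: cong_def)
      qed
      then show "{x \<in> D. [x = t + i * m] (mod (r * m))} \<inter> {x \<in> D. [x = t + j * m] (mod (r * m))} = {}" by blast
    qed
  qed (use assms in auto)
  ultimately show ?thesis unfolding cnt_def by simp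
qed

lemma cnt_1 [simp]: "cnt D (Suc 0) t = card D"
  by (simp add: cnt_def cong_def)

section \<open>Shift invariance of residue counts\<close>

definition inv_shift :: "nat set \<Rightarrow> nat \<Rightarrow> nat \<Rightarrow> bool" where
  "inv_shift D m h \<longleftrightarrow> (\<forall>t. cnt D m (t + h) = cnt D m t)"

definition inv_mixed :: "nat set \<Rightarrow> nat \<Rightarrow> nat \<Rightarrow> nat \<Rightarrow> bool" where
  "inv_mixed D m h l \<longleftrightarrow>
     (\<forall>t. cnt D m t + cnt D m (t + h + l) = cnt D m (t + h) + cnt D m (t + l))"

lemma inv_shift_mult: "inv_shift D m h \<Longrightarrow> cnt D m (t + k * h) = cnt D m t"
proof (induction k)
  case (Suc k)
  then have "cnt D m ((t + k * h) + h) = cnt D m (t + k * h)" unfolding inv_shift_def by blast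
  then show ?case using Suc by (simp add: add_ac)
qed simp

lemma inv_shift_slice:
  assumes "r > 0" "i < r" "inv_shift D (r * m) (r * h)" shows "inv_shift (slice r i D) m h"
  unfolding inv_shift_def
proof
  fix t
  show "cnt (slice r i D) m (t + h) = cnt (slice r i D) m t"
    using assms(3)[unfolded inv_shift_def, rule_format, of "i + r * t"]
    by (simp add: cnt_slice[OF assms(1,2)] distrib_left add_ac)
qed

lemma inv_mixed_slice:
  assumes "r > 0" "i < r" "inv_mixed D (r * m) (r * h) (r * l)" shows "inv_mixed (slice r i D) m h l"
  unfolding inv_mixed_def
proof
  fix t
  show "cnt (slice r i D) m t + cnt (slice r i D) m (t + h + l) = cnt (slice r i D) m (t + h) + cnt (slice r i D) m (t + l)"
    using assms(3)[unfolded inv_mixed_def, rule_format, of "i + r * t"]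
    by (simp add: cnt_slice[OF assms(1,2)] distrib_left add_ac)
qed

lemma inv_shift_of_slice:
  assumes "r > 0" "\<And>i. i < r \<Longrightarrow> inv_shift (slice r i D) m h" shows "inv_shift D (r * m) (r * h)"
  unfolding inv_shift_def
proof
  fix t
  have *: "t mod r < r" using assms by simp
  have "t = t mod r + r * (t div r)" by simp
  moreover have "t + r * h = t mod r + r * (t div r + h)" by (simp add: distrib_left)
  ultimately show "cnt D (r * m) (t + r * h) = cnt D (r * m) t"
    using cnt_slice[OF assms(1) *] assms(2)[OF *] unfolding inv_shift_def by metis
qed

lemma cnt_one_class:
  assumes "\<And>x. x \<in> D \<Longrightarrow> x mod r = \<rho>" "t mod r \<noteq> \<rho>"
  shows "cnt D (r * m) t = 0"
proof -
  have "{x \<in> D. [x = t] (mod (r * m))} = {}"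
  proof -
    have False if "x \<in> D" "[x = t] (mod (r * m))" for x
      using that assms cong_modulus_mult_nat[of x t r m] by (auto simp: cong_def)
    then show ?thesis by blast
  qed
  then show ?thesis unfolding cnt_def by (simp only: card.empty)
qed

lemma inv_shift_of_slice_one_class:
  assumes "r > 0" "\<And>x. x \<in> D \<Longrightarrow> x mod r = \<rho>" "inv_shift (slice r \<rho> D) m h"
  shows "inv_shift D (r * m) (r * h)"
proof (rule inv_shift_of_slice[OF assms(1)])
  fix i assume i: "i < r"
  show "inv_shift (slice r i D) m h"
  proof (cases "i = \<rho>")
    case False
    then have "cnt D (r * m) (i + r * t) = 0" for t
      using i by (intro cnt_one_class[OF assms(2)]) auto
    then show ?thesis by (simp add: inv_shift_def cnt_slice[OF assms(1) i])
  qed (use assms in simp)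
qed

lemma cnt_slice_coprime:
  assumes "r > 0" "\<And>x. x \<in> D \<Longrightarrow> x mod r = \<rho>" "coprime r m"
  shows "cnt (slice r \<rho> D) m t = cnt D m (\<rho> + r * t)"
proof -
  have "bij_betw (\<lambda>u. \<rho> + r * u) {x \<in> slice r \<rho> D. [x = t] (mod m)} {x \<in> D. [x = \<rho> + r * t] (mod m)}"
    unfolding bij_betw_def
  proof
    show "inj_on (\<lambda>u. \<rho> + r * u) {x \<in> slice r \<rho> D. [x = t] (mod m)}" using assms by (auto simp: inj_on_def)
    have iff: "[\<rho> + r * u = \<rho> + r * t] (mod m) \<longleftrightarrow> [u = t] (mod m)" for u
      using assms(3) by (simp add: cong_add_lcancel_nat cong_mult_lcancel_nat coprime_commute)
    show "(\<lambda>u. \<rho> + r * u) ` {x \<in> slice r \<rho> D. [x = t] (mod m)} = {x \<in> D. [x = \<rho> + r * t] (mod m)}"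
    proof (intro equalityI subsetI)
      fix x assume x: "x \<in> {x \<in> D. [x = \<rho> + r * t] (mod m)}"
      then have "x mod r = \<rho>" using assms(2) by simp
      then obtain u where u: "x = \<rho> + r * u" by (metis mod_mult_div_eq)
      then show "x \<in> (\<lambda>u. \<rho> + r * u) ` {x \<in> slice r \<rho> D. [x = t] (mod m)}"
        using x iff unfolding u slice_def by auto
    qed (use iff in \<open>auto simp: slice_def\<close>)
  qed
  then show ?thesis unfolding cnt_def by (rule bij_betw_same_card)
qed

text \<open>Modulo m the slice is an affine image of D, because r is invertible modulo m.\<close>

lemma inv_shift_slice_coprime_iff:
  assumes "r > 0" "\<And>x. x \<in> D \<Longrightarrow> x mod r = \<rho>" "coprime r m" "m > 0"
  shows "inv_shift (slice r \<rho> D) m h \<longleftrightarrow> inv_shift D m h"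
proof
  assume *: "inv_shift D m h"
  show "inv_shift (slice r \<rho> D) m h" unfolding inv_shift_def
  proof
    fix t
    have "cnt D m (\<rho> + r * t + r * h) = cnt D m (\<rho> + r * t)" by (rule inv_shift_mult[OF *])
    then show "cnt (slice r \<rho> D) m (t + h) = cnt (slice r \<rho> D) m t"
      by (simp add: cnt_slice_coprime[OF assms(1-3)] distrib_left add.assoc)
  qed
next
  assume *: "inv_shift (slice r \<rho> D) m h"
  obtain y where y: "[r * y = 1] (mod m)" using cong_solve_coprime_nat[OF assms(3)] by auto
  \<comment> \<open>\<open>(m - 1) * \<rho>\<close> stands for -\<rho>, so the argument on the right
    solves \<open>\<rho> + r * u = t\<close> for u modulo m.\<close>
  have c: "cnt D m t = cnt (slice r \<rho> D) m (y * (t + (m - 1) * \<rho>))" for t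
  proof -
    have "[r * y * (t + (m - 1) * \<rho>) = 1 * (t + (m - 1) * \<rho>)] (mod m)" using y cong_scalar_right by blast
    then have "[\<rho> + r * (y * (t + (m - 1) * \<rho>)) = \<rho> + (t + (m - 1) * \<rho>)] (mod m)"
      by (simp only: cong_add_lcancel_nat mult.assoc mult_1)
    also have "\<rho> + (t + (m - 1) * \<rho>) = t + m * \<rho>" using assms(4) by (cases m) auto
    also have "[t + m * \<rho> = t] (mod m)" by (simp add: cong_def)
    finally have "cnt D m (\<rho> + r * (y * (t + (m - 1) * \<rho>))) = cnt D m t" by (rule cnt_cong)
    then show ?thesis by (simp only: cnt_slice_coprime[OF assms(1-3)])
  qed
  show "inv_shift D m h" unfolding inv_shift_def
  proof
    fix t
    have "y * (t + h + (m - 1) * \<rho>) = y * (t + (m - 1) * \<rho>) + y * h" by (simp add: algebra_simps)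
    then show "cnt D m (t + h) = cnt D m t" unfolding c using inv_shift_mult[OF *] by metis
  qed
qed

section \<open>Mixed zeros of tilings with two primes\<close>

text \<open>The p-adic digits of index below c that are equidistributed in D given the lower digits;
  by \<open>zr_prime_power_iff\<close> they correspond to the zeros of order
  \<open>p ^ Suc u\<close>.\<close>

definition cuts :: "nat \<Rightarrow> nat set \<Rightarrow> nat \<Rightarrow> nat set" where
  "cuts p D c = {u. u < c \<and> inv_shift D (p ^ Suc u) (p ^ u)}"

lemma finite_cuts [simp]: "finite (cuts p D c)"
  by (simp add: cuts_def)

lemma cuts_from_Suc:
  "{u \<in> cuts p D c. k \<le> u} = (if k \<in> cuts p D c then insert k {u \<in> cuts p D c. Suc k \<le> u} else {u \<in> cuts p D c. Suc k \<le> u})"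
  by (auto simp: le_less Suc_le_eq)

lemma cnt_cut:
  assumes "finite D" "p > 0" "inv_shift D (p ^ Suc u) (p ^ u)"
  shows "cnt D (p ^ u) t = p * cnt D (p ^ Suc u) t"
proof -
  have "cnt D (p ^ u) t = (\<Sum>i<p. cnt D (p * p ^ u) (t + i * p ^ u))"
    using assms by (intro cnt_refine) auto
  also have "\<dots> = (\<Sum>i<p. cnt D (p ^ Suc u) t)"
    using inv_shift_mult[OF assms(3)] by simp
  finally show ?thesis by simp
qed

lemma cnt_Suc_le:
  assumes "finite D" "p > 0" shows "cnt D (p ^ Suc u) t \<le> cnt D (p ^ u) t"
proof -
  have "[x = t] (mod (p ^ u))" if "[x = t] (mod (p ^ Suc u))" for x
    using that by (rule cong_dvd_modulus_nat) simp
  then show ?thesis unfolding cnt_def using assms by (intro card_mono) auto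
qed

text \<open>Downward induction: at a cut the class splits into p classes of equal size, elsewhere
  into classes that all carry the factor already.\<close>

lemma cuts_dvd_cnt:
  assumes "finite D" "p > 0" "k \<le> c"
  shows "p ^ card {u \<in> cuts p D c. k \<le> u} dvd cnt D (p ^ k) t"
  using assms(3)
proof (induction k arbitrary: t rule: inc_induct)
  case base
  have "{u \<in> cuts p D c. c \<le> u} = {}" by (auto simp: cuts_def)
  then show ?case by (simp only: card.empty power_0 one_dvd)
next
  case (step k)
  show ?case
  proof (cases "k \<in> cuts p D c")
    case True
    then have "inv_shift D (p ^ Suc k) (p ^ k)" by (simp add: cuts_def)
    then have "cnt D (p ^ k) t = p * cnt D (p ^ Suc k) t" using assms cnt_cut by blast
    moreover have "card {u \<in> cuts p D c. k \<le> u} = Suc (card {u \<in> cuts p D c. Suc k \<le> u})"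
      using True by (subst cuts_from_Suc) simp
    ultimately show ?thesis using step.IH by (simp add: mult_dvd_mono)
  next
    case False
    have "cnt D (p ^ k) t = (\<Sum>i<p. cnt D (p * p ^ k) (t + i * p ^ k))"
      using assms by (intro cnt_refine) auto
    also have "p ^ card {u \<in> cuts p D c. Suc k \<le> u} dvd \<dots>"
      using step.IH by (intro dvd_sum) simp
    finally show ?thesis using False by (subst cuts_from_Suc) simp
  qed
qed

lemma cuts_card_dvd: "finite D \<Longrightarrow> p > 0 \<Longrightarrow> p ^ card (cuts p D c) dvd card D"
  using cuts_dvd_cnt[of D p 0 c 0] by simp

text \<open>Each cut below k divides the size of a class by p, and the other levels cannot enlarge
  it.\<close>

lemma cnt_upper_bound:
  assumes "finite D" "p > 0" "k \<le> c"
  shows "cnt D (p ^ k) t * p ^ card {u \<in> cuts p D c. u < k} \<le> card D"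
  using assms(3)
proof (induction k)
  case (Suc k)
  show ?case
  proof (cases "k \<in> cuts p D c")
    case True
    then have "inv_shift D (p ^ Suc k) (p ^ k)" by (simp add: cuts_def)
    then have "cnt D (p ^ k) t = p * cnt D (p ^ Suc k) t" using assms cnt_cut by blast
    moreover have "{u \<in> cuts p D c. u < Suc k} = insert k {u \<in> cuts p D c. u < k}"
      using True by (auto simp: less_Suc_eq)
    ultimately show ?thesis using Suc by (simp add: mult_ac)
  next
    case False
    then have "{u \<in> cuts p D c. u < Suc k} = {u \<in> cuts p D c. u < k}"
      using less_Suc_eq by blast
    then show ?thesis using Suc cnt_Suc_le[OF assms(1,2), of k t]
      by (metis (no_types, lifting) Suc_leD mult_le_mono1 order_trans)
  qed
qed simp

lemma zr_prime_power_iff: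
  assumes "prime p" "finite D"
  shows "zr D (p ^ Suc u) \<longleftrightarrow> inv_shift D (p ^ Suc u) (p ^ u)"
proof -
  have pos: "p ^ Suc u > 0" using assms prime_gt_0_nat by simp
  have cop: "coprime k (p ^ Suc u) \<longleftrightarrow> \<not> p dvd k" for k
  proof
    assume "coprime k (p ^ Suc u)"
    then have "coprime k p" by simp
    then show "\<not> p dvd k" using assms(1) by (metis coprime_absorb_right not_prime_unit)
  next
    assume "\<not> p dvd k"
    then have "coprime p k" using assms(1) by (intro prime_imp_coprime)
    then show "coprime k (p ^ Suc u)" by (simp add: coprime_commute)
  qed
  have "inv_shift D (p ^ Suc u) (p ^ u) \<longleftrightarrow> (\<forall>k. p dvd k \<or> ev D (rt (p ^ Suc u) k) = 0)"
    unfolding inv_shift_def using assms(2) pos by (subst cnt_shift_invariant_iff) auto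
  also have "\<dots> \<longleftrightarrow> zr D (p ^ Suc u)"
    using zr_iff[OF pos] cop by (metis assms(1) not_prime_unit)
  finally show ?thesis by simp
qed

text \<open>Modulo N the sums \<open>d + c\<close> run through all residues once, and the powers of
  a nontrivial M-th root of unity over a full period add up to 0.\<close>

lemma ev_tiling:
  assumes "tiling N D C" "M dvd N" "M > 0" "\<not> M dvd k"
  shows "ev D (rt M k) * ev C (rt M k) = 0"
proof -
  have fin: "finite D" "finite C" "N > 0" using assms by (auto simp: tiling_def)
  obtain e where e: "N = M * e" using assms by blast
  have per: "rt M k ^ (n mod N) = rt M k ^ n" for n
  proof -
    have "[n mod N * k = n * k] (mod M)"
      using e by (intro cong_mult cong_refl) (metis cong_def dvd_triv_left mod_mod_cancel)
    then show ?thesis using rt_cong assms(3) by (simp add: rt_power)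
  qed
  have "ev D (rt M k) * ev C (rt M k) = (\<Sum>(d, c)\<in>D \<times> C. rt M k ^ (d + c))"
    by (simp add: ev_def sum_product sum.cartesian_product power_add)
  also have "\<dots> = (\<Sum>x\<in>D \<times> C. rt M k ^ ((case x of (d, c) \<Rightarrow> (d + c) mod N)))"
    by (intro sum.cong) (auto simp: per)
  also have "\<dots> = (\<Sum>n<N. rt M k ^ n)"
    using assms(1) by (intro sum.reindex_bij_betw) (simp add: tiling_def)
  also have "\<dots> = 0"
  proof -
    have "rt M k \<noteq> 1" "rt M k ^ N = 1" using assms e by (auto simp: rt_eq_1_iff rt_power)
    then show ?thesis by (simp add: sum_gp_strict)
  qed
  finally show ?thesis .
qed

lemma tiling_cut:
  assumes "tiling N D C" "prime p" "p ^ Suc u dvd N"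
  shows "inv_shift D (p ^ Suc u) (p ^ u) \<or> inv_shift C (p ^ Suc u) (p ^ u)"
proof -
  have "p ^ Suc u > 0" "\<not> p ^ Suc u dvd 1"
    using assms(2) prime_gt_0_nat not_prime_unit by (auto simp: nat_dvd_1_iff_1)
  then have "ev D (rt (p ^ Suc u) 1) * ev C (rt (p ^ Suc u) 1) = 0"
    using assms by (intro ev_tiling)
  then have "zr D (p ^ Suc u) \<or> zr C (p ^ Suc u)" by (simp add: zr_def)
  then show ?thesis using zr_prime_power_iff assms(1,2) by (simp add: tiling_def)
qed

context
  fixes p q c d :: nat and D C
  assumes pq: "prime p" "prime q" "p \<noteq> q" and t: "tiling (p ^ c * q ^ d) D C"
begin

lemma cuts_union: "cuts p D c \<union> cuts p C c = {..<c}"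
proof -
  have "p ^ Suc u dvd p ^ c * q ^ d" if "u < c" for u
    using that by (metis Suc_leI dvd_mult2 le_imp_power_dvd)
  then show ?thesis using tiling_cut[OF t pq(1)] by (auto simp: cuts_def)
qed

lemma power_p_dvd: "p ^ k dvd p ^ c * q ^ d \<Longrightarrow> k \<le> c"
proof -
  assume "p ^ k dvd p ^ c * q ^ d"
  moreover have "coprime (p ^ k) (q ^ d)" using pq by (simp add: primes_coprime)
  ultimately have "p ^ k dvd p ^ c" by (simp add: coprime_dvd_mult_left_iff)
  then show "k \<le> c" using pq(1) by (metis power_dvd_imp_le prime_gt_1_nat)
qed

text \<open>The cuts of D and C together put that many factors p into
  \<open>card D * card C\<close>, which has only c of them, while the union of the cuts already has
  c elements.\<close>

lemma cuts_disjoint: "cuts p D c \<inter> cuts p C c = {}"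
proof -
  have fin: "finite D" "finite C" "p > 0" using t pq prime_gt_0_nat by (auto simp: tiling_def)
  have "p ^ card (cuts p D c) * p ^ card (cuts p C c) dvd card D * card C"
    using fin by (intro mult_dvd_mono cuts_card_dvd)
  then have "card (cuts p D c) + card (cuts p C c) \<le> c"
    using tiling_card[OF t] by (intro power_p_dvd) (simp add: power_add)
  moreover have "card (cuts p D c) + card (cuts p C c) = c + card (cuts p D c \<inter> cuts p C c)"
    using card_Un_Int[of "cuts p D c" "cuts p C c"] cuts_union by simp
  ultimately show ?thesis by simp
qed

text \<open>D has at most \<beta> cuts, C has at most \<open>c - \<beta>\<close> since its
  cardinality has only that many factors p, and together they have c.\<close>

lemma card_cuts_prime_power:
  assumes "card D = p ^ \<beta>" shows "card (cuts p D c) = \<beta>"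
proof -
  have fin: "finite D" "finite C" "p > 1" using t pq prime_gt_1_nat by (auto simp: tiling_def)
  have "p ^ card (cuts p D c) dvd p ^ \<beta>" using cuts_card_dvd[of D p c] fin assms by simp
  then have 1: "card (cuts p D c) \<le> \<beta>" using fin power_dvd_imp_le by blast
  have "p ^ \<beta> * p ^ card (cuts p C c) dvd p ^ \<beta> * card C"
    by (rule mult_dvd_mono[OF dvd_refl cuts_card_dvd]) (use fin in auto)
  then have 2: "\<beta> + card (cuts p C c) \<le> c"
    by (intro power_p_dvd) (simp only: power_add tiling_card[OF t, unfolded assms])
  have "card (cuts p D c) + card (cuts p C c) = c"
    using card_Un_disjoint[of "cuts p D c" "cuts p C c"] cuts_union cuts_disjoint by simp
  then show ?thesis using 1 2 by linarith
qed

text \<open>If \<open>D\<close> has as many cuts as its cardinality allows, it does not branch at the other levels.\<close>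

lemma no_branching:
  assumes "card D = p ^ \<beta>" "u < c" "\<not> inv_shift D (p ^ Suc u) (p ^ u)"
  shows "cnt D (p ^ Suc u) t = 0 \<or> cnt D (p ^ Suc u) (t + p ^ u) = 0"
proof (rule ccontr)
  assume pos: "\<not> ?thesis"
  have fin: "finite D" "p > 1" using t pq prime_gt_1_nat by (auto simp: tiling_def)
  \<comment> \<open>Counting from both sides: every nonempty class modulo \<open>p ^ Suc u\<close>
    has at least \<open>p ^ e\<close> elements, while a class modulo \<open>p ^ u\<close> has at
    most \<open>p ^ e\<close>.\<close>
  define e where "e = card {v \<in> cuts p D c. Suc u \<le> v}"
  have u: "u \<notin> cuts p D c" using assms by (simp add: cuts_def)
  have size: "cnt D (p ^ Suc u) s \<ge> p ^ e" if "cnt D (p ^ Suc u) s > 0" for s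
    using cuts_dvd_cnt[of D p "Suc u" c s] fin assms that dvd_imp_le by (auto simp: e_def)
  have "cnt D (p ^ u) t * p ^ card {v \<in> cuts p D c. v < u} \<le> p ^ \<beta>"
    using cnt_upper_bound[of D p u c t] fin assms by simp
  moreover have \<beta>: "\<beta> = e + card {v \<in> cuts p D c. v < u}"
  proof -
    have eq: "cuts p D c = {v \<in> cuts p D c. v < u} \<union> {v \<in> cuts p D c. Suc u \<le> v}"
    proof -
      have "v < u \<or> Suc u \<le> v" if "v \<in> cuts p D c" for v
        using u that by (cases "v = u") auto
      then show ?thesis by blast
    qed
    have "card ({v \<in> cuts p D c. v < u} \<union> {v \<in> cuts p D c. Suc u \<le> v}) = card {v \<in> cuts p D c. v < u} + e"
      unfolding e_def by (rule card_Un_disjoint) auto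
    then have "card (cuts p D c) = card {v \<in> cuts p D c. v < u} + e" by (rule trans[OF arg_cong[OF eq, of card]])
    then show ?thesis using card_cuts_prime_power[OF assms(1)] by simp
  qed
  ultimately have "cnt D (p ^ u) t * p ^ card {v \<in> cuts p D c. v < u} \<le> p ^ e * p ^ card {v \<in> cuts p D c. v < u}"
    by (simp only: power_add)
  then have le: "cnt D (p ^ u) t \<le> p ^ e" using fin by simp
  have "cnt D (p ^ u) t = (\<Sum>i<p. cnt D (p * p ^ u) (t + i * p ^ u))"
    using fin by (intro cnt_refine) auto
  also have "\<dots> \<ge> (\<Sum>i\<in>{0, 1}. cnt D (p * p ^ u) (t + i * p ^ u))"
    using fin by (intro sum_mono2) auto
  finally have "cnt D (p ^ u) t \<ge> cnt D (p ^ Suc u) t + cnt D (p ^ Suc u) (t + p ^ u)" by simp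
  moreover have "cnt D (p ^ Suc u) t \<ge> p ^ e" "cnt D (p ^ Suc u) (t + p ^ u) \<ge> p ^ e"
    using size pos by auto
  moreover have "p ^ e > 0" using fin by simp
  ultimately show False using le by linarith
qed

end

lemma card_one_class_slice:
  assumes "r > 0" "\<And>x. x \<in> D \<Longrightarrow> x mod r = \<rho>" shows "card (slice r \<rho> D) = card D"
proof -
  have "bij_betw (\<lambda>t. \<rho> + r * t) (slice r \<rho> D) D"
    unfolding bij_betw_def
  proof
    show "inj_on (\<lambda>t. \<rho> + r * t) (slice r \<rho> D)" using assms(1) by (auto simp: inj_on_def)
    show "(\<lambda>t. \<rho> + r * t) ` slice r \<rho> D = D"
    proof (intro equalityI subsetI)
      fix x assume "x \<in> D"
      moreover from this obtain u where "x = \<rho> + r * u" using assms(2) by (metis mod_mult_div_eq)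
      ultimately show "x \<in> (\<lambda>t. \<rho> + r * t) ` slice r \<rho> D" by (auto simp: slice_def)
    qed (auto simp: slice_def)
  qed
  then show ?thesis by (rule bij_betw_same_card)
qed

lemma card_slice_tiling:
  assumes "tiling (r * N) D C" "r > 0" "\<And>x. x \<in> C \<Longrightarrow> x mod r = \<rho>" "i < r"
  shows "card D = r * card (slice r i D)" "tiling N (slice r i D) (slice r \<rho> C)"
proof -
  show t: "tiling N (slice r i D) (slice r \<rho> C)"
    using tiling_reduce[OF tiling_commute[OF assms(1)] assms(2-4)] tiling_commute by blast
  have "card (slice r i D) * card C = N"
    using tiling_card[OF t] card_one_class_slice[of r C \<rho>] assms(2,3) by simp
  moreover have "card D * card C = r * N" using tiling_card[OF assms(1)] .
  ultimately have "card D * card C = (r * card (slice r i D)) * card C" by simp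
  moreover have "card C > 0" using tiling_nonempty[OF assms(1)] assms(1) by (auto simp: tiling_def card_gt_0_iff)
  ultimately show "card D = r * card (slice r i D)" by simp
qed

text \<open>Sands' theorem splits a tiling into tilings of smaller period, so the statement follows by
  induction. When \<open>C\<close> lies in one class modulo \<open>q\<close> and \<open>y = 0\<close>, the slices of \<open>D\<close> modulo \<open>q\<close> have
  prime power cardinality and do not branch at level \<open>x\<close>, which forces them to agree modulo
  \<open>p ^ Suc x\<close>.\<close>

theorem mixed_zero_is_full:
  assumes "prime p" "prime q" "p \<noteq> q"
  shows "tiling (p ^ c * q ^ d) D C \<Longrightarrow> \<not> q\<^sup>2 dvd card D \<Longrightarrow> x < c \<Longrightarrow>
    inv_shift C (p ^ Suc x) (p ^ x) \<Longrightarrow>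
    inv_mixed D (p ^ Suc x * q ^ Suc y) (p ^ x * q ^ Suc y) (p ^ Suc x * q ^ y) \<Longrightarrow>
    inv_shift D (p ^ Suc x * q ^ Suc y) (p ^ Suc x * q ^ y)"
proof (induction "c + d" arbitrary: c d D C x y rule: less_induct)
  case less
  note t = less.prems(1)
  note cutC = less.prems(4)
  note mix = less.prems(5)
  have p0: "p > 1" and q0: "q > 1" using assms prime_gt_1_nat by auto
  have fin: "finite D" "finite C" using t by (auto simp: tiling_def)
  have cop: "coprime q (p ^ n)" for n using assms by (simp add: primes_coprime)
  consider (Dp) "c > 0" "one_class p D" | (Cp) "c > 0" "one_class p C"
    | (Dq) "d > 0" "one_class q D" | (Cq) "d > 0" "one_class q C"
    using sands[OF assms(1,2) t] less.prems(3) by auto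
  then show ?case
  proof cases
    case Dp
    then obtain \<rho> where \<rho>: "\<And>x. x \<in> D \<Longrightarrow> x mod p = \<rho>" unfolding one_class_def by blast
    have \<rho>p: "\<rho> < p"
    proof -
      obtain z where "z \<in> D" using tiling_nonempty[OF t] by blast
      then show ?thesis using \<rho>[of z] p0 by (metis mod_less_divisor order_less_trans zero_less_one)
    qed
    obtain c' where c': "c = Suc c'" using Dp(1) gr0_implies_Suc by blast
    have t': "tiling (p * (p ^ c' * q ^ d)) D C" using t c' by (simp add: mult_ac)
    have z: "cnt D (p * m) s = 0" if "s mod p \<noteq> \<rho>" for m s
      using cnt_one_class[of D p \<rho>] \<rho> that by blast
    show ?thesis
    proof (cases x)
      case 0
      show ?thesis unfolding inv_shift_def
      proof
        fix s
        let ?N = "p ^ Suc x * q ^ Suc y"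
        have N: "?N = p * q ^ Suc y" using 0 by simp
        have ndvd: "\<not> p dvd q ^ Suc y" using assms by (metis prime_dvd_power primes_dvd_imp_eq)
        show "cnt D ?N (s + p ^ Suc x * q ^ y) = cnt D ?N s"
        proof (cases "s mod p = \<rho>")
          case True
          \<comment> \<open>Adding \<open>q ^ Suc y\<close>, which p does not divide, leaves the
            class of D modulo p, so two of the four counts in the mixed relation vanish.\<close>
          have ne: "(s + q ^ Suc y) mod p \<noteq> \<rho>"
          proof
            assume "(s + q ^ Suc y) mod p = \<rho>"
            then have "[s + q ^ Suc y = s + 0] (mod p)" using True by (simp add: cong_def)
            then have "[q ^ Suc y = 0] (mod p)" by (simp only: cong_add_lcancel_nat)
            then show False using ndvd by (simp add: cong_0_iff)
          qed
          have "cnt D ?N (s + q ^ Suc y) = 0" unfolding N by (rule z[OF ne])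
          moreover have "(s + q ^ Suc y + p * q ^ y) mod p \<noteq> \<rho>" using ne by simp
          then have "cnt D ?N (s + q ^ Suc y + p * q ^ y) = 0" unfolding N by (rule z)
          ultimately show ?thesis using mix[unfolded inv_mixed_def, rule_format, of s] 0 by simp
        next
          case False
          then have "(s + p * q ^ y) mod p \<noteq> \<rho>" by simp
          then have "cnt D ?N (s + p * q ^ y) = 0" unfolding N by (rule z)
          then have "cnt D ?N (s + p ^ Suc x * q ^ y) = 0" using 0 by simp
          moreover have "cnt D ?N s = 0" unfolding N by (rule z[OF False])
          ultimately show ?thesis by simp
        qed
      qed
    next
      case (Suc x')
      have "inv_shift (slice p 0 C) (p ^ Suc x') (p ^ x')"
        using cutC Suc p0 by (intro inv_shift_slice) auto
      moreover have "inv_mixed (slice p \<rho> D) (p ^ Suc x' * q ^ Suc y) (p ^ x' * q ^ Suc y) (p ^ Suc x' * q ^ y)"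
        using mix Suc p0 \<rho>p by (intro inv_mixed_slice) (auto simp: mult.assoc)
      moreover have "tiling (p ^ c' * q ^ d) (slice p \<rho> D) (slice p 0 C)"
        using tiling_reduce[OF t' _ \<rho>] p0 by simp
      moreover have "card (slice p \<rho> D) = card D" using \<rho> p0 by (intro card_one_class_slice) auto
      ultimately have "inv_shift (slice p \<rho> D) (p ^ Suc x' * q ^ Suc y) (p ^ Suc x' * q ^ y)"
        using less.hyps[of c' d "slice p \<rho> D" "slice p 0 C" x' y] less.prems c' Suc by simp
      then have "inv_shift D (p * (p ^ Suc x' * q ^ Suc y)) (p * (p ^ Suc x' * q ^ y))"
        by (intro inv_shift_of_slice_one_class[of p D \<rho>]) (use p0 \<rho> in auto)
      then show ?thesis using Suc by (simp add: mult.assoc)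
    qed
  next
    case Cp
    then obtain \<rho> where \<rho>: "\<And>x. x \<in> C \<Longrightarrow> x mod p = \<rho>" unfolding one_class_def by blast
    have \<rho>p: "\<rho> < p"
    proof -
      obtain z where "z \<in> C" using tiling_nonempty[OF t] by blast
      then show ?thesis using \<rho>[of z] p0 by (metis mod_less_divisor order_less_trans zero_less_one)
    qed
    obtain c' where c': "c = Suc c'" using Cp(1) gr0_implies_Suc by blast
    have t': "tiling (p * (p ^ c' * q ^ d)) D C" using t c' by (simp add: mult_ac)
    show ?thesis
    proof (cases x)
      case 0
      \<comment> \<open>As C lies in one class modulo p, its lowest p-adic digit is not
        equidistributed, so \<open>x = 0\<close> is impossible here.\<close>
      have "cnt C (p * 1) (\<rho> + 1) = 0"
      proof (rule cnt_one_class[OF \<rho>])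
        show "(\<rho> + 1) mod p \<noteq> \<rho>" using p0 \<rho>p by (cases "\<rho> + 1 = p") auto
      qed
      moreover have "cnt C (p * 1) \<rho> = card C" 
      proof -
        have "{x \<in> C. [x = \<rho>] (mod (p * 1))} = C" using \<rho> \<rho>p by (auto simp: cong_def)
        then show ?thesis by (simp add: cnt_def)
      qed
      moreover have "cnt C (p * 1) (\<rho> + 1) = cnt C (p * 1) \<rho>"
        using cutC 0 unfolding inv_shift_def by simp
      moreover have "card C > 0" using tiling_nonempty[OF t] fin by (simp add: card_gt_0_iff)
      ultimately show ?thesis by linarith
    next
      case (Suc x')
      have "inv_shift (slice p i D) (p ^ Suc x' * q ^ Suc y) (p ^ Suc x' * q ^ y)" if i: "i < p" for i
      proof -
        have "inv_shift (slice p \<rho> C) (p ^ Suc x') (p ^ x')"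
          using cutC Suc p0 \<rho>p by (intro inv_shift_slice) auto
        moreover have "inv_mixed (slice p i D) (p ^ Suc x' * q ^ Suc y) (p ^ x' * q ^ Suc y) (p ^ Suc x' * q ^ y)"
          using mix Suc p0 i by (intro inv_mixed_slice) (auto simp: mult.assoc)
        moreover have red: "card D = p * card (slice p i D)" "tiling (p ^ c' * q ^ d) (slice p i D) (slice p \<rho> C)"
          using card_slice_tiling[OF t' _ \<rho> i] p0 by auto
        moreover have "\<not> q\<^sup>2 dvd card (slice p i D)" using less.prems(2) red(1) by (metis dvd_mult)
        ultimately show ?thesis
          using less.hyps[of c' d "slice p i D" "slice p \<rho> C" x' y] less.prems(3) c' Suc by simp
      qed
      then have "inv_shift D (p * (p ^ Suc x' * q ^ Suc y)) (p * (p ^ Suc x' * q ^ y))"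
        by (intro inv_shift_of_slice[of p D]) (use p0 in auto)
      then show ?thesis using Suc by (simp add: mult.assoc)
    qed
  next
    case Dq
    then obtain \<rho> where \<rho>: "\<And>x. x \<in> D \<Longrightarrow> x mod q = \<rho>" unfolding one_class_def by blast
    have \<rho>q: "\<rho> < q"
    proof -
      obtain z where "z \<in> D" using tiling_nonempty[OF t] by blast
      then show ?thesis using \<rho>[of z] q0 by (metis mod_less_divisor order_less_trans zero_less_one)
    qed
    obtain d' where d': "d = Suc d'" using Dq(1) gr0_implies_Suc by blast
    have t': "tiling (q * (p ^ c * q ^ d')) D C" using t d' by (simp add: mult_ac)
    have z: "cnt D (q * m) s = 0" if "s mod q \<noteq> \<rho>" for m s
      using cnt_one_class[of D q \<rho>] \<rho> that by blast
    \<comment> \<open>The cut at x belongs to C, hence not to D; the slice of D modulo q inherits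
      this, so the cut falls to the slice of C.\<close>
    have notD: "\<not> inv_shift D (p ^ Suc x) (p ^ x)"
      using cuts_disjoint[OF assms t] cutC less.prems(3) by (auto simp: cuts_def)
    have tr: "tiling (p ^ c * q ^ d') (slice q \<rho> D) (slice q 0 C)"
      using tiling_reduce[OF t' _ \<rho>] q0 by simp
    have "\<not> inv_shift (slice q \<rho> D) (p ^ Suc x) (p ^ x)"
      using notD inv_shift_slice_coprime_iff[of q D \<rho> "p ^ Suc x" "p ^ x"] \<rho> q0 p0 cop[of "Suc x"] by simp
    then have cutC': "inv_shift (slice q 0 C) (p ^ Suc x) (p ^ x)"
      using cuts_union[OF assms tr] less.prems(3) by (auto simp: cuts_def)
    show ?thesis
    proof (cases y)
      case 0
      let ?N = "p ^ Suc x * q"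
      \<comment> \<open>For \<open>y = 0\<close> the shift by \<open>p ^ Suc x\<close> leaves the
        class of D modulo q, and the mixed relation would make x a cut of the slice of D, a
        contradiction.\<close>
      have "inv_shift D (q * p ^ Suc x) (q * p ^ x)" unfolding inv_shift_def
      proof
        fix s
        show "cnt D (q * p ^ Suc x) (s + q * p ^ x) = cnt D (q * p ^ Suc x) s"
        proof (cases "s mod q = \<rho>")
          case True
          have ndvd: "\<not> q dvd p ^ Suc x" using assms by (metis prime_dvd_power primes_dvd_imp_eq)
          have ne: "(s + p ^ Suc x) mod q \<noteq> \<rho>"
          proof
            assume "(s + p ^ Suc x) mod q = \<rho>"
            then have "[s + p ^ Suc x = s + 0] (mod q)" using True by (simp add: cong_def)
            then have "[p ^ Suc x = 0] (mod q)" by (simp only: cong_add_lcancel_nat)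
            then show False using ndvd by (simp add: cong_0_iff)
          qed
          have "cnt D (q * p ^ Suc x) (s + p ^ Suc x) = 0" by (rule z[OF ne])
          moreover have "(s + q * p ^ x + p ^ Suc x) mod q \<noteq> \<rho>"
            using ne by (metis add.assoc add.commute mod_mult_self2)
          then have "cnt D (q * p ^ Suc x) (s + q * p ^ x + p ^ Suc x) = 0" by (rule z)
          moreover have "p ^ Suc x * q ^ Suc y = q * p ^ Suc x" "p ^ x * q ^ Suc y = q * p ^ x"
            "p ^ Suc x * q ^ y = p ^ Suc x" using 0 by simp_all
          ultimately show ?thesis using mix unfolding inv_mixed_def by (metis add.right_neutral)
        next
          case False
          then have "(s + q * p ^ x) mod q \<noteq> \<rho>" by simp
          then show ?thesis using z False by simp
        qed
      qed
      then have "inv_shift (slice q \<rho> D) (p ^ Suc x) (p ^ x)"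
        using q0 \<rho>q by (intro inv_shift_slice) auto
      then have False using \<open>\<not> inv_shift (slice q \<rho> D) (p ^ Suc x) (p ^ x)\<close> by blast
      then show ?thesis ..
    next
      case (Suc y')
      have "inv_mixed (slice q \<rho> D) (p ^ Suc x * q ^ Suc y') (p ^ x * q ^ Suc y') (p ^ Suc x * q ^ y')"
        using mix Suc q0 \<rho>q by (intro inv_mixed_slice) (auto simp: mult_ac)
      moreover have "card (slice q \<rho> D) = card D" using \<rho> q0 by (intro card_one_class_slice) auto
      ultimately have "inv_shift (slice q \<rho> D) (p ^ Suc x * q ^ Suc y') (p ^ Suc x * q ^ y')"
        using less.hyps[of c d' "slice q \<rho> D" "slice q 0 C" x y'] less.prems d' tr cutC' by simp
      then have "inv_shift D (q * (p ^ Suc x * q ^ Suc y')) (q * (p ^ Suc x * q ^ y'))"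
        by (intro inv_shift_of_slice_one_class[of q D \<rho>]) (use q0 \<rho> in auto)
      then show ?thesis using Suc by (simp add: mult_ac)
    qed
  next
    case Cq
    then obtain \<rho> where \<rho>: "\<And>x. x \<in> C \<Longrightarrow> x mod q = \<rho>" unfolding one_class_def by blast
    obtain d' where d': "d = Suc d'" using Cq(1) gr0_implies_Suc by blast
    have t': "tiling (q * (p ^ c * q ^ d')) D C" using t d' by (simp add: mult_ac)
    have cutC': "inv_shift (slice q \<rho> C) (p ^ Suc x) (p ^ x)"
      using cutC inv_shift_slice_coprime_iff[of q C \<rho> "p ^ Suc x" "p ^ x"] \<rho> q0 p0 cop[of "Suc x"] by simp
    note red = card_slice_tiling[OF t' _ \<rho>]
    show ?thesis
    proof (cases y)
      case 0
      have nobranch: "cnt (slice q i D) (p ^ Suc x) s = 0 \<or> cnt (slice q i D) (p ^ Suc x) (s + p ^ x) = 0"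
        if i: "i < q" for i s
      proof -
        have ti: "tiling (p ^ c * q ^ d') (slice q i D) (slice q \<rho> C)" and card: "card D = q * card (slice q i D)"
          using red i q0 by auto
        \<comment> \<open>Slicing uses up the single factor q of \<open>card D\<close>, so the
          slices have the prime power cardinality that \<open>no_branching\<close> requires.\<close>
        have "\<not> q dvd card (slice q i D)"
          using less.prems(2) card by (auto simp: power2_eq_square)
        then have "coprime (card (slice q i D)) (q ^ d')"
          using assms(2) by (metis coprime_commute coprime_power_right_iff prime_imp_coprime)
        moreover have "card (slice q i D) dvd p ^ c * q ^ d'" using tiling_card[OF ti] by (metis dvd_triv_left)
        ultimately have "card (slice q i D) dvd p ^ c" by (simp add: coprime_dvd_mult_left_iff)
        then obtain \<beta> where \<beta>: "card (slice q i D) = p ^ \<beta>" using assms(1) divides_primepow_nat by blast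
        have "\<not> inv_shift (slice q i D) (p ^ Suc x) (p ^ x)"
          using cuts_disjoint[OF assms ti] cutC' less.prems(3) by (auto simp: cuts_def)
        then show ?thesis by (rule no_branching[OF assms ti \<beta> less.prems(3)])
      qed
      have nb: "cnt D (q * p ^ Suc x) s = 0 \<or> cnt D (q * p ^ Suc x) (s + q * p ^ x) = 0" for s
      proof -
        have i: "s mod q < q" using q0 by simp
        have "cnt (slice q (s mod q) D) (p ^ Suc x) (s div q) = cnt D (q * p ^ Suc x) s"
          "cnt (slice q (s mod q) D) (p ^ Suc x) (s div q + p ^ x) = cnt D (q * p ^ Suc x) (s + q * p ^ x)"
          using i q0 by (simp_all add: cnt_slice distrib_left flip: add.assoc)
        then show ?thesis using nobranch[OF i, of "s div q"] by simp
      qed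
      have mix': "cnt D (q * p ^ Suc x) s + cnt D (q * p ^ Suc x) (s + q * p ^ x + p ^ Suc x)
        = cnt D (q * p ^ Suc x) (s + q * p ^ x) + cnt D (q * p ^ Suc x) (s + p ^ Suc x)" for s
        using mix 0 unfolding inv_mixed_def by (simp add: mult_ac)
      show ?thesis unfolding inv_shift_def
      proof
        fix s
        \<comment> \<open>At s as well as at \<open>s + p ^ Suc x\<close>, one of the counts with
          and without the shift \<open>q * p ^ x\<close> is 0; in each of the four cases the mixed
          relation leaves only equality.\<close>
        have "cnt D (q * p ^ Suc x) (s + p ^ Suc x) = cnt D (q * p ^ Suc x) s"
          using nb[of s] nb[of "s + p ^ Suc x"] mix'[of s] by (auto simp: add_ac)
        then show "cnt D (p ^ Suc x * q ^ Suc y) (s + p ^ Suc x * q ^ y) = cnt D (p ^ Suc x * q ^ Suc y) s"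
          using 0 by (simp add: mult_ac)
      qed
    next
      case (Suc y')
      have "inv_shift (slice q i D) (p ^ Suc x * q ^ Suc y') (p ^ Suc x * q ^ y')" if i: "i < q" for i
      proof -
        have "inv_mixed (slice q i D) (p ^ Suc x * q ^ Suc y') (p ^ x * q ^ Suc y') (p ^ Suc x * q ^ y')"
          using mix Suc q0 i by (intro inv_mixed_slice) (auto simp: mult_ac)
        moreover have r: "card D = q * card (slice q i D)" "tiling (p ^ c * q ^ d') (slice q i D) (slice q \<rho> C)"
          using red[OF _ _ i] q0 by auto
        moreover have "\<not> q\<^sup>2 dvd card (slice q i D)" using less.prems(2) r(1) by (metis dvd_mult)
        ultimately show ?thesis
          using less.hyps[of c d' "slice q i D" "slice q \<rho> C" x y'] less.prems(3) d' cutC' by simp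
      qed
      then have "inv_shift D (q * (p ^ Suc x * q ^ Suc y')) (q * (p ^ Suc x * q ^ y'))"
        by (intro inv_shift_of_slice[of q D]) (use q0 in auto)
      then show ?thesis using Suc by (simp add: mult_ac)
    qed
  qed
qed

section \<open>Attractors with interior\<close>

fun digit_sums :: "nat \<Rightarrow> nat set \<Rightarrow> nat \<Rightarrow> nat set" where
  "digit_sums b D 0 = {0}"
| "digit_sums b D (Suc M) = (\<lambda>(d, w). d + b * w) ` (D \<times> digit_sums b D M)"

lemma finite_digit_sums: "finite D \<Longrightarrow> finite (digit_sums b D M)"
  by (induction M) auto

lemma card_digit_sums_le: "finite D \<Longrightarrow> card (digit_sums b D M) \<le> card D ^ M"
proof (induction M)
  case (Suc M)
  have "card (digit_sums b D (Suc M)) \<le> card (D \<times> digit_sums b D M)"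
    unfolding digit_sums.simps by (rule card_image_le) (use Suc finite_digit_sums in auto)
  then show ?case using Suc by (auto simp: card_cartesian_product intro: order_trans mult_le_mono2)
qed simp

locale digits =
  fixes b :: nat and D :: "nat set"
  assumes b: "b \<ge> 2" and D: "finite D" "D \<noteq> {}"
begin

abbreviation "T \<equiv> tile_attractor b D"

definition val :: "(nat \<Rightarrow> nat) \<Rightarrow> real" where
  "val d = (\<Sum>k. real (d k) / real b ^ Suc k)"

lemma T_altdef: "x \<in> T \<longleftrightarrow> (\<exists>d. (\<forall>k. d k \<in> D) \<and> x = val d)"
  by (simp add: tile_attractor_def val_def)

lemma geom: "(\<lambda>k. real (Max D) * (1 / real b) ^ Suc k) sums (real (Max D) / (real b - 1))"
proof -
  have "(\<lambda>k. (1 / real b) ^ k) sums (1 / (1 - 1 / real b))"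
    by (rule geometric_sums) (use b in simp)
  then have "(\<lambda>k. (real (Max D) / real b) * (1 / real b) ^ k) sums ((real (Max D) / real b) * (1 / (1 - 1 / real b)))"
    by (rule sums_mult)
  moreover have "(real (Max D) / real b) * (1 / (1 - 1 / real b)) = real (Max D) / (real b - 1)"
    using b by (simp add: field_simps)
  moreover have "(\<lambda>k. (real (Max D) / real b) * (1 / real b) ^ k) = (\<lambda>k. real (Max D) * (1 / real b) ^ Suc k)"
    by (simp add: fun_eq_iff)
  ultimately show ?thesis by (simp only:)
qed

lemma term_le: "\<forall>k. d k \<in> D \<Longrightarrow> real (d k) / real b ^ Suc k \<le> real (Max D) * (1 / real b) ^ Suc k"
proof -
  assume "\<forall>k. d k \<in> D"
  then have "real (d k) \<le> real (Max D)" using D by simp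
  then show ?thesis using b by (simp add: divide_right_mono power_one_over field_simps)
qed

lemma summable_digits: assumes "\<forall>k. d k \<in> D" shows "summable (\<lambda>k. real (d k) / real b ^ Suc k)"
proof (rule summable_comparison_test'[of "\<lambda>k. real (Max D) * (1 / real b) ^ Suc k" 0])
  show "summable (\<lambda>k. real (Max D) * (1 / real b) ^ Suc k)" using geom by (rule sums_summable)
qed (use term_le[OF assms] in simp)

lemma T_bounds: assumes "x \<in> T" shows "0 \<le> x" "x \<le> real (Max D)"
proof -
  obtain d where d: "\<forall>k. d k \<in> D" "x = val d" using assms T_altdef by blast
  show "0 \<le> x" unfolding d val_def by (rule suminf_nonneg[OF summable_digits[OF d(1)]]) simp
  have "x \<le> real (Max D) / (real b - 1)"
    unfolding d val_def sums_unique[OF geom]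
    by (rule suminf_le[OF _ summable_digits[OF d(1)] sums_summable[OF geom]]) (rule term_le[OF d(1)])
  also have "\<dots> \<le> real (Max D)" using b by (simp add: divide_le_eq mult_le_cancel_left1)
  finally show "x \<le> real (Max D)" .
qed

lemma val_head: assumes "\<forall>k. d k \<in> D" shows "real b * val d = real (d 0) + val (\<lambda>k. d (Suc k))"
proof -
  have "val d = real (d 0) / real b + (\<Sum>k. real (d (Suc k)) / real b ^ Suc (Suc k))"
    unfolding val_def using suminf_split_head[OF summable_digits[OF assms]] by simp
  also have "(\<Sum>k. real (d (Suc k)) / real b ^ Suc (Suc k)) = (\<Sum>k. (1 / real b) * (real (d (Suc k)) / real b ^ Suc k))"
    by (simp add: field_simps)
  also have "\<dots> = (1 / real b) * val (\<lambda>k. d (Suc k))"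
    unfolding val_def by (rule suminf_mult) (use summable_digits[of "\<lambda>k. d (Suc k)"] assms in simp)
  finally show ?thesis using b by (simp add: field_simps)
qed

lemma T_step: "x \<in> T \<longleftrightarrow> (\<exists>d\<in>D. real b * x - real d \<in> T)"
proof
  assume "x \<in> T"
  then obtain d where d: "\<forall>k. d k \<in> D" "x = val d" using T_altdef by blast
  have eq: "real b * x - real (d 0) = val (\<lambda>k. d (Suc k))" using val_head[OF d(1)] d(2) by simp
  have "real b * x - real (d 0) \<in> T" unfolding T_altdef
    by (intro exI[of _ "\<lambda>k. d (Suc k)"] conjI eq) (use d(1) in simp)
  then show "\<exists>d\<in>D. real b * x - real d \<in> T" using d(1) by blast
next
  assume "\<exists>d\<in>D. real b * x - real d \<in> T"
  then obtain d e where de: "d \<in> D" "\<forall>k. e k \<in> D" "real b * x - real d = val e"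
    using T_altdef by blast
  define f where "f = case_nat d e"
  have f: "\<forall>k. f k \<in> D" using de by (auto simp: f_def split: nat.split)
  have "real b * val f = real d + val e" using val_head[OF f] by (simp add: f_def)
  then have "real b * val f = real b * x" using de by simp
  then have "x = val f" using b by simp
  then show "x \<in> T" unfolding T_altdef using f by blast
qed

lemma T_iter: "x \<in> T \<longleftrightarrow> (\<exists>w\<in>digit_sums b D M. real b ^ M * x - real w \<in> T)"
proof (induction M)
  case (Suc M)
  have "x \<in> T \<longleftrightarrow> (\<exists>w\<in>digit_sums b D M. \<exists>d\<in>D. real b * (real b ^ M * x - real w) - real d \<in> T)"
    unfolding Suc by (subst T_step) blast
  also have "\<dots> \<longleftrightarrow> (\<exists>w\<in>digit_sums b D (Suc M). real b ^ Suc M * x - real w \<in> T)"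
    by (auto simp: algebra_simps)
  finally show ?case .
qed simp

definition Tx :: "real \<Rightarrow> int set" where
  "Tx x = {n. real_of_int n + x \<in> T}"

lemma Tx_subset: "Tx x \<subseteq> {\<lceil>- x\<rceil>..\<lfloor>real (Max D) - x\<rfloor>}"
proof
  fix n assume "n \<in> Tx x"
  then have "0 \<le> real_of_int n + x" "real_of_int n + x \<le> real (Max D)"
    using T_bounds by (auto simp: Tx_def)
  then show "n \<in> {\<lceil>- x\<rceil>..\<lfloor>real (Max D) - x\<rfloor>}" by (auto simp: ceiling_le_iff le_floor_iff)
qed

lemma finite_Tx [simp]: "finite (Tx x)"
  using Tx_subset finite_subset by blast

lemma card_Tx_shift: "card (Tx (x + of_int k)) = card (Tx x)"
proof -
  have "bij_betw (\<lambda>n. n + k) (Tx (x + of_int k)) (Tx x)"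
    unfolding bij_betw_def
  proof
    show "(\<lambda>n. n + k) ` Tx (x + of_int k) = Tx x"
    proof (intro equalityI subsetI)
      fix n assume "n \<in> Tx x"
      then have "n - k \<in> Tx (x + of_int k)" by (simp add: Tx_def)
      then show "n \<in> (\<lambda>n. n + k) ` Tx (x + of_int k)" by (intro image_eqI[of _ _ "n - k"]) auto
    qed (auto simp: Tx_def add_ac)
  qed simp
  then show ?thesis by (rule bij_betw_same_card)
qed

text \<open>An integer translation keeps the cardinality. The choice \<open>x \<le> 0\<close> makes
  \<open>Tx x\<close> consist of nonnegative integers, because T has no negative elements.\<close>

lemma minimal_slice:
  obtains x where "-1 < x" "x \<le> 0" "\<And>y. card (Tx x) \<le> card (Tx y)"
proof -
  obtain x where x: "\<And>y. card (Tx x) \<le> card (Tx y)"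
    using ex_has_least_nat[of "\<lambda>_. True" 0 "\<lambda>x. card (Tx x)"] by blast
  define x' where "x' = x + of_int (- \<lceil>x\<rceil>)"
  have "card (Tx x') = card (Tx x)" unfolding x'_def by (rule card_Tx_shift)
  moreover have "-1 < x'" "x' \<le> 0" unfolding x'_def by (simp_all add: le_of_int_ceiling) linarith
  ultimately show ?thesis using that x by metis
qed

end

definition slice_sums :: "nat \<Rightarrow> nat set \<Rightarrow> nat set \<Rightarrow> nat \<Rightarrow> nat set" where
  "slice_sums b D X M = (\<lambda>(w, t). w + t) ` (digit_sums b D M \<times> X)"

lemma card_slice: "r > 0 \<Longrightarrow> i < r \<Longrightarrow> card (slice r i Y) = cnt Y r i"
  using cnt_slice[of r i Y 1 0] by simp

lemma sum_cnt: "finite Y \<Longrightarrow> m > 0 \<Longrightarrow> (\<Sum>i<m. cnt Y m i) = card Y"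
  using cnt_refine[of Y m 1 0] by simp

text \<open>\<open>X\<close> is a slice of the attractor along a coset of the integers, of minimal cardinality. By
  minimality the translates that make up \<open>slice_sums b D X M\<close> do not overlap.\<close>

lemma tile_structure:
  assumes tile: "tile_digit_set b D"
  obtains X where "finite X" "X \<noteq> {}"
    "\<And>M. inj_on (\<lambda>(w, t). w + t) (digit_sums b D M \<times> X)" "\<And>M. card (digit_sums b D M) = b ^ M"
    "\<And>M r. r < b ^ M \<Longrightarrow> cnt (slice_sums b D X M) (b ^ M) r = card X"
    "\<And>L. \<exists>M s. {s..<s + L} \<subseteq> slice_sums b D X M"
proof -
  have b2: "b \<ge> 2" and cD: "card D = b" and int: "interior (tile_attractor b D) \<noteq> {}"
    using tile by (auto simp: tile_digit_set_def)
  have finD: "finite D" "D \<noteq> {}" using b2 cD by (auto intro: card_ge_0_finite)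
  interpret digits b D using b2 finD by unfold_locales auto
  obtain x where x: "-1 < x" "x \<le> 0" "\<And>y. card (Tx x) \<le> card (Tx y)" using minimal_slice by metis
  define X where "X = {n::nat. real n + x \<in> T}"
  define Y where "Y = slice_sums b D X"
  have intX: "Tx x = int ` X"
  proof (intro equalityI subsetI)
    fix n assume n: "n \<in> Tx x"
    then have "0 \<le> real_of_int n + x" using T_bounds by (auto simp: Tx_def)
    then have "n \<ge> 0" using x(2) by linarith
    then show "n \<in> int ` X" using n by (intro image_eqI[of _ _ "nat n"]) (auto simp: Tx_def X_def)
  qed (auto simp: Tx_def X_def)
  then have finX: "finite X" using finite_imageD[of int X] finite_Tx[of x] by (simp add: inj_on_def)
  have cardX: "card (Tx x) = card X" using intX by (simp add: card_image inj_on_def)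
  have finY: "finite (Y M)" for M using finX finite_digit_sums[OF finD(1)] by (simp add: Y_def slice_sums_def)
  \<comment> \<open>By the self-similarity \<open>T_iter\<close>, scaling with \<open>b ^ M\<close>
    turns the slice at \<open>(x + real s) / real b ^ M\<close> into the elements of
    \<open>Y M\<close> in the class s.\<close>
  have slY: "card (Tx ((x + real s) / real b ^ M)) = cnt (Y M) (b ^ M) s" if s: "s < b ^ M" for s M
  proof -
    have bM: "b ^ M > 0" using b2 by simp
    have mem: "n \<in> Tx ((x + real s) / real b ^ M) \<longleftrightarrow> (\<exists>w\<in>digit_sums b D M. int (b ^ M) * n + int s - int w \<in> int ` X)" for n
    proof -
      have "real b ^ M * (real_of_int n + (x + real s) / real b ^ M) - real w
         = real_of_int (int (b ^ M) * n + int s - int w) + x" for w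
        using b2 by (simp add: field_simps)
      then have "n \<in> Tx ((x + real s) / real b ^ M) \<longleftrightarrow> (\<exists>w\<in>digit_sums b D M. int (b ^ M) * n + int s - int w \<in> Tx x)"
        unfolding Tx_def mem_Collect_eq by (subst T_iter[of _ M]) (simp only:)
      then show ?thesis by (simp only: intX)
    qed
    have "Tx ((x + real s) / real b ^ M) = int ` slice (b ^ M) s (Y M)"
    proof (intro equalityI subsetI)
      fix n assume "n \<in> Tx ((x + real s) / real b ^ M)"
      then obtain w t where wt: "w \<in> digit_sums b D M" "t \<in> X" "int (b ^ M) * n + int s - int w = int t"
        using mem by blast
      have "n \<ge> 0"
      proof (rule ccontr)
        assume "\<not> n \<ge> 0"
        then have "int (b ^ M) * n \<le> int (b ^ M) * (-1)" by (intro mult_left_mono) auto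
        moreover have "int (b ^ M) * n + int s \<ge> 0" using wt(3) by linarith
        ultimately show False using s by linarith
      qed
      then obtain m where m: "n = int m" using nonneg_int_cases by blast
      have "int (s + b ^ M * m) = int (w + t)" using wt(3) m by simp
      then have "s + b ^ M * m = w + t" by (simp only: of_nat_eq_iff)
      then have "m \<in> slice (b ^ M) s (Y M)" using wt by (auto simp: slice_def Y_def slice_sums_def)
      then show "n \<in> int ` slice (b ^ M) s (Y M)" using m by blast
    next
      fix n assume "n \<in> int ` slice (b ^ M) s (Y M)"
      then obtain m w t where "n = int m" "w \<in> digit_sums b D M" "t \<in> X" "s + b ^ M * m = w + t"
        by (auto simp: slice_def Y_def slice_sums_def)
      moreover from this have "int (b ^ M) * n + int s - int w = int t"
        by (metis add.commute add_diff_cancel_left' of_nat_add of_nat_mult)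
      ultimately show "n \<in> Tx ((x + real s) / real b ^ M)" using mem by blast
    qed
    then show ?thesis using card_slice[OF bM s] by (simp add: card_image inj_on_def)
  qed
  have ge: "card X \<le> cnt (Y M) (b ^ M) s" if "s < b ^ M" for s M
    using slY[OF that] x(3) cardX by metis
  \<comment> \<open>An interval inside T, magnified by \<open>b ^ M\<close>, becomes an arbitrarily
    long run of integers in \<open>Y M\<close>.\<close>
  have cover: "\<exists>M s. {s..<s + L} \<subseteq> Y M" for L
  proof -
    obtain z e where ze: "e > 0" "ball z e \<subseteq> T" using int by (metis ex_in_conv mem_interior)
    define u where "u = z - e"
    have uT: "y \<in> T" if "u < y" "y < u + 2 * e" for y
      using that ze by (auto simp: u_def dist_real_def subset_iff abs_if)
    have "u \<ge> 0"
    proof (rule ccontr)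
      assume "\<not> u \<ge> 0"
      define y where "y = (u + min 0 (u + 2 * e)) / 2"
      have "u < y" "y < u + 2 * e" "y < 0" using \<open>\<not> u \<ge> 0\<close> ze(1) by (auto simp: y_def min_def)
      then show False using uT T_bounds(1) by fastforce
    qed
    obtain M where M: "real b ^ M > (real L + 3) / (2 * e)"
      using real_arch_pow[of "real b"] b2 by fastforce
    define s where "s = nat \<lceil>real b ^ M * u - x\<rceil> + 1"
    have bu: "real b ^ M * u \<ge> 0" using \<open>u \<ge> 0\<close> by simp
    have s1: "real s > real b ^ M * u - x" "real s \<le> real b ^ M * u - x + 2"
      using bu x unfolding s_def by linarith+
    have "{s..<s + L} \<subseteq> Y M"
    proof
      fix n assume n: "n \<in> {s..<s + L}"
      define y where "y = (real n + x) / real b ^ M"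
      have bM: "real b ^ M > 0" using b2 by simp
      have "real n \<ge> real s" "real n < real s + real L" using n by auto
      then have "real n + x > real b ^ M * u" "real n + x < real b ^ M * u + (real L + 3)"
        using s1 by linarith+
      moreover have "real b ^ M * (2 * e) > real L + 3" using M ze(1) by (simp add: field_simps)
      ultimately have "real b ^ M * u < real n + x" "real n + x < real b ^ M * (u + 2 * e)"
        by (simp_all add: distrib_left)
      then have "u < y" "y < u + 2 * e" using bM by (simp_all add: y_def field_simps)
      then have "y \<in> T" by (rule uT)
      then obtain w where w: "w \<in> digit_sums b D M" "real b ^ M * y - real w \<in> T" using T_iter by blast
      have eq: "real b ^ M * y - real w = real n + x - real w" using bM by (simp add: y_def)
      have "real n + x - real w \<ge> 0" using T_bounds(1) w(2) eq by metis
      then have "w \<le> n" using x(2) by linarith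
      then have "n - w \<in> X" using w(2) eq by (simp add: X_def algebra_simps)
      then have "w + (n - w) \<in> Y M" using w(1) by (auto simp: Y_def slice_sums_def)
      then show "n \<in> Y M" using \<open>w \<le> n\<close> by simp
    qed
    then show ?thesis by blast
  qed
  have "X \<noteq> {}"
  proof
    assume "X = {}"
    moreover obtain M s where "{s..<s + 1} \<subseteq> Y M" using cover by blast
    ultimately show False by (auto simp: Y_def slice_sums_def)
  qed
  then have X0: "card X > 0" using finX by (simp add: card_gt_0_iff)
  \<comment> \<open>By minimality each of the \<open>b ^ M\<close> classes has at least
    \<open>card X\<close> elements, and \<open>Y M\<close> has at most \<open>b ^ M * card X\<close>
    in all; so every estimate is an equality.\<close>
  have main: "inj_on (\<lambda>(w, t). w + t) (digit_sums b D M \<times> X) \<and> card (digit_sums b D M) = b ^ M \<and>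
     (\<forall>r<b ^ M. cnt (Y M) (b ^ M) r = card X)" for M
  proof -
    have le1: "card (Y M) \<le> card (digit_sums b D M) * card X"
      unfolding Y_def slice_sums_def
      using card_image_le[of "digit_sums b D M \<times> X"] finX finite_digit_sums[OF finD(1)] by (simp add: card_cartesian_product)
    have le2: "card (digit_sums b D M) \<le> b ^ M" using card_digit_sums_le[OF finD(1)] cD by simp
    have sum: "(\<Sum>i<b ^ M. cnt (Y M) (b ^ M) i) = card (Y M)" using finY b2 by (intro sum_cnt) auto
    have "(\<Sum>i<b ^ M. card X) \<le> (\<Sum>i<b ^ M. cnt (Y M) (b ^ M) i)"
      using ge by (intro sum_mono) auto
    then have ge1: "b ^ M * card X \<le> card (Y M)" using sum by simp
    have "b ^ M * card X \<le> card (digit_sums b D M) * card X" using ge1 le1 by linarith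
    then have c: "card (digit_sums b D M) = b ^ M" using le2 X0 by simp
    then have cY: "card (Y M) = card (digit_sums b D M) * card X" using le1 ge1 by simp
    then have "inj_on (\<lambda>(w, t). w + t) (digit_sums b D M \<times> X)"
      unfolding Y_def slice_sums_def
      using finX finite_digit_sums[OF finD(1)] by (intro eq_card_imp_inj_on) (auto simp: card_cartesian_product)
    moreover have "cnt (Y M) (b ^ M) r = card X" if r: "r < b ^ M" for r
    proof (rule ccontr)
      assume "cnt (Y M) (b ^ M) r \<noteq> card X"
      then have "card X < cnt (Y M) (b ^ M) r" using ge[OF r] by simp
      then have "(\<Sum>i<b ^ M. card X) < (\<Sum>i<b ^ M. cnt (Y M) (b ^ M) i)"
        using ge r by (intro sum_strict_mono_ex1) auto
      then show False using sum cY c by simp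
    qed
    ultimately show ?thesis using c by blast
  qed
  show ?thesis
    by (rule that[of X]) (use finX \<open>X \<noteq> {}\<close> main cover in \<open>auto simp: Y_def\<close>)
qed

lemma ev_digit_sums:
  assumes "finite D" "D \<noteq> {}" "\<And>M. card (digit_sums b D M) = card D ^ M"
  shows "ev (digit_sums b D M) z = (\<Prod>i<M. ev D (z ^ (b ^ i)))"
proof (induction M arbitrary: z)
  case (Suc M)
  have inj: "inj_on (\<lambda>(d, w). d + b * w) (D \<times> digit_sums b D M)"
    using assms(3)[of "Suc M"] assms(3)[of M] assms(1) finite_digit_sums[OF assms(1)]
    by (intro eq_card_imp_inj_on) (auto simp: card_cartesian_product)
  have "ev (digit_sums b D (Suc M)) z = (\<Sum>(d, w)\<in>D \<times> digit_sums b D M. z ^ (d + b * w))"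
    unfolding ev_def digit_sums.simps by (subst sum.reindex[OF inj]) (simp add: case_prod_unfold)
  also have "\<dots> = ev D z * ev (digit_sums b D M) (z ^ b)"
    by (simp add: ev_def sum_product sum.cartesian_product power_add power_mult)
  also have "\<dots> = ev D z * (\<Prod>i<M. ev D (z ^ (b ^ Suc i)))"
    unfolding Suc by (simp add: power_mult)
  also have "\<dots> = (\<Prod>i<Suc M. ev D (z ^ (b ^ i)))"
    by (subst prod.lessThan_Suc_shift) simp
  finally show ?case .
qed (simp add: ev_def)

section \<open>Blocking zeros and periodic tilings of a tile digit set\<close>

text \<open>The predicate is arbitrary because the criterion is applied to mask polynomials and also
  to products of two of them whose sums might still coincide.\<close>

definition blocking :: "nat \<Rightarrow> (complex \<Rightarrow> bool) \<Rightarrow> bool" where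
  "blocking b Z \<longleftrightarrow> (\<forall>n>0. \<exists>m>0. Z (rt (b ^ m) n))"

text \<open>The sums over \<open>digit_sums b D M\<close> and over the slice \<open>X\<close> multiply to zero; the second tends to
  \<open>card X\<close>.\<close>

lemma tile_blocking:
  assumes tile: "tile_digit_set b D"
  shows "blocking b (\<lambda>z. ev D z = 0)"
proof (rule ccontr)
  assume "\<not> ?thesis"
  then obtain n where n: "n > 0" "\<And>m. m > 0 \<Longrightarrow> ev D (rt (b ^ m) n) \<noteq> 0" unfolding blocking_def by blast
  have b2: "b \<ge> 2" and cD: "card D = b" using tile by (auto simp: tile_digit_set_def)
  have finD: "finite D" "D \<noteq> {}" using b2 cD by (auto intro: card_ge_0_finite)
  obtain X where X: "finite X" "X \<noteq> {}"
    "\<And>M. inj_on (\<lambda>(w, t). w + t) (digit_sums b D M \<times> X)" "\<And>M. card (digit_sums b D M) = b ^ M"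
    "\<And>M r. r < b ^ M \<Longrightarrow> cnt (slice_sums b D X M) (b ^ M) r = card X"
    using tile_structure[OF tile] by metis
  have zero: "ev X (rt (b ^ M) n) = 0" if M: "M \<ge> n" for M
  proof -
    let ?z = "rt (b ^ M) n"
    have bM: "b ^ M > n" 
    proof -
      have "n < 2 ^ n" by (rule less_exp)
      also have "(2::nat) ^ n \<le> 2 ^ M" using M by (intro power_increasing) auto
      also have "\<dots> \<le> b ^ M" using b2 by (intro power_mono) auto
      finally show ?thesis .
    qed
    have "ev (digit_sums b D M) ?z * ev X ?z = (\<Sum>(w, t)\<in>digit_sums b D M \<times> X. ?z ^ (w + t))"
      by (simp add: ev_def sum_product sum.cartesian_product power_add)
    also have "\<dots> = ev (slice_sums b D X M) ?z"
      unfolding ev_def slice_sums_def by (subst sum.reindex[OF X(3)]) (simp add: case_prod_unfold)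
    also have "\<dots> = (\<Sum>t<b ^ M. of_nat (cnt (slice_sums b D X M) (b ^ M) t) * rt (b ^ M) (n * t))"
      using X finite_digit_sums[OF finD(1)] b2 by (intro ev_cnt) (auto simp: slice_sums_def)
    also have "\<dots> = of_nat (card X) * (\<Sum>t<b ^ M. rt (b ^ M) (n * t))"
      unfolding sum_distrib_left by (intro sum.cong) (auto simp: X(5))
    also have "\<dots> = 0"
      using bM n(1) b2 by (subst sum_rt) (auto dest: dvd_imp_le)
    finally have "ev (digit_sums b D M) ?z * ev X ?z = 0" .
    moreover have "ev (digit_sums b D M) ?z \<noteq> 0"
    proof -
      have "?z ^ (b ^ i) = rt (b ^ (M - i)) n" if "i < M" for i
      proof -
        have "rt (b ^ i * b ^ (M - i)) (b ^ i * n) = rt (b ^ (M - i)) n"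
          using b2 by (intro rt_cancel) simp
        then show ?thesis using that by (simp add: rt_power flip: power_add)
      qed
      then have "ev D (?z ^ (b ^ i)) \<noteq> 0" if "i < M" for i using n(2) that by simp
      then show ?thesis using ev_digit_sums[OF finD] X(4) cD by simp
    qed
    ultimately show ?thesis by simp
  qed
  have "(\<lambda>M. 2 * pi * real n / real (b ^ M)) \<longlonglongrightarrow> 0"
  proof -
    have "(\<lambda>M. (2 * pi * real n) * (1 / real b) ^ M) \<longlonglongrightarrow> (2 * pi * real n) * 0"
      by (intro tendsto_mult tendsto_const LIMSEQ_realpow_zero) (use b2 in auto)
    then show ?thesis by (simp add: power_one_over field_simps)
  qed
  then have "(\<lambda>M. rt (b ^ M) n) \<longlonglongrightarrow> cis 0"
    unfolding rt_def by (intro tendsto_intros)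
  then have "(\<lambda>M. ev X (rt (b ^ M) n)) \<longlonglongrightarrow> ev X (cis 0)"
    unfolding ev_def by (intro tendsto_intros)
  moreover have "(\<lambda>M. ev X (rt (b ^ M) n)) \<longlonglongrightarrow> 0"
    by (rule tendsto_eventually) (use zero in \<open>auto simp: eventually_sequentially\<close>)
  ultimately have "ev X (cis 0) = 0" using LIMSEQ_unique by blast
  then show False using X by simp
qed

text \<open>The part of \<open>C\<close> just below a position determines its continuation, and by the pigeonhole
  principle two positions see the same part.\<close>

lemma periodic_tiling:
  assumes "finite D" "D \<noteq> {}"
    and ex: "\<And>L. \<exists>C s. finite C \<and> inj_on (\<lambda>(d, c). d + c) (D \<times> C) \<and> {s..<s + L} \<subseteq> (\<lambda>(d, c). d + c) ` (D \<times> C)"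
  obtains N C where "tiling N D C"
proof -
  define R where "R = Suc (Max D)"
  have R: "d < R" if "d \<in> D" for d using that assms by (simp add: R_def le_imp_less_Suc)
  \<comment> \<open>There are \<open>2 ^ R\<close> possible patterns of C on the R places below a
    position, and only from these places can a sum reach across the position.\<close>
  define K where "K = (2::nat) ^ R"
  obtain C s where C: "finite C" "inj_on (\<lambda>(d, c). d + c) (D \<times> C)"
    "{s..<s + (R + (K + 1) * (R + 1))} \<subseteq> (\<lambda>(d, c). d + c) ` (D \<times> C)" using ex by metis
  define pos where "pos i = s + R + i * (R + 1)" for i
  define st where "st i = {k \<in> {1..R}. pos i - k \<in> C}" for i
  have "\<not> inj_on st {..K}"
  proof
    assume "inj_on st {..K}"
    moreover have "st ` {..K} \<subseteq> Pow {1..R}" by (auto simp: st_def)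
    ultimately have "card {..K} \<le> card (Pow {1..R})" by (intro card_inj_on_le) auto
    then show False by (simp add: card_Pow K_def)
  qed
  then obtain i j where ij: "i < j" "j \<le> K" "st i = st j"
    unfolding inj_on_def by (metis atMost_iff linorder_neqE_nat)
  define t t' N where "t = pos i" and "t' = pos j" and "N = t' - t"
  have tt: "t' = t + N" "N > R" "t \<ge> R + s"
  proof -
    have "(i + 1) * (R + 1) \<le> j * (R + 1)" using ij(1) by (intro mult_le_mono1) simp
    then have "pos i + (R + 1) \<le> pos j" by (simp add: pos_def)
    then show "t' = t + N" "N > R" by (auto simp: t_def t'_def N_def)
    show "t \<ge> R + s" by (simp add: t_def pos_def)
  qed
  have t'le: "t' \<le> s + (R + (K + 1) * (R + 1))"
  proof -
    have "j * (R + 1) \<le> (K + 1) * (R + 1)" using ij(2) by (intro mult_le_mono1) simp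
    then show ?thesis by (simp add: t'_def pos_def)
  qed
  have state: "t - k \<in> C \<longleftrightarrow> t' - k \<in> C" if "k \<in> {1..R}" for k
  proof -
    have "k \<in> st i \<longleftrightarrow> k \<in> st j" using ij by simp
    then show ?thesis using that by (simp add: st_def t_def t'_def)
  qed
  define C' where "C' = {c \<in> C. t \<le> c \<and> c < t'}"
  have "bij_betw (\<lambda>(d, c). (d + c) mod N) (D \<times> C') {..<N}"
    unfolding bij_betw_def
  proof
    \<comment> \<open>If two sums differed by N, then c would lie at most R below \<open>t'\<close>.
      By the equal patterns, c lowered by N, which is \<open>t - k\<close>, is in C too and gives
      the same sum as \<open>c'\<close>, although it lies below t.\<close>
    have key: False if *: "d \<in> D" "c \<in> C'" "d' \<in> D" "c' \<in> C'" "d + c = d' + c' + N" for d c d' c'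
    proof -
      have "t' \<le> d + c" using * tt by (simp add: C'_def)
      define k where "k = t' - c"
      have k: "k \<in> {1..R}" using * R[of d] \<open>t' \<le> d + c\<close> by (auto simp: k_def C'_def)
      have "t' - k = c" using * by (simp add: k_def C'_def)
      then have "t - k \<in> C" using state[OF k] * by (simp add: C'_def)
      moreover have "c + k = t + N" "k \<le> t" using * tt k by (auto simp: k_def C'_def)
      then have "d + (t - k) = d' + c'" using *(5) by linarith
      ultimately have "t - k = c'" using C(2) * unfolding inj_on_def C'_def by fastforce
      moreover have "t \<le> c'" "1 \<le> k" using * k by (auto simp: C'_def)
      ultimately show False using \<open>k \<le> t\<close> by linarith
    qed
    show "inj_on (\<lambda>(d, c). (d + c) mod N) (D \<times> C')"
    proof (rule inj_onI, clarify)
      fix d c d' c' assume *: "d \<in> D" "c \<in> C'" "d' \<in> D" "c' \<in> C'" "(d + c) mod N = (d' + c') mod N"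
      have bd: "t \<le> e + f \<and> e + f < t + N + R" if "e \<in> D" "f \<in> C'" for e f
        using that R[of e] tt by (auto simp: C'_def)
      have aux: "x = y \<or> x = y + N" if "x mod N = y mod N" "y \<le> x" "x < y + 2 * N" for x y :: nat
      proof -
        have "N dvd x - y" using that by (simp add: mod_eq_dvd_iff_nat)
        then obtain m where "x - y = N * m" by blast
        then have x: "x = y + N * m" using that(2) by linarith
        then have "N * m < N * 2" using that(3) by simp
        then have "m < 2" by simp
        then have "m = 0 \<or> m = 1" by auto
        then show ?thesis using x by auto
      qed
      have "d + c = d' + c' \<or> d + c = d' + c' + N \<or> d' + c' = d + c + N"
      proof (cases "d' + c' \<le> d + c")
        case True
        then show ?thesis using aux[of "d + c" "d' + c'"] * bd[of d c] bd[of d' c'] tt by auto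
      next
        case False
        then show ?thesis using aux[of "d' + c'" "d + c"] * bd[of d c] bd[of d' c'] tt by auto
      qed
      then have "d + c = d' + c'" using key * by blast
      then show "d = d' \<and> c = c'" using C(2) * unfolding inj_on_def C'_def by fastforce
    qed
    show "(\<lambda>(d, c). (d + c) mod N) ` (D \<times> C') = {..<N}"
    proof (intro equalityI subsetI)
      fix n assume n: "n \<in> {..<N}"
      have "\<exists>m. t \<le> m \<and> m < t' \<and> m mod N = n"
      proof (intro exI conjI)
        let ?m = "t + (n + N * t - t) mod N"
        have N0: "N > 0" using tt by simp
        show "t \<le> ?m" by simp
        show "?m < t'" using tt N0 by simp
        have "t \<le> n + N * t" using N0 by (simp add: trans_le_add2)
        then have "(t + (n + N * t - t)) mod N = n" using n by simp
        then show "?m mod N = n" by (simp only: mod_add_right_eq)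
      qed
      then obtain m where m: "t \<le> m" "m < t'" "m mod N = n" by blast
      have "m \<in> {s..<s + (R + (K + 1) * (R + 1))}" using m t'le tt by simp
      then have "m \<in> (\<lambda>(d, c). d + c) ` (D \<times> C)" using C(3) by (rule subsetD[rotated])
      then obtain d c where dc: "d \<in> D" "c \<in> C" "m = d + c" by auto
      show "n \<in> (\<lambda>(d, c). (d + c) mod N) ` (D \<times> C')"
      proof (cases "t \<le> c")
        case True
        then have "c \<in> C'" using dc m by (simp add: C'_def)
        then show ?thesis using dc m by (intro image_eqI[of _ _ "(d, c)"]) auto
      next
        case False
        define k where "k = t - c"
        have k: "k \<in> {1..R}" using False dc m R[of d] by (auto simp: k_def)
        have "t - k = c" using False by (simp add: k_def)
        then have "t' - k \<in> C" using state[OF k] dc by simp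
        moreover have "t \<le> t' - k" "t' - k < t'" using k tt by auto
        ultimately have "t' - k \<in> C'" by (simp add: C'_def)
        moreover have "(d + (t' - k)) = m + N" using dc tt False by (simp add: k_def)
        then have "(d + (t' - k)) mod N = n" using m by simp
        ultimately show ?thesis using dc(1) by (intro image_eqI[of _ _ "(d, t' - k)"]) auto
      qed
    qed (use tt in auto)
  qed
  moreover have "finite C'" using C by (simp add: C'_def)
  ultimately have "tiling N D C'" using assms tt by (simp add: tiling_def)
  then show ?thesis by (rule that)
qed

text \<open>The lowest digit ranges over D, so the nonoverlapping sums in \<open>slice_sums\<close>
  split into D and a complement that covers long intervals.\<close>

lemma tile_periodic_tiling:
  assumes tile: "tile_digit_set b D"
  obtains N C where "tiling N D C"
proof -
  have b2: "b \<ge> 2" and cD: "card D = b" using tile by (auto simp: tile_digit_set_def)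
  have finD: "finite D" "D \<noteq> {}" using b2 cD by (auto intro: card_ge_0_finite)
  obtain X where X: "finite X" "X \<noteq> {}"
    "\<And>M. inj_on (\<lambda>(w, t). w + t) (digit_sums b D M \<times> X)" "\<And>M. card (digit_sums b D M) = b ^ M"
    "\<And>L. \<exists>M s. {s..<s + L} \<subseteq> slice_sums b D X M"
    using tile_structure[OF tile] by metis
  have "\<exists>C s. finite C \<and> inj_on (\<lambda>(d, c). d + c) (D \<times> C) \<and> {s..<s + L} \<subseteq> (\<lambda>(d, c). d + c) ` (D \<times> C)" for L
  proof -
    \<comment> \<open>The extra length beyond \<open>Max X\<close> excludes \<open>M = 0\<close>,
      where the sums form just X and no digit can be split off.\<close>
    obtain M s where Ms: "{s..<s + (L + (Max X + 2))} \<subseteq> slice_sums b D X M" using X(5) by blast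
    have "M \<noteq> 0"
    proof
      assume "M = 0"
      then have "slice_sums b D X M = X" by (force simp: slice_sums_def)
      then have "s + (L + Max X + 1) \<in> X" using Ms by auto
      then have "s + (L + Max X + 1) \<le> Max X" using X by simp
      then show False by simp
    qed
    then obtain M' where M': "M = Suc M'" using not0_implies_Suc by blast
    define C where "C = (\<lambda>(w, t). b * w + t) ` (digit_sums b D M' \<times> X)"
    have injD: "inj_on (\<lambda>(d, w). d + b * w) (D \<times> digit_sums b D M')"
      using X(4)[of "Suc M'"] X(4)[of M'] cD finD finite_digit_sums[OF finD(1)]
      by (intro eq_card_imp_inj_on) (auto simp: card_cartesian_product)
    have "inj_on (\<lambda>(d, c). d + c) (D \<times> C)"
    proof (rule inj_onI, clarify)
      fix d c d' c' assume *: "d \<in> D" "c \<in> C" "d' \<in> D" "c' \<in> C" "d + c = d' + c'"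
      obtain w t where c: "w \<in> digit_sums b D M'" "t \<in> X" "c = b * w + t" using * by (auto simp: C_def)
      obtain w' t' where c': "w' \<in> digit_sums b D M'" "t' \<in> X" "c' = b * w' + t'" using * by (auto simp: C_def)
      have "(d + b * w) + t = (d' + b * w') + t'" using * c c' by simp
      moreover have "d + b * w \<in> digit_sums b D M" "d' + b * w' \<in> digit_sums b D M" using * c c' M' by auto
      ultimately have "d + b * w = d' + b * w'" "t = t'"
        using inj_onD[OF X(3)[of M], of "(d + b * w, t)" "(d' + b * w', t')"] c c' by auto
      then have "d = d'" "w = w'" using inj_onD[OF injD, of "(d, w)" "(d', w')"] * c c' by auto
      then show "d = d' \<and> c = c'" using c c' \<open>t = t'\<close> by simp
    qed
    moreover have "finite C" using X finite_digit_sums[OF finD(1)] by (simp add: C_def)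
    moreover have "{s..<s + L} \<subseteq> (\<lambda>(d, c). d + c) ` (D \<times> C)"
    proof
      fix n assume "n \<in> {s..<s + L}"
      then have "n \<in> slice_sums b D X M" using Ms by auto
      then obtain w t where "w \<in> digit_sums b D M" "t \<in> X" "n = w + t" by (auto simp: slice_sums_def)
      then obtain d w' where "d \<in> D" "w' \<in> digit_sums b D M'" "t \<in> X" "n = d + (b * w' + t)"
        unfolding M' by auto
      then show "n \<in> (\<lambda>(d, c). d + c) ` (D \<times> C)" unfolding C_def by force
    qed
    ultimately show ?thesis by blast
  qed
  then show ?thesis using periodic_tiling[OF finD] that by metis
qed

section \<open>Digit sets with blocking zeros\<close>

lemma coeff_pcompose_monom_nonzero:
  fixes R :: "complex poly"
  assumes "coeff (pcompose R (monom 1 b)) n \<noteq> 0"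
  obtains w where "n = b * w" "coeff R w \<noteq> 0"
proof -
  have m: "pcompose (monom c i) (monom 1 b) = monom c (b * i)" for c :: complex and i
    by (induction i) (simp_all add: monom_Suc monom_0 pcompose_pCons mult_monom)
  have "R = (\<Sum>i\<le>degree R. monom (coeff R i) i)" by (simp add: poly_as_sum_of_monoms)
  then have "pcompose R (monom 1 b) = pcompose (\<Sum>i\<le>degree R. monom (coeff R i) i) (monom 1 b)"
    by simp
  also have "\<dots> = (\<Sum>i\<le>degree R. monom (coeff R i) (b * i))"
    by (simp add: pcompose_sum m)
  finally have "(\<Sum>i\<le>degree R. coeff (monom (coeff R i) (b * i)) n) \<noteq> 0"
    using assms by (simp add: coeff_sum)
  then obtain i where "coeff (monom (coeff R i) (b * i)) n \<noteq> 0"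
    by (rule sum.not_neutral_contains_not_neutral)
  then show ?thesis using that by (auto split: if_splits)
qed

text \<open>The product of P over the arguments z, \<open>z ^ b\<close>, and so on up to
  \<open>z ^ (b ^ (M - 1))\<close>. In contrast to the set of digit sums, it keeps multiplicities
  when sums coincide.\<close>

fun iterated_mask :: "nat \<Rightarrow> complex poly \<Rightarrow> nat \<Rightarrow> complex poly" where
  "iterated_mask b P 0 = 1"
| "iterated_mask b P (Suc M) = P * pcompose (iterated_mask b P M) (monom 1 b)"

lemma poly_iterated_mask: "poly (iterated_mask b P M) z = (\<Prod>i<M. poly P (z ^ (b ^ i)))"
proof (induction M arbitrary: z)
  case (Suc M)
  have "poly (iterated_mask b P (Suc M)) z = poly P z * (\<Prod>i<M. poly P (z ^ (b ^ Suc i)))"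
    by (simp add: poly_pcompose poly_monom Suc power_mult)
  also have "\<dots> = (\<Prod>i<Suc M. poly P (z ^ (b ^ i)))"
    by (subst prod.lessThan_Suc_shift) simp
  finally show ?case .
qed simp

lemma coeff_mult_nonzero:
  fixes P R :: "complex poly"
  assumes "coeff (P * R) n \<noteq> 0"
  obtains i j where "n = i + j" "coeff P i \<noteq> 0" "coeff R j \<noteq> 0"
proof -
  have "(\<Sum>i\<le>n. coeff P i * coeff R (n - i)) \<noteq> 0" using assms by (simp add: coeff_mult)
  then obtain i where "i \<in> {..n}" "coeff P i * coeff R (n - i) \<noteq> 0"
    by (rule sum.not_neutral_contains_not_neutral)
  then show ?thesis using that[of i "n - i"] by auto
qed

lemma support_iterated_mask:
  assumes "\<And>n. coeff P n \<noteq> 0 \<Longrightarrow> n \<in> D" "coeff (iterated_mask b P M) n \<noteq> 0"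
  shows "n \<in> digit_sums b D M"
  using assms(2)
proof (induction M arbitrary: n)
  case 0
  then show ?case by (cases n) (auto simp: coeff_1 split: if_splits)
next
  case (Suc M)
  obtain i j where ij: "n = i + j" "coeff P i \<noteq> 0" "coeff (pcompose (iterated_mask b P M) (monom 1 b)) j \<noteq> 0"
    using Suc.prems by (auto elim: coeff_mult_nonzero)
  obtain w where "j = b * w" "coeff (iterated_mask b P M) w \<noteq> 0"
    using ij(3) by (rule coeff_pcompose_monom_nonzero)
  then show ?case using ij assms(1) Suc.IH by auto
qed

text \<open>Vanishing at the nontrivial m-th roots of unity makes the sums of coefficients over all
  residue classes equal to \<open>poly Q 1 / of_nat m\<close>, which is not 0.\<close>

lemma coefficient_in_class:
  fixes Q :: "complex poly"
  assumes "m > 0" "\<And>k. 0 < k \<Longrightarrow> k < m \<Longrightarrow> poly Q (rt m k) = 0" "poly Q 1 \<noteq> 0"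
  obtains n where "[n = r] (mod m)" "coeff Q n \<noteq> 0"
proof -
  define F where "F t = (\<Sum>i\<in>{i \<in> {..degree Q}. i mod m = t mod m}. coeff Q i)" for t
  define c where "c = poly Q 1 / of_nat m"
  have ev: "(\<Sum>t<m. F t * rt m (k * t)) = poly Q (rt m k)" for k
  proof -
    have "poly Q (rt m k) = (\<Sum>i\<le>degree Q. coeff Q i * rt m (k * i))"
      by (simp add: poly_altdef rt_power mult.commute)
    also have "\<dots> = (\<Sum>t<m. \<Sum>i\<in>{i \<in> {..degree Q}. i mod m = t}. coeff Q i * rt m (k * i))"
      by (rule sum.group[symmetric]) (use assms(1) in auto)
    also have "\<dots> = (\<Sum>t<m. F t * rt m (k * t))"
    proof (rule sum.cong)
      fix t assume t: "t \<in> {..<m}"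
      have "rt m (k * i) = rt m (k * t)" if "i mod m = t" for i
        by (rule rt_cong[OF assms(1) cong_mult[OF cong_refl]]) (use that t in \<open>simp add: cong_def\<close>)
      then have "(\<Sum>i\<in>{i \<in> {..degree Q}. i mod m = t}. coeff Q i * rt m (k * i))
        = (\<Sum>i\<in>{i \<in> {..degree Q}. i mod m = t}. coeff Q i * rt m (k * t))"
        by (intro sum.cong) auto
      then show "(\<Sum>i\<in>{i \<in> {..degree Q}. i mod m = t}. coeff Q i * rt m (k * i)) = F t * rt m (k * t)"
        using t by (simp add: F_def sum_distrib_right)
    qed simp
    finally show ?thesis by simp
  qed
  have "F r - c = 0"
  proof (rule dft_inj[OF assms(1), where F = "\<lambda>t. F t - c"])
    show "F (t + m) - c = F t - c" for t by (simp add: F_def)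
    fix k assume k: "k < m"
    have "(\<Sum>t<m. (F t - c) * rt m (k * t)) = poly Q (rt m k) - c * (\<Sum>t<m. rt m (k * t))"
      unfolding ev[symmetric] by (simp add: left_diff_distrib sum_subtractf sum_distrib_left)
    also have "\<dots> = 0"
    proof (cases "k = 0")
      case True
      then show ?thesis using assms(1) by (simp add: c_def)
    next
      case False
      then have "\<not> m dvd k" using k by (auto dest: dvd_imp_le)
      then show ?thesis using False assms(2) k sum_rt[OF assms(1), of k] by simp
    qed
    finally show "(\<Sum>t<m. (F t - c) * rt m (k * t)) = 0" .
  qed
  then have "F r \<noteq> 0" using assms by (simp add: c_def)
  then obtain i where "i \<in> {i \<in> {..degree Q}. i mod m = r mod m}" "coeff Q i \<noteq> 0"
    unfolding F_def by (rule sum.not_neutral_contains_not_neutral)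
  then show ?thesis by (intro that[of i]) (auto simp: cong_def)
qed

text \<open>If b does not divide n, then m can be read off from the root \<open>rt (b ^ m) n\<close>
  as the least exponent with \<open>z ^ (b ^ m) = 1\<close>; as P has finitely many roots, m stays
  bounded.\<close>

lemma blocking_bounded:
  assumes b: "b \<ge> 2" and P: "poly P 1 \<noteq> 0" and bl: "blocking b (\<lambda>z. poly P z = 0)"
  obtains K where "\<And>n. \<not> b dvd n \<Longrightarrow> \<exists>m. 0 < m \<and> m \<le> K \<and> poly P (rt (b ^ m) n) = 0"
proof -
  define lev where "lev z = (LEAST m. z ^ (b ^ m) = 1)" for z :: complex
  define K where "K = Max (insert 0 (lev ` {z. poly P z = 0}))"
  have fin: "finite {z. poly P z = 0}" using P by (intro poly_roots_finite) auto
  have "\<exists>m. 0 < m \<and> m \<le> K \<and> poly P (rt (b ^ m) n) = 0" if n: "\<not> b dvd n" for n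
  proof -
    have "n > 0" using n by (intro Nat.gr0I) auto
    then obtain m where m: "m > 0" "poly P (rt (b ^ m) n) = 0" using bl unfolding blocking_def by blast
    have "lev (rt (b ^ m) n) = m"
      unfolding lev_def
    proof (rule Least_equality)
      show "rt (b ^ m) n ^ b ^ m = 1" using b by (simp add: rt_power rt_eq_1_iff)
      fix k assume k: "rt (b ^ m) n ^ b ^ k = 1"
      show "m \<le> k"
      proof (rule ccontr)
        assume "\<not> m \<le> k"
        have "b ^ m dvd b ^ k * n" using k b by (simp add: rt_power rt_eq_1_iff)
        moreover have "b ^ m = b ^ k * b ^ (m - k)" using \<open>\<not> m \<le> k\<close> by (simp flip: power_add)
        ultimately have "b ^ (m - k) dvd n" using b by simp
        moreover have "b dvd b ^ (m - k)" using \<open>\<not> m \<le> k\<close> by simp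
        ultimately show False using n dvd_trans by blast
      qed
    qed
    then have "m \<in> insert 0 (lev ` {z. poly P z = 0})" using m by force
    then have "m \<le> K" unfolding K_def using fin by (intro Max_ge) auto
    then show ?thesis using m by blast
  qed
  then show ?thesis using that by blast
qed

text \<open>At a nontrivial \<open>b ^ M\<close>-th root of unity the iterated mask vanishes, unless
  the root already satisfies \<open>z ^ (b ^ K) = 1\<close>; then the mask H of an interval of
  length \<open>b ^ K\<close> vanishes. So digit sums plus this interval meet every class.\<close>

lemma blocking_cover:
  assumes b: "b \<ge> 2" and P: "poly P 1 \<noteq> 0" and bl: "blocking b (\<lambda>z. poly P z = 0)"
    and supp: "\<And>n. coeff P n \<noteq> 0 \<Longrightarrow> n \<in> D"
  obtains K where "\<And>M r. \<exists>w\<in>digit_sums b D M. \<exists>t<b ^ K. [w + t = r] (mod (b ^ M))"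
proof -
  obtain K where K: "\<And>n. \<not> b dvd n \<Longrightarrow> \<exists>m. 0 < m \<and> m \<le> K \<and> poly P (rt (b ^ m) n) = 0"
    using blocking_bounded[OF b P bl] by blast
  define H where "H = (\<Sum>t<b ^ K. monom (1::complex) t)"
  have H: "poly H z = (\<Sum>t<b ^ K. z ^ t)" for z by (simp add: H_def poly_sum poly_monom)
  have "\<exists>w\<in>digit_sums b D M. \<exists>t<b ^ K. [w + t = r] (mod (b ^ M))" for M r
  proof -
    define Q where "Q = iterated_mask b P M * H"
    have "poly Q 1 \<noteq> 0" using P b by (simp add: Q_def poly_iterated_mask H)
    moreover have "poly Q (rt (b ^ M) k) = 0" if k: "0 < k" "k < b ^ M" for k
    proof -
      define t where "t = multiplicity b k"
      have nz: "k \<noteq> 0" "\<not> is_unit b" using k b by auto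
      obtain n where n: "k = b ^ t * n" "\<not> b dvd n"
        using multiplicity_decompose'[OF nz] unfolding t_def by blast
      have tM: "t < M"
      proof (rule ccontr)
        assume "\<not> t < M"
        then have "b ^ M \<le> b ^ t" using b by (intro power_increasing) auto
        moreover have "n > 0" using n(2) by (intro Nat.gr0I) auto
        then have "b ^ t \<le> k" using n(1) by simp
        ultimately show False using k by linarith
      qed
      have red: "rt (b ^ M) k ^ (b ^ i) = rt (b ^ (M - t - i)) n" if "i \<le> M - t" for i
      proof -
        have "M = (t + i) + (M - t - i)" using that tM by simp
        then have "b ^ M = b ^ (t + i) * b ^ (M - t - i)" by (simp flip: power_add)
        moreover have "b ^ i * k = b ^ (t + i) * n" using n(1) by (simp add: power_add)
        ultimately show ?thesis using b by (simp add: rt_power rt_cancel)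
      qed
      obtain m where m: "0 < m" "m \<le> K" "poly P (rt (b ^ m) n) = 0" using K n(2) by blast
      show ?thesis
      proof (cases "m \<le> M - t")
        case True
        define i where "i = M - t - m"
        have "M - t - i = m" "i \<le> M - t" "i < M" using True m tM by (auto simp: i_def)
        then have "poly P (rt (b ^ M) k ^ (b ^ i)) = 0" using red[of i] m by simp
        then have "poly (iterated_mask b P M) (rt (b ^ M) k) = 0"
          unfolding poly_iterated_mask using \<open>i < M\<close> by (subst prod_zero_iff) auto
        then show ?thesis by (simp add: Q_def)
      next
        case False
        let ?z = "rt (b ^ M) k"
        have "?z = rt (b ^ (M - t)) n" using red[of 0] by simp
        then have "?z ^ (b ^ K) = 1"
        proof -
          have "b ^ (M - t) dvd b ^ K" using False m by (intro le_imp_power_dvd) simp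
          then show ?thesis using \<open>?z = _\<close> b by (simp add: rt_power rt_eq_1_iff)
        qed
        moreover have "?z \<noteq> 1" using k b by (auto simp: rt_eq_1_iff dest: dvd_imp_le)
        ultimately have "poly H ?z = 0" unfolding H by (simp add: sum_gp_strict)
        then show ?thesis by (simp add: Q_def)
      qed
    qed
    ultimately obtain n where n: "[n = r] (mod (b ^ M))" "coeff Q n \<noteq> 0"
      using coefficient_in_class[of "b ^ M" Q] b by auto
    obtain w t where "n = w + t" "coeff (iterated_mask b P M) w \<noteq> 0" "coeff H t \<noteq> 0"
      using n(2) unfolding Q_def by (rule coeff_mult_nonzero)
    moreover from this have "t < b ^ K" by (auto simp: H_def coeff_sum split: if_splits)
    ultimately show ?thesis using n support_iterated_mask[OF supp] by blast
  qed
  then show ?thesis using that by blast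
qed

text \<open>With fewer than b digits at most \<open>(b - 1) ^ M * b ^ K\<close> residues modulo
  \<open>b ^ M\<close> are covered, too few for large M. This later shows that sums are
  direct.\<close>

lemma blocking_card:
  assumes b: "b \<ge> 2" and P: "poly P 1 \<noteq> 0" and bl: "blocking b (\<lambda>z. poly P z = 0)"
    and supp: "\<And>n. coeff P n \<noteq> 0 \<Longrightarrow> n \<in> D" and fin: "finite D"
  shows "b \<le> card D"
proof (rule ccontr)
  assume "\<not> b \<le> card D"
  then have cD: "card D \<le> b - 1" by simp
  obtain K where K: "\<And>M r. \<exists>w\<in>digit_sums b D M. \<exists>t<b ^ K. [w + t = r] (mod (b ^ M))"
    using blocking_cover[OF b P bl supp] by blast
  have le: "b ^ M \<le> (b - 1) ^ M * b ^ K" for M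
  proof -
    have "{..<b ^ M} \<subseteq> (\<lambda>(w, t). (w + t) mod b ^ M) ` (digit_sums b D M \<times> {..<b ^ K})"
    proof
      fix r assume r: "r \<in> {..<b ^ M}"
      obtain w t where wt: "w \<in> digit_sums b D M" "t < b ^ K" "[w + t = r] (mod (b ^ M))" using K by blast
      then have "(w + t) mod b ^ M = r" using r by (simp add: cong_def)
      then show "r \<in> (\<lambda>(w, t). (w + t) mod b ^ M) ` (digit_sums b D M \<times> {..<b ^ K})"
        using wt by (intro image_eqI[of _ _ "(w, t)"]) auto
    qed
    then have "card {..<b ^ M} \<le> card (digit_sums b D M \<times> {..<b ^ K})"
      using finite_digit_sums[OF fin] by (intro surj_card_le) auto
    also have "\<dots> = card (digit_sums b D M) * b ^ K" by (simp add: card_cartesian_product)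
    also have "\<dots> \<le> (b - 1) ^ M * b ^ K"
      using card_digit_sums_le[OF fin, of b M] power_mono[OF cD, of M] by (intro mult_le_mono1) linarith
    finally show ?thesis by simp
  qed
  have "real b / real (b - 1) > 1" using b by simp
  then obtain M where M: "real b ^ K < (real b / real (b - 1)) ^ M" using real_arch_pow by blast
  have "real b ^ M \<le> real (b - 1) ^ M * real b ^ K"
    using le[of M] by (metis of_nat_le_iff of_nat_mult of_nat_power)
  then have "(real b / real (b - 1)) ^ M \<le> real b ^ K" using b by (simp add: power_divide field_simps)
  then show False using M by simp
qed

lemma interior_finite_Union_closed:
  assumes "finite I" "\<And>i. i \<in> I \<Longrightarrow> closed (A i)" "\<And>i. i \<in> I \<Longrightarrow> interior (A i) = {}"
  shows "interior (\<Union>i\<in>I. A i) = {}"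
  using assms
proof (induction I rule: finite_induct)
  case (insert i I)
  then have "interior (A i \<union> (\<Union>i\<in>I. A i)) = interior (A i)"
    by (intro interior_closed_Un_empty_interior) auto
  then show ?case using insert by simp
qed simp

lemma closure_finite_UN: "finite I \<Longrightarrow> closure (\<Union>i\<in>I. A i) = (\<Union>i\<in>I. closure (A i))"
  by (induction I rule: finite_induct) (simp_all add: closure_Un)

section \<open>From blocking zeros to interior points\<close>

context digits
begin

lemma closure_step: assumes "x \<in> closure T" shows "\<exists>d\<in>D. real b * x - real d \<in> closure T"
proof -
  define S where "S d = {y \<in> T. real b * y - real d \<in> T}" for d
  have "T = (\<Union>d\<in>D. S d)"
  proof (intro equalityI subsetI)
    fix y assume "y \<in> T"
    then obtain d where "d \<in> D" "real b * y - real d \<in> T" using T_step[of y] by blast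
    then show "y \<in> (\<Union>d\<in>D. S d)" using \<open>y \<in> T\<close> by (auto simp: S_def)
  qed (auto simp: S_def)
  then have "closure T = (\<Union>d\<in>D. closure (S d))" using closure_finite_UN[of D S] D by metis
  then obtain d where d: "d \<in> D" "x \<in> closure (S d)" using assms by blast
  have "(\<lambda>y. real b * y - real d) ` closure (S d) \<subseteq> closure T"
    by (rule image_closure_subset) (auto simp: S_def intro!: continuous_intros closure_subset[THEN subsetD])
  then show ?thesis using d by blast
qed

text \<open>The closure satisfies the same self-similarity, so digits can be read off one after
  another from any of its points, and their series converges to that point.\<close>

lemma closed_T: "closed T"
proof -
  have "closure T \<subseteq> T"
  proof
    fix x assume x: "x \<in> closure T"
    obtain g where g: "\<And>y. y \<in> closure T \<Longrightarrow> g y \<in> D \<and> real b * y - real (g y) \<in> closure T"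
      using closure_step by metis
    define y where "y k = ((\<lambda>y. real b * y - real (g y)) ^^ k) x" for k
    have y: "y k \<in> closure T" for k by (induction k) (use x g in \<open>auto simp: y_def\<close>)
    define d where "d k = g (y k)" for k
    have d: "\<forall>k. d k \<in> D" using g y by (simp add: d_def)
    have ps: "(\<Sum>k<n. real (d k) / real b ^ Suc k) = x - y n / real b ^ n" for n
    proof (induction n)
      case (Suc n)
      have "y (Suc n) = real b * y n - real (d n)" by (simp add: y_def d_def)
      then have "y n / real b ^ n = real (d n) / real b ^ Suc n + y (Suc n) / real b ^ Suc n"
        using b by (simp add: field_simps)
      then show ?case using Suc by simp
    qed (simp add: y_def)
    have bd: "\<bar>y n\<bar> \<le> real (Max D)" for n
    proof -
      have "closure T \<subseteq> {0..real (Max D)}" using T_bounds by (intro closure_minimal) auto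
      then show ?thesis using y[of n] by auto
    qed
    have "(\<lambda>n. y n / real b ^ n) \<longlonglongrightarrow> 0"
    proof (rule Lim_null_comparison)
      show "\<forall>\<^sub>F n in sequentially. norm (y n / real b ^ n) \<le> real (Max D) * (1 / real b) ^ n"
        using bd b by (intro always_eventually) (auto simp: power_one_over divide_right_mono)
      have "(\<lambda>n. real (Max D) * (1 / real b) ^ n) \<longlonglongrightarrow> real (Max D) * 0"
        by (intro tendsto_mult tendsto_const LIMSEQ_realpow_zero) (use b in auto)
      then show "(\<lambda>n. real (Max D) * (1 / real b) ^ n) \<longlonglongrightarrow> 0" by simp
    qed
    then have "(\<lambda>n. x - y n / real b ^ n) \<longlonglongrightarrow> x - 0" by (intro tendsto_diff tendsto_const)
    then have "(\<lambda>k. real (d k) / real b ^ Suc k) sums x" unfolding sums_def ps by simp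
    then have "x = val d" unfolding val_def by (rule sums_unique)
    then show "x \<in> T" unfolding T_altdef using d by blast
  qed
  then show ?thesis using closure_subset_eq by blast
qed

lemma T_nonempty: "T \<noteq> {}"
proof -
  obtain d where "d \<in> D" using D by blast
  then have "val (\<lambda>_. d) \<in> T" unfolding T_altdef by (intro exI[of _ "\<lambda>_. d"]) simp
  then show ?thesis by blast
qed

lemma digit_sums_bound: assumes "w \<in> digit_sums b D M" shows "w \<le> Max D * b ^ M"
proof -
  \<comment> \<open>The additional \<open>Max D\<close> lets the induction close, because
    \<open>2 * Max D \<le> b * Max D\<close>.\<close>
  have "w + Max D \<le> Max D * b ^ M" using assms
  proof (induction M arbitrary: w)
    case (Suc M)
    then obtain d v where w: "w = d + b * v" "d \<in> D" "v \<in> digit_sums b D M" by auto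
    have "d \<le> Max D" using w D by simp
    moreover have "2 * Max D \<le> b * Max D" using b by simp
    ultimately have "w + Max D \<le> b * (v + Max D)" unfolding w(1) distrib_left by linarith
    also have "\<dots> \<le> b * (Max D * b ^ M)" using Suc.IH[OF w(3)] by (intro mult_le_mono2)
    finally show ?case by (simp add: mult_ac)
  qed simp
  then show ?thesis by simp
qed

text \<open>By \<open>blocking_cover\<close>, finitely many integer translates of T come arbitrarily
  near to each point between 0 and 1. Their union is closed, so it contains these points, but a
  finite union of closed sets with empty interior has empty interior.\<close>

lemma interior_T:
  assumes P: "poly P 1 \<noteq> 0" and bl: "blocking b (\<lambda>z. poly P z = 0)"
    and supp: "\<And>n. coeff P n \<noteq> 0 \<Longrightarrow> n \<in> D"
  shows "interior T \<noteq> {}"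
proof
  assume int: "interior T = {}"
  obtain K where K: "\<And>M r. \<exists>w\<in>digit_sums b D M. \<exists>t<b ^ K. [w + t = r] (mod (b ^ M))"
    using blocking_cover[OF b P bl supp] by blast
  define Z where "Z = Max D + b ^ K"
  define U where "U = (\<Union>z\<in>{..Z}. (+) (- real z) ` T)"
  have cl: "closed U" unfolding U_def by (intro closed_UN ballI closed_translation closed_T) simp
  obtain \<tau> where \<tau>: "\<tau> \<in> T" using T_nonempty by blast
  have near: "\<exists>u\<in>U. \<bar>y - u\<bar> \<le> (real (b ^ K) + 1 + real (Max D)) * (1 / real b) ^ M"
    if y: "0 \<le> y" "y < 1" for y M
  proof -
    have bM: "real b ^ M > 0" using b by simp
    define r where "r = nat \<lfloor>y * real b ^ M\<rfloor>"
    have r: "real r \<le> y * real b ^ M" "y * real b ^ M < real r + 1"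
      using y bM by (auto simp: r_def)
    have "y * real b ^ M < real b ^ M" using y bM by simp
    then have rb: "r < b ^ M" using r by (metis of_nat_less_iff of_nat_power order_le_less_trans)
    obtain w t where wt: "w \<in> digit_sums b D M" "t < b ^ K" "[w + t = r] (mod (b ^ M))" using K by blast
    define z where "z = (w + t) div b ^ M"
    have eq: "w + t = r + b ^ M * z"
    proof -
      have "(w + t) mod b ^ M = r" using wt(3) rb by (simp add: cong_def)
      then show ?thesis using mult_div_mod_eq[of "b ^ M" "w + t"] unfolding z_def by linarith
    qed
    have "z \<le> Z"
    proof -
      have "b ^ M * z \<le> Max D * b ^ M + b ^ K" using eq digit_sums_bound[OF wt(1)] wt(2) by linarith
      also have "\<dots> \<le> b ^ M * Z" using b by (simp add: Z_def distrib_left mult.commute)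
      finally show ?thesis using b by simp
    qed
    define u where "u = - real z + (real w + \<tau>) / real b ^ M"
    have "(real w + \<tau>) / real b ^ M \<in> T"
      by (rule iffD2[OF T_iter[where M = M]], rule bexI[of _ w]) (use wt(1) \<tau> bM in simp_all)
    then have "u \<in> U" using \<open>z \<le> Z\<close> by (auto simp: U_def u_def)
    moreover have "\<bar>y - u\<bar> \<le> (real (b ^ K) + 1 + real (Max D)) * (1 / real b) ^ M"
    proof -
      have "real w + real t = real r + real b ^ M * real z" using eq by (metis of_nat_add of_nat_mult of_nat_power)
      moreover have "(y - u) * real b ^ M = y * real b ^ M + real b ^ M * real z - (real w + \<tau>)"
      proof -
        have "(real w + \<tau>) / real b ^ M * real b ^ M = real w + \<tau>" using bM by simp
        then have "u * real b ^ M = - real z * real b ^ M + (real w + \<tau>)"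
          by (simp only: u_def distrib_right)
        then show ?thesis by (simp add: left_diff_distrib mult.commute)
      qed
      ultimately have "(y - u) * real b ^ M = y * real b ^ M - real r + real t - \<tau>" by linarith
      moreover have "\<bar>y * real b ^ M - real r + real t - \<tau>\<bar> \<le> real (b ^ K) + 1 + real (Max D)"
        using r T_bounds[OF \<tau>] wt(2) by linarith
      ultimately have "\<bar>y - u\<bar> * real b ^ M \<le> real (b ^ K) + 1 + real (Max D)"
        using bM by (metis abs_mult abs_of_pos)
      then show ?thesis using bM by (simp add: power_one_over field_simps)
    qed
    ultimately show ?thesis by blast
  qed
  have "y \<in> U" if y: "0 \<le> y" "y < 1" for y
  proof -
    obtain u where u: "\<And>M. u M \<in> U" "\<And>M. \<bar>y - u M\<bar> \<le> (real (b ^ K) + 1 + real (Max D)) * (1 / real b) ^ M"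
      using near[OF y] by metis
    have "(\<lambda>M. (real (b ^ K) + 1 + real (Max D)) * (1 / real b) ^ M) \<longlonglongrightarrow> (real (b ^ K) + 1 + real (Max D)) * 0"
      by (intro tendsto_mult tendsto_const LIMSEQ_realpow_zero) (use b in auto)
    then have g0: "(\<lambda>M. (real (b ^ K) + 1 + real (Max D)) * (1 / real b) ^ M) \<longlonglongrightarrow> 0" by (simp only: mult_zero_right)
    have "(\<lambda>M. y - u M) \<longlonglongrightarrow> 0"
      by (rule Lim_null_comparison[OF _ g0], intro always_eventually allI)
        (simp only: real_norm_def u(2))
    then have "(\<lambda>M. y - (y - u M)) \<longlonglongrightarrow> y - 0" by (intro tendsto_diff tendsto_const)
    then have "u \<longlonglongrightarrow> y" by simp
    then show ?thesis using cl u(1) closed_sequentially by blast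
  qed
  then have "{0<..<1} \<subseteq> U" by auto
  then have "interior {0<..<1::real} \<subseteq> interior U" by (rule interior_mono)
  moreover have "interior U = {}"
    unfolding U_def
    by (intro interior_finite_Union_closed closed_translation closed_T) (simp_all only: interior_translation int image_empty finite_atMost)
  moreover have "interior {0<..<1::real} = {0<..<1}" by (simp add: interior_open)
  ultimately have "{0<..<1::real} = {}" by simp
  then show False by simp
qed

end

lemma rt_reduced:
  assumes "M > 0"
  obtains s k where "s > 0" "s dvd M" "coprime k s" "rt M n = rt s k" "M dvd n \<Longrightarrow> s = 1" "\<not> M dvd n \<Longrightarrow> s > 1"
proof -
  define g where "g = gcd M n"
  have g: "g > 0" using assms by (simp add: g_def)
  define s k where "s = M div g" and "k = n div g"
  have M: "M = g * s" and n: "n = g * k" by (simp_all add: s_def k_def g_def)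
  have s: "s > 0" using M assms by (cases "s = 0") auto
  have "coprime k s" unfolding s_def k_def g_def using assms div_gcd_coprime[of n M]
    by (simp add: gcd.commute)
  moreover have "rt M n = rt s k" unfolding M n by (rule rt_cancel[OF g])
  moreover have "s dvd M" using M by simp
  moreover have "s = 1 \<longleftrightarrow> M dvd n"
  proof
    assume "s = 1" then show "M dvd n" using M n by simp
  next
    assume "M dvd n"
    then have "g = M" unfolding g_def by (simp add: gcd_nat.absorb1)
    then show "s = 1" using M assms by simp
  qed
  ultimately show ?thesis using that s by (metis One_nat_def Suc_lessI)
qed

section \<open>Zeros of modulo product-forms\<close>

lemma finite_components:
  assumes "bij_betw f (\<Pi>\<^sub>E i\<in>I. Es i) E" "finite E" "E \<noteq> {}" "i \<in> I"
  shows "finite (Es i)" "Es i \<noteq> {}"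
proof -
  have fin: "finite (\<Pi>\<^sub>E i\<in>I. Es i)" using assms bij_betw_finite by blast
  have "(\<Pi>\<^sub>E i\<in>I. Es i) \<noteq> {}" using assms by (auto simp: bij_betw_def)
  then obtain e where e: "e \<in> (\<Pi>\<^sub>E i\<in>I. Es i)" by blast
  then show "Es i \<noteq> {}" using assms(4) by (auto simp: PiE_def Pi_def)
  have "inj_on (\<lambda>x. e(i := x)) (Es i)" by (auto simp: inj_on_def fun_eq_iff split: if_splits)
  moreover have "(\<lambda>x. e(i := x)) ` Es i \<subseteq> (\<Pi>\<^sub>E i\<in>I. Es i)"
    using e assms(4) by (auto simp: PiE_def Pi_def extensional_def)
  ultimately show "finite (Es i)" using fin by (metis inj_on_finite)
qed

lemma ev_direct_decomposition:
  assumes d: "direct_decomposition E r Es" and E: "finite E" "E \<noteq> {}"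
  shows "ev E z = (\<Prod>i\<le>r. ev (Es i) z)" "card E = (\<Prod>i\<le>r. card (Es i))"
    "\<And>i. i \<le> r \<Longrightarrow> finite (Es i) \<and> Es i \<noteq> {}"
proof -
  have b: "bij_betw (\<lambda>e. \<Sum>i\<le>r. e i) (\<Pi>\<^sub>E i\<in>{..r}. Es i) E"
    using d by (simp add: direct_decomposition_def)
  show fin: "finite (Es i) \<and> Es i \<noteq> {}" if "i \<le> r" for i
    using finite_components[OF b E] that by simp
  have "ev E z = (\<Sum>e\<in>(\<Pi>\<^sub>E i\<in>{..r}. Es i). z ^ (\<Sum>i\<le>r. e i))"
    unfolding ev_def by (rule sum.reindex_bij_betw[OF b, symmetric])
  also have "\<dots> = (\<Sum>e\<in>(\<Pi>\<^sub>E i\<in>{..r}. Es i). \<Prod>i\<le>r. z ^ e i)" by (simp add: power_sum)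
  also have "\<dots> = (\<Prod>i\<le>r. ev (Es i) z)"
    unfolding ev_def by (rule prod_sum_PiE[symmetric]) (use fin in auto)
  finally show "ev E z = (\<Prod>i\<le>r. ev (Es i) z)" .
  have "card E = card (\<Pi>\<^sub>E i\<in>{..r}. Es i)" using bij_betw_same_card[OF b] by simp
  then show "card E = (\<Prod>i\<le>r. card (Es i))" by (simp add: card_PiE)
qed

lemma zr_direct_decomposition:
  assumes "direct_decomposition E r Es" "finite E" "E \<noteq> {}" "zr E s"
  obtains i where "i \<le> r" "zr (Es i) s"
  using assms(4) that ev_direct_decomposition(1)[OF assms(1-3), of "rt s 1"] by (auto simp: zr_def)

lemma poly_kernel: "poly (kernel_poly b l S i) z = (\<Prod>j\<le>i. \<Prod>s\<in>S j. poly (cyclotomic s) (z ^ (b ^ l j)))"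
  by (simp add: kernel_poly_def poly_prod poly_pcompose poly_monom)

lemma prod_zero_ex: "prod f A = (0 :: complex) \<Longrightarrow> \<exists>a\<in>A. f a = 0"
  by (induction A rule: infinite_finite_induct) auto

lemma kernel_rootE:
  assumes "poly (kernel_poly b l S i) z = 0"
  obtains j s where "j \<le> i" "s \<in> S j" "poly (cyclotomic s) (z ^ (b ^ l j)) = 0"
proof -
  obtain j where j: "j \<in> {..i}" "(\<Prod>s\<in>S j. poly (cyclotomic s) (z ^ (b ^ l j))) = 0"
    using prod_zero_ex[OF assms[unfolded poly_kernel]] by blast
  then show ?thesis using prod_zero_ex[OF j(2)] that by blast
qed

lemma kernel_rootI:
  assumes "j \<le> i" "s \<in> S j" "finite (S j)" "poly (cyclotomic s) (z ^ (b ^ l j)) = 0"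
  shows "poly (kernel_poly b l S i) z = 0"
proof -
  have "(\<Prod>s\<in>S j. poly (cyclotomic s) (z ^ (b ^ l j))) = 0" using assms by (intro prod_zero) auto
  then show ?thesis unfolding poly_kernel using assms(1) by (intro prod_zero) auto
qed

text \<open>One root of order s yields the whole cyclotomic factor: the order t of its power divides
  s, so an exponent prime to s keeps primitive t-th roots primitive.\<close>

lemma kernel_cyclotomic_dvd:
  assumes root: "poly (kernel_poly b l S i) (rt s k) = 0" and s: "s > 0" "coprime k s"
    and S: "\<And>j t. j \<le> i \<Longrightarrow> t \<in> S j \<Longrightarrow> t > 0" "\<And>j. j \<le> i \<Longrightarrow> finite (S j)"
  shows "cyclotomic s dvd kernel_poly b l S i"
  unfolding cyclotomic_dvd_iff_roots[OF s(1)]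
proof (intro allI impI)
  fix k2 assume k2: "coprime k2 s"
  obtain j t where jt: "j \<le> i" "t \<in> S j" "poly (cyclotomic t) (rt s k ^ (b ^ l j)) = 0"
    using root by (rule kernel_rootE)
  have t: "t > 0" using S jt by blast
  obtain k' where k': "coprime k' t" "rt s k ^ (b ^ l j) = rt t k'"
    using jt(3) poly_cyclotomic_eq_0_iff[OF t] by blast
  have "rt t k' ^ s = 1"
    unfolding k'(2)[symmetric] using s by (simp add: rt_power rt_eq_1_iff)
  then have "t dvd s * k'" using t by (simp add: rt_power rt_eq_1_iff)
  then have ts: "t dvd s" using k'(1) by (simp add: coprime_dvd_mult_left_iff coprime_commute)
  obtain x where x: "[k * x = 1] (mod s)" using cong_solve_coprime_nat[OF s(2)] by auto
  have kx: "[k * (x * k2) = k2] (mod s)"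
    using cong_mult[OF x cong_refl[of k2]] by (simp add: mult.assoc)
  then have "coprime (k * (x * k2)) s" using k2 by (metis cong_imp_coprime cong_sym)
  then have cop: "coprime (x * k2) t" using ts by (metis coprime_mult_left_iff coprime_divisors dvd_refl)
  have "rt s k2 = rt s k ^ (x * k2)"
    using rt_cong[OF s(1) kx] by (simp add: rt_power mult.commute)
  then have "rt s k2 ^ (b ^ l j) = (rt s k ^ (b ^ l j)) ^ (x * k2)"
    by (simp flip: power_mult add: mult.commute)
  then have "rt s k2 ^ (b ^ l j) = rt t (x * k2 * k')" unfolding k'(2) by (simp only: rt_power)
  moreover have "coprime (x * k2 * k') t" using cop k'(1) by simp
  ultimately have "poly (cyclotomic t) (rt s k2 ^ (b ^ l j)) = 0"
    unfolding poly_cyclotomic_eq_0_iff[OF t] by blast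
  then show "poly (kernel_poly b l S i) (rt s k2) = 0"
    using jt S by (intro kernel_rootI[of j i t]) auto
qed

lemma set_cong_ev:
  assumes "set_cong n X Y" "s dvd n" "s > 0" shows "ev X (rt s k) = ev Y (rt s k)"
proof -
  obtain f where f: "bij_betw f X Y" "\<And>x. x \<in> X \<Longrightarrow> [x = f x] (mod n)"
    using assms(1) by (auto simp: set_cong_def)
  have "ev Y (rt s k) = (\<Sum>x\<in>X. rt s (k * f x))"
    unfolding ev_rt by (rule sum.reindex_bij_betw[OF f(1), symmetric])
  also have "\<dots> = (\<Sum>x\<in>X. rt s (k * x))"
  proof (rule sum.cong)
    fix x assume "x \<in> X"
    then have "[x = f x] (mod s)" using f(2) assms(2) cong_dvd_modulus_nat by blast
    then show "rt s (k * f x) = rt s (k * x)"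
      using assms(3) by (intro rt_cong cong_mult[OF cong_refl]) (auto simp: cong_sym)
  qed simp
  finally show ?thesis by (simp add: ev_rt)
qed

lemma ev_sumset: "direct X Y \<Longrightarrow> ev (sumset X Y) z = ev X z * ev Y z"
  unfolding ev_def sumset_def direct_def
  by (subst sum.reindex) (auto simp: sum_product sum.cartesian_product power_add case_prod_unfold)

lemma ev_mult_image: "c > 0 \<Longrightarrow> ev ((*) c ` E) z = ev E (z ^ c)"
  unfolding ev_def by (subst sum.reindex) (auto simp: inj_on_def power_mult)

text \<open>Each congruence is modulo a multiple of the orders concerned and does not change values
  at roots of those orders. Zeros of the earlier kernel come from the previous set, the others from
  the component just added.\<close>

lemma modulo_product_zeros:
  assumes mp: "modulo_product b r Es l S D" and b: "b > 0" and l0: "l 0 = 0"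
    and fin: "\<And>i. i \<le> r \<Longrightarrow> finite (Es i)"
    and S: "\<And>j t. j \<le> r \<Longrightarrow> t \<in> S j \<Longrightarrow> t > 0 \<and> zr (Es j) t" "\<And>j. j \<le> r \<Longrightarrow> finite (S j)"
  shows "card D = (\<Prod>i\<le>r. card (Es i))"
    "\<And>s. s > 0 \<Longrightarrow> cyclotomic s dvd kernel_poly b l S r \<Longrightarrow> zr D s"
proof -
  obtain Ds where Ds: "set_cong (cyclotomic_lcm (kernel_poly b l S 0)) (Ds 0) (Es 0)"
    "\<And>i. i \<in> {1..r} \<Longrightarrow> direct (Ds (i - 1)) ((*) (b ^ l i) ` Es i)"
    "\<And>i. i \<in> {1..r} \<Longrightarrow> set_cong (cyclotomic_lcm (kernel_poly b l S i)) (Ds i)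
         (sumset (Ds (i - 1)) ((*) (b ^ l i) ` Es i))" "D = Ds r"
    using mp unfolding modulo_product_def by blast
  have lcm: "s dvd cyclotomic_lcm (kernel_poly b l S i)" if "s > 0" "cyclotomic s dvd kernel_poly b l S i" for s i
    unfolding cyclotomic_lcm_def using that by (intro dvd_Lcm) simp
  have "card (Ds i) = (\<Prod>i\<le>i. card (Es i)) \<and>
     (\<forall>s>0. cyclotomic s dvd kernel_poly b l S i \<longrightarrow> zr (Ds i) s)" if "i \<le> r" for i
    using that
  proof (induction i)
    case 0
    have "card (Ds 0) = card (Es 0)" using Ds(1) bij_betw_same_card by (auto simp: set_cong_def)
    moreover have "zr (Ds 0) s" if s: "s > 0" "cyclotomic s dvd kernel_poly b l S 0" for s
    proof -
      have "poly (kernel_poly b l S 0) (rt s 1) = 0" using s cyclotomic_dvd_iff_roots by simp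
      then obtain j t where jt: "j \<le> 0" "t \<in> S j" "poly (cyclotomic t) (rt s 1 ^ (b ^ l j)) = 0"
        by (rule kernel_rootE)
      have t: "t > 0" "zr (Es 0) t" using S(1)[of 0 t] jt by auto
      obtain k where "coprime k t" "rt s 1 = rt t k"
        using jt l0 poly_cyclotomic_eq_0_iff[OF t(1)] by auto
      then have "ev (Es 0) (rt s 1) = 0" using t zr_iff by simp
      then show ?thesis using set_cong_ev[OF Ds(1) lcm[OF s] s(1)] by (simp add: zr_def)
    qed
    ultimately show ?case by simp
  next
    case (Suc i)
    have i: "Suc i \<in> {1..r}" using Suc.prems by simp
    have dir: "direct (Ds i) ((*) (b ^ l (Suc i)) ` Es (Suc i))" using Ds(2)[OF i] by simp
    have sc: "set_cong (cyclotomic_lcm (kernel_poly b l S (Suc i))) (Ds (Suc i))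
         (sumset (Ds i) ((*) (b ^ l (Suc i)) ` Es (Suc i)))" using Ds(3)[OF i] by simp
    have "card (Ds (Suc i)) = card (sumset (Ds i) ((*) (b ^ l (Suc i)) ` Es (Suc i)))"
      using sc bij_betw_same_card by (auto simp: set_cong_def)
    also have "\<dots> = card (Ds i) * card ((*) (b ^ l (Suc i)) ` Es (Suc i))"
      using dir unfolding direct_def sumset_def by (simp add: card_image card_cartesian_product)
    also have "card ((*) (b ^ l (Suc i)) ` Es (Suc i)) = card (Es (Suc i))"
      using b by (intro card_image) (simp add: inj_on_def)
    finally have "card (Ds (Suc i)) = (\<Prod>i\<le>Suc i. card (Es i))" using Suc by simp
    moreover have "zr (Ds (Suc i)) s" if s: "s > 0" "cyclotomic s dvd kernel_poly b l S (Suc i)" for s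
    proof -
      have "poly (kernel_poly b l S (Suc i)) (rt s 1) = 0" using s cyclotomic_dvd_iff_roots by simp
      then obtain j t where jt: "j \<le> Suc i" "t \<in> S j" "poly (cyclotomic t) (rt s 1 ^ (b ^ l j)) = 0"
        by (rule kernel_rootE)
      have t: "t > 0" "zr (Es j) t" using S(1)[of j t] jt Suc.prems by auto
      have "ev (Ds i) (rt s 1) * ev (Es (Suc i)) (rt s 1 ^ (b ^ l (Suc i))) = 0"
      proof (cases "j = Suc i")
        case True
        obtain k where "coprime k t" "rt s 1 ^ (b ^ l j) = rt t k"
          using jt poly_cyclotomic_eq_0_iff[OF t(1)] by auto
        then have "ev (Es j) (rt s 1 ^ (b ^ l j)) = 0" using t zr_iff by simp
        then show ?thesis using True by simp
      next
        case False
        then have j: "j \<le> i" using jt by simp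
        then have "poly (kernel_poly b l S i) (rt s 1) = 0"
          using jt S(2)[of j] Suc.prems by (intro kernel_rootI[of j i t]) auto
        then have "cyclotomic s dvd kernel_poly b l S i"
        proof (rule kernel_cyclotomic_dvd)
          show "t > 0" if "j \<le> i" "t \<in> S j" for j t using S(1)[of j t] that Suc.prems by simp
        qed (use s S(2) Suc.prems in auto)
        then have "zr (Ds i) s" using Suc s by simp
        then show ?thesis by (simp add: zr_def)
      qed
      then have "ev (sumset (Ds i) ((*) (b ^ l (Suc i)) ` Es (Suc i))) (rt s 1) = 0"
        using ev_sumset[OF dir] ev_mult_image[of "b ^ l (Suc i)"] b by simp
      then show ?thesis using set_cong_ev[OF sc lcm[OF s] s(1)] by (simp add: zr_def)
    qed
    ultimately show ?case by blast
  qed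
  then show "card D = (\<Prod>i\<le>r. card (Es i))"
    "\<And>s. s > 0 \<Longrightarrow> cyclotomic s dvd kernel_poly b l S r \<Longrightarrow> zr D s"
    using Ds(4) by auto
qed

text \<open>Blocking by the cyclotomic factors of K alone: these zeros survive the congruences, and
  the next order starts from them.\<close>

definition cyclotomic_blocking :: "nat \<Rightarrow> complex poly \<Rightarrow> bool" where
  "cyclotomic_blocking b K \<longleftrightarrow> (\<forall>n>0. \<exists>m>0. \<exists>s>0. cyclotomic s dvd K \<and>
     (\<exists>k. coprime k s \<and> rt (b ^ m) n = rt s k))"

text \<open>Substituting \<open>x ^ (b ^ l j)\<close> moves a zero from level m to level
  \<open>m + l j\<close>, and blocking does not prescribe the level.\<close>

lemma cyclotomic_blocking_kernel:
  assumes b: "b > 0"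
    and S: "\<And>j t. j \<le> i \<Longrightarrow> t \<in> S j \<Longrightarrow> t > 0" "\<And>j. j \<le> i \<Longrightarrow> finite (S j)"
    and ex: "\<And>n. n > 0 \<Longrightarrow> \<exists>m>0. \<exists>j\<le>i. \<exists>t\<in>S j. \<exists>k. coprime k t \<and> rt (b ^ m) n = rt t k"
  shows "cyclotomic_blocking b (kernel_poly b l S i)"
  unfolding cyclotomic_blocking_def
proof (intro allI impI)
  fix n :: nat assume "n > 0"
  then obtain m j t k where *: "m > 0" "j \<le> i" "t \<in> S j" "coprime k t" "rt (b ^ m) n = rt t k"
    using ex[of n] by blast
  have t: "t > 0" using * S by blast
  have "b ^ (m + l j) > 0" using b by simp
  then obtain s k' where s: "s > 0" "coprime k' s" "rt (b ^ (m + l j)) n = rt s k'"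
    by (rule rt_reduced)
  have "rt (b ^ (m + l j)) n ^ (b ^ l j) = rt (b ^ l j * b ^ m) (b ^ l j * n)"
    by (simp add: rt_power power_add mult.commute)
  then have "rt s k' ^ (b ^ l j) = rt t k" using * s(3) b by (simp add: rt_cancel)
  then have "poly (cyclotomic t) (rt s k' ^ (b ^ l j)) = 0"
    using *(4) poly_cyclotomic_eq_0_iff[OF t] by auto
  then have "poly (kernel_poly b l S i) (rt s k') = 0"
    using * S by (intro kernel_rootI[of j i t]) auto
  then have "cyclotomic s dvd kernel_poly b l S i"
    by (rule kernel_cyclotomic_dvd) (use s S in auto)
  then show "\<exists>m>0. \<exists>s>0. cyclotomic s dvd kernel_poly b l S i \<and> (\<exists>k. coprime k s \<and> rt (b ^ m) n = rt s k)"
    using s *(1) by (intro exI[of _ "m + l j"]) auto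
qed

lemma finite_zr: assumes "finite G" "G \<noteq> {}" shows "finite {s. s > 0 \<and> zr G s}"
proof -
  have "inj_on (\<lambda>s. rt s 1) {s. s > 0 \<and> zr G s}"
  proof (rule inj_onI)
    fix s t assume st: "s \<in> {s. s > 0 \<and> zr G s}" "t \<in> {s. s > 0 \<and> zr G s}" "rt s 1 = rt t 1"
    then have "rt s 1 ^ n = 1 \<longleftrightarrow> rt t 1 ^ n = 1" for n by simp
    then have "s dvd n \<longleftrightarrow> t dvd n" for n using st by (simp add: rt_power rt_eq_1_iff)
    then show "s = t" by (meson dvd_antisym dvd_refl)
  qed
  moreover have "(\<lambda>s. rt s 1) ` {s. s > 0 \<and> zr G s} \<subseteq> {z. poly (set_poly G) z = 0}"
    by (auto simp: zr_def poly_set_poly)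
  moreover have "finite {z. poly (set_poly G) z = 0}"
  proof (rule poly_roots_finite)
    have "poly (set_poly G) 1 \<noteq> 0" using assms by (simp add: poly_set_poly)
    then show "set_poly G \<noteq> 0" by auto
  qed
  ultimately show ?thesis by (rule inj_on_finite)
qed

lemma zr_residues: assumes "set_cong b E {0..<b}" "s dvd b" "s > 1" shows "zr E s"
proof -
  obtain c where c: "b = s * c" using assms by blast
  have "ev {0..<b} (rt s 1) = (\<Sum>x<b. rt s 1 ^ x)" by (simp add: ev_def atLeast0LessThan)
  also have "\<dots> = 0"
  proof -
    have "rt s 1 \<noteq> 1" using assms(3) by (simp add: rt_eq_1_iff)
    moreover have "rt s 1 ^ b = 1" using assms by (simp add: rt_power rt_eq_1_iff)
    ultimately show ?thesis by (simp add: sum_gp_strict)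
  qed
  finally show ?thesis using set_cong_ev[OF assms(1,2), of 1] assms(3) by (simp add: zr_def)
qed

text \<open>In the first order, with the powers of b removed from n, the level just above them gives
  a nontrivial b-th root of unity, where the residue system E vanishes and with it some component.
  Higher orders inherit blocking from the previous kernel.\<close>

lemma modulo_product_form_blocking:
  assumes "modulo_product_form b k D K" "b \<ge> 2"
  shows "card D = b \<and> (\<forall>s>0. cyclotomic s dvd K \<longrightarrow> zr D s) \<and> cyclotomic_blocking b K"
  using assms(1)
proof (induction rule: modulo_product_form.induct)
  case (first_order E r Es l D)
  let ?S = "first_order_indices b Es"
  have E: "finite E" "card E = b" using first_order(2) bij_betw_finite bij_betw_same_card
    by (fastforce simp: set_cong_def)+
  then have ne: "E \<noteq> {}" using assms(2) by auto
  note dec = ev_direct_decomposition[OF first_order(1) E(1) ne]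
  have S: "t > 0 \<and> zr (Es j) t" if "j \<le> r" "t \<in> ?S j" for j t
    using that cyclotomic_dvd_set_poly[of t "Es j"] by (auto simp: first_order_indices_def)
  have finS: "finite (?S j)" for j
  proof -
    have "?S j \<subseteq> {d. d dvd b}" by (auto simp: first_order_indices_def)
    then show ?thesis by (rule finite_subset) (use assms(2) in simp)
  qed
  have b0: "b > 0" using assms(2) by simp
  note z = modulo_product_zeros[OF first_order(5) b0 first_order(3) _ S finS]
  have "cyclotomic_blocking b (kernel_poly b l ?S r)"
  proof (rule cyclotomic_blocking_kernel[OF b0])
    fix n :: nat assume n: "n > 0"
    have nz: "n \<noteq> 0" "\<not> is_unit b" using n assms(2) by auto
    obtain n' where n': "n = b ^ multiplicity b n * n'" "\<not> b dvd n'"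
      using multiplicity_decompose'[OF nz] by blast
    let ?m = "multiplicity b n"
    obtain s k where s: "s > 0" "s dvd b" "coprime k s" "rt b n' = rt s k" "s > 1"
      using rt_reduced[OF b0, of n'] n'(2) by metis
    have "zr E s" using zr_residues first_order(2) s by blast
    then obtain i where i: "i \<le> r" "zr (Es i) s"
      using zr_direct_decomposition[OF first_order(1) E(1) ne] by metis
    then have "s \<in> ?S i" using s cyclotomic_dvd_set_poly by (simp add: first_order_indices_def)
    moreover have "rt (b ^ Suc ?m) n = rt s k"
    proof -
      have "rt (b ^ Suc ?m) n = rt (b ^ ?m * b) (b ^ ?m * n')" using n'(1) by (simp add: mult.commute)
      also have "\<dots> = rt b n'" using b0 by (intro rt_cancel) simp
      finally show ?thesis using s by simp
    qed
    ultimately show "\<exists>m>0. \<exists>j\<le>r. \<exists>t\<in>?S j. \<exists>k. coprime k t \<and> rt (b ^ m) n = rt t k"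
      using i(1) s(3) by (intro exI[of _ "Suc ?m"]) auto
  qed (use S finS in auto)
  then show ?case using z dec E by auto
next
  case (higher_order k G K r Gs l D)
  let ?S = "higher_order_indices K Gs"
  have G: "card G = b" "\<And>s. s > 0 \<Longrightarrow> cyclotomic s dvd K \<Longrightarrow> zr G s" "cyclotomic_blocking b K"
    using higher_order by auto
  then have fin: "finite G" "G \<noteq> {}" using assms(2) by (auto intro: card_ge_0_finite)
  note dec = ev_direct_decomposition[OF higher_order(2) fin]
  have S: "t > 0 \<and> zr (Gs j) t" if "j \<le> r" "t \<in> ?S j" for j t
    using that cyclotomic_dvd_set_poly[of t "Gs j"] by (auto simp: higher_order_indices_def)
  have finS: "finite (?S j)" if "j \<le> r" for j
    using finite_zr[of "Gs j"] dec(3)[OF that] S[OF that] by (auto elim!: finite_subset[rotated])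
  have b0: "b > 0" using assms(2) by simp
  note z = modulo_product_zeros[OF higher_order(5) b0 higher_order(3) _ S finS]
  have "cyclotomic_blocking b (kernel_poly b l ?S r)"
  proof (rule cyclotomic_blocking_kernel[OF b0])
    fix n :: nat assume n: "n > 0"
    then obtain m s k where ms: "m > 0" "s > 0" "cyclotomic s dvd K" "coprime k s" "rt (b ^ m) n = rt s k"
      using G(3) unfolding cyclotomic_blocking_def by blast
    obtain i where i: "i \<le> r" "zr (Gs i) s"
      using zr_direct_decomposition[OF higher_order(2) fin G(2)] ms by metis
    then have "s \<in> ?S i" using ms cyclotomic_dvd_set_poly by (simp add: higher_order_indices_def)
    then show "\<exists>m>0. \<exists>j\<le>r. \<exists>t\<in>?S j. \<exists>k. coprime k t \<and> rt (b ^ m) n = rt t k"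
      using ms i by blast
  qed (use S finS in auto)
  then show ?case using z dec G by auto
qed

lemma modulo_product_form_tile:
  assumes "modulo_product_form b k D K" "b \<ge> 2"
  shows "tile_digit_set b D"
proof -
  have *: "card D = b" "\<And>s. s > 0 \<Longrightarrow> cyclotomic s dvd K \<Longrightarrow> zr D s" "cyclotomic_blocking b K"
    using modulo_product_form_blocking[OF assms] by auto
  have fin: "finite D" "D \<noteq> {}" using * assms(2) by (auto intro: card_ge_0_finite)
  interpret digits b D using assms(2) fin by unfold_locales
  have "blocking b (\<lambda>z. poly (set_poly D) z = 0)"
    unfolding blocking_def
  proof (intro allI impI)
    fix n :: nat assume "n > 0"
    then obtain m s k where "m > 0" "s > 0" "cyclotomic s dvd K" "coprime k s" "rt (b ^ m) n = rt s k"
      using *(3) unfolding cyclotomic_blocking_def by blast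
    then have "m > 0 \<and> poly (set_poly D) (rt (b ^ m) n) = 0"
      using *(2)[of s] by (simp add: poly_set_poly zr_iff)
    then show "\<exists>m>0. poly (set_poly D) (rt (b ^ m) n) = 0" by blast
  qed
  moreover have "poly (set_poly D) 1 \<noteq> 0" using fin by (simp add: poly_set_poly)
  moreover have "n \<in> D" if "coeff (set_poly D) n \<noteq> 0" for n
    using that fin by (auto simp: set_poly_def coeff_sum split: if_splits)
  ultimately have "interior T \<noteq> {}" using interior_T by blast
  then show ?thesis using * assms(2) by (simp add: tile_digit_set_def)
qed

section \<open>Zeros of tile digit sets\<close>

locale prime_base =
  fixes p q \<alpha> b :: nat
  assumes pq: "prime p" "prime q" "p \<noteq> q" and \<alpha>: "\<alpha> \<ge> 1" and b_def: "b = p ^ \<alpha> * q"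
begin

lemma p1: "p > 1" and q1: "q > 1"
  using pq prime_gt_1_nat by auto

lemma b2: "b \<ge> 2"
proof -
  have "p ^ \<alpha> \<ge> 1" using p1 by simp
  then have "1 * q \<le> b" unfolding b_def by (intro mult_le_mono1)
  then show ?thesis using q1 by simp
qed

lemma p_pos [simp]: "p > 0" and q_pos [simp]: "q > 0"
  using p1 q1 by auto

lemma pq_pos [simp]: "p ^ x * q ^ y > 0"
  using p1 q1 by simp

lemma coprime_pq: "coprime (p ^ x) (q ^ y)"
  using pq by (simp add: primes_coprime)

lemma coprime_pow_iff: "coprime k (p ^ x * q ^ y) \<longleftrightarrow> (x = 0 \<or> \<not> p dvd k) \<and> (y = 0 \<or> \<not> q dvd k)"
proof -
  have *: "coprime k (r ^ n) \<longleftrightarrow> n = 0 \<or> \<not> r dvd k" if "prime r" for r n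
  proof (cases "n = 0")
    case False
    have "coprime k r \<longleftrightarrow> \<not> r dvd k"
    proof
      assume "coprime k r"
      then show "\<not> r dvd k" using that by (metis coprime_absorb_right not_prime_unit)
    next
      assume "\<not> r dvd k"
      then have "coprime r k" using that by (intro prime_imp_coprime)
      then show "coprime k r" by (simp add: coprime_commute)
    qed
    then show ?thesis using False by simp
  qed simp
  show ?thesis unfolding coprime_mult_right_iff *[OF pq(1)] *[OF pq(2)] ..
qed

lemma zr_ev:
  assumes "zr D (p ^ x * q ^ y)" "x = 0 \<or> \<not> p dvd k" "y = 0 \<or> \<not> q dvd k"
  shows "ev D (rt (p ^ x * q ^ y) k) = 0"
proof -
  have "coprime k (p ^ x * q ^ y)" using assms(2,3) coprime_pow_iff by blast
  then show ?thesis using assms(1) zr_iff[OF pq_pos] by blast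
qed

lemma power_dvd_iff: "p ^ x * q ^ y dvd p ^ x' * q ^ y' \<longleftrightarrow> x \<le> x' \<and> y \<le> y'"
proof
  assume *: "p ^ x * q ^ y dvd p ^ x' * q ^ y'"
  have "p ^ x dvd p ^ x' * q ^ y'" using * dvd_mult_left by blast
  then have "p ^ x dvd p ^ x'" using coprime_pq by (simp add: coprime_dvd_mult_left_iff)
  moreover have "q ^ y dvd p ^ x' * q ^ y'" using * dvd_mult_right by blast
  then have "q ^ y dvd q ^ y'" using coprime_pq by (simp add: coprime_dvd_mult_right_iff coprime_commute)
  ultimately show "x \<le> x' \<and> y \<le> y'" using p1 q1 power_dvd_imp_le by blast
qed (auto intro: mult_dvd_mono le_imp_power_dvd)

lemma dvd_pq_obtains:
  assumes "s dvd p ^ x * q ^ y"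
  obtains x' y' where "x' \<le> x" "y' \<le> y" "s = p ^ x' * q ^ y'"
proof -
  obtain s1 s2 where "s = s1 * s2" "s1 dvd p ^ x" "s2 dvd q ^ y"
    using division_decomp[OF assms] by blast
  then show ?thesis using that pq divides_primepow_nat by metis
qed

text \<open>The subtractions are truncated.\<close>

lemma rt_base_power:
  assumes "\<not> p dvd n0" "\<not> q dvd n0"
  obtains k where "coprime k (p ^ (\<alpha> * m - P) * q ^ (m - Q))"
    "rt (b ^ m) (p ^ P * q ^ Q * n0) = rt (p ^ (\<alpha> * m - P) * q ^ (m - Q)) k"
proof -
  define c where "c = p ^ min (\<alpha> * m) P * q ^ min m Q"
  define k where "k = p ^ (P - \<alpha> * m) * q ^ (Q - m) * n0"
  have "b ^ m = p ^ (\<alpha> * m) * q ^ m" by (simp add: b_def power_mult_distrib power_mult)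
  also have "p ^ (\<alpha> * m) = p ^ min (\<alpha> * m) P * p ^ (\<alpha> * m - P)" by (simp add: min_def flip: power_add)
  also have "q ^ m = q ^ min m Q * q ^ (m - Q)" by (simp add: min_def flip: power_add)
  finally have 1: "b ^ m = c * (p ^ (\<alpha> * m - P) * q ^ (m - Q))" by (simp add: c_def mult_ac)
  have "p ^ P = p ^ min (\<alpha> * m) P * p ^ (P - \<alpha> * m)" by (simp add: min_def flip: power_add)
  moreover have "q ^ Q = q ^ min m Q * q ^ (Q - m)" by (simp add: min_def flip: power_add)
  ultimately have 2: "p ^ P * q ^ Q * n0 = c * k" by (simp add: c_def k_def mult_ac)
  have "c > 0" by (simp add: c_def)
  then have "rt (b ^ m) (p ^ P * q ^ Q * n0) = rt (p ^ (\<alpha> * m - P) * q ^ (m - Q)) k"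
    unfolding 1 2 by (rule rt_cancel)
  moreover have "coprime k (p ^ (\<alpha> * m - P) * q ^ (m - Q))"
  proof -
    have "\<not> p dvd q" "\<not> q dvd p" using pq primes_dvd_imp_eq by blast+
    then have "\<not> p dvd k \<or> \<alpha> * m - P = 0" "\<not> q dvd k \<or> m - Q = 0"
      using assms pq by (auto simp: k_def prime_dvd_mult_iff dest: prime_dvd_power)
    then show ?thesis unfolding coprime_pow_iff by blast
  qed
  ultimately show ?thesis using that by blast
qed

text \<open>The choice of \<open>p ^ P * q ^ Q\<close> for n turns blocking into a condition on
  lattice points: each truncated diagonal of direction (\<alpha>, 1) meets a zero.\<close>

lemma exponents_of_blocking:
  assumes "blocking b (\<lambda>z. ev D z = 0)"
  shows "\<exists>m>0. zr D (p ^ (\<alpha> * m - P) * q ^ (m - Q))"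
proof -
  have nd: "\<not> p dvd 1" "\<not> q dvd 1" using p1 q1 by auto
  obtain m where m: "m > 0" "ev D (rt (b ^ m) (p ^ P * q ^ Q * 1)) = 0"
    using assms unfolding blocking_def by (metis mult.right_neutral pq_pos)
  obtain k where "coprime k (p ^ (\<alpha> * m - P) * q ^ (m - Q))"
    "rt (b ^ m) (p ^ P * q ^ Q * 1) = rt (p ^ (\<alpha> * m - P) * q ^ (m - Q)) k"
    using rt_base_power[OF nd] by metis
  then have "zr D (p ^ (\<alpha> * m - P) * q ^ (m - Q))" using m zr_iff by (metis pq_pos)
  then show ?thesis using m by blast
qed

lemma blocking_of_exponents:
  assumes Z: "\<And>x y k. Z x y \<Longrightarrow> coprime k (p ^ x * q ^ y) \<Longrightarrow> F (rt (p ^ x * q ^ y) k)"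
    and ex: "\<And>P Q. \<exists>m>0. Z (\<alpha> * m - P) (m - Q)"
  shows "blocking b F"
  unfolding blocking_def
proof (intro allI impI)
  fix n :: nat assume n: "n > 0"
  have nz: "n \<noteq> 0" "\<not> is_unit p" "\<not> is_unit q" using n p1 q1 by auto
  obtain n1 where n1: "n = p ^ multiplicity p n * n1" "\<not> p dvd n1"
    using multiplicity_decompose'[OF nz(1,2)] by blast
  then have "n1 \<noteq> 0" by (metis nz(1) mult_0_right)
  then obtain n0 where n0: "n1 = q ^ multiplicity q n1 * n0" "\<not> q dvd n0"
    using multiplicity_decompose' nz(3) by blast
  define P Q where "P = multiplicity p n" and "Q = multiplicity q n1"
  have n': "n = p ^ P * q ^ Q * n0" "\<not> p dvd n0"
    using n1 n0 unfolding P_def Q_def by (metis mult.assoc, metis dvd_mult)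
  obtain m where m: "m > 0" "Z (\<alpha> * m - P) (m - Q)" using ex by blast
  obtain k where "coprime k (p ^ (\<alpha> * m - P) * q ^ (m - Q))"
    "rt (b ^ m) n = rt (p ^ (\<alpha> * m - P) * q ^ (m - Q)) k"
    using rt_base_power[OF n'(2) n0(2), of m P Q] n'(1) by metis
  then have "F (rt (b ^ m) n)" using Z[OF m(2)] by simp
  then show "\<exists>m>0. F (rt (b ^ m) n)" using m by blast
qed

text \<open>The shape of the zeros of a tile digit set: \<open>Z x y\<close> stands for a zero at the roots of unity of
  order \<open>p ^ x * q ^ y\<close>. There is a row of zeros \<open>(u, j)\<close> with \<open>u \<le> U\<close>, and for each residue
  modulo \<open>\<alpha>\<close> a column of zeros \<open>(a, v)\<close>, which reaches the diagonals of direction \<open>(\<alpha>, 1)\<close> that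
  the row misses.\<close>

definition zero_type :: "(nat \<Rightarrow> nat \<Rightarrow> bool) \<Rightarrow> nat set \<Rightarrow> nat \<Rightarrow> nat \<Rightarrow> bool" where
  "zero_type Z A j U \<longleftrightarrow> finite A \<and> (\<forall>a\<in>A. a > 0) \<and> (\<forall>P. \<exists>a\<in>A. \<exists>m. \<alpha> * m = a + P) \<and>
     j > 0 \<and> \<alpha> * (j - 1) \<le> U \<and> (\<forall>u\<le>U. Z u j) \<and>
     (\<forall>a\<in>A. \<forall>v. v = 0 \<or> U + \<alpha> * v < a + \<alpha> * j \<longrightarrow> Z a v)"

text \<open>The diagonal reaches height j at \<open>m = Q + j\<close>. If this happens beyond U,
  then the column a with \<open>\<alpha> * m = a + P\<close> is met within the heights that the type
  guarantees.\<close>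

lemma zero_type_exponents:
  assumes "zero_type Z A j U"
  shows "\<exists>m>0. Z (\<alpha> * m - P) (m - Q)"
proof (cases "\<alpha> * (Q + j) - P \<le> U")
  case True
  have "Z (\<alpha> * (Q + j) - P) (Q + j - Q)" using assms True by (simp add: zero_type_def)
  moreover have "Q + j > 0" using assms by (simp add: zero_type_def)
  ultimately show ?thesis by blast
next
  case False
  obtain a m where am: "a \<in> A" "\<alpha> * m = a + P" using assms unfolding zero_type_def by blast
  have a: "a > 0" using assms am by (simp add: zero_type_def)
  have col: "v = 0 \<or> U + \<alpha> * v < a + \<alpha> * j \<Longrightarrow> Z a v" for v
    using assms am unfolding zero_type_def by blast
  have "m > 0" using am a by (cases "m = 0") auto
  moreover have "Z a (m - Q)"
  proof (cases "m \<le> Q")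
    case True
    then show ?thesis using col by simp
  next
    case mQ: False
    have "\<alpha> * (m - Q) + \<alpha> * Q = a + P" using mQ am(2) by (simp flip: distrib_left)
    moreover have "U + P < \<alpha> * Q + \<alpha> * j" using False by (simp add: distrib_left)
    ultimately have "U + \<alpha> * (m - Q) < a + \<alpha> * j" by linarith
    then show ?thesis using col by blast
  qed
  moreover have "\<alpha> * m - P = a" using am by simp
  ultimately show ?thesis by metis
qed

end

section \<open>The zeros of a tile digit set form a type\<close>

text \<open>D is dilated by the part \<open>n0\<close> of the period prime to \<open>p * q\<close>.
  The dilated set lies in the class 0 modulo \<open>n0\<close>, and slicing returns D while that
  part disappears from the period.\<close>

lemma prime_base_tiling:
  assumes pq: "prime p" "prime q" "p \<noteq> q" and t: "tiling N D C"
    and cD: "\<And>k. coprime k (p * q) \<Longrightarrow> coprime k (card D)"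
  obtains c d C' where "tiling (p ^ c * q ^ d) D C'" "B \<le> c"
proof -
  have pos: "p > 1" "q > 1" using pq prime_gt_1_nat by auto
  have t1: "tiling (N * p ^ B) D ((\<lambda>(c, i). c + N * i) ` (C \<times> {..<p ^ B}))" (is "tiling ?N D ?C")
    using tiling_extend[OF t] pos by simp
  have N: "?N \<noteq> 0" using t1 by (simp add: tiling_def)
  have nu: "\<not> is_unit p" "\<not> is_unit q" using pos by auto
  obtain n1 where n1: "?N = p ^ multiplicity p ?N * n1" "\<not> p dvd n1"
    using multiplicity_decompose'[OF N nu(1)] by blast
  then have "n1 \<noteq> 0" by (metis N mult_0_right)
  then obtain n0 where n0: "n1 = q ^ multiplicity q n1 * n0" "\<not> q dvd n0"
    using multiplicity_decompose' nu(2) by blast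
  define c d where "c = multiplicity p ?N" and "d = multiplicity q n1"
  have eq: "?N = n0 * (p ^ c * q ^ d)" using n1(1) n0(1) unfolding c_def d_def
    by (metis mult.assoc mult.commute)
  have n0p: "\<not> p dvd n0" "n0 > 0" using n1(2) n0(1) \<open>n1 \<noteq> 0\<close> by (metis dvd_mult, metis gr0I mult_0_right)
  have "B \<le> c" unfolding c_def by (rule multiplicity_geI) (use N nu in auto)
  have "coprime p n0" "coprime q n0" using pq n0p n0 by (auto intro: prime_imp_coprime)
  then have "coprime n0 (card D)" using cD by (simp add: coprime_commute)
  then have t2: "tiling (n0 * (p ^ c * q ^ d)) ((*) n0 ` D) ?C"
    using tijdeman[OF t1 n0p(2)] eq by simp
  have "tiling (p ^ c * q ^ d) (slice n0 0 ((*) n0 ` D)) (slice n0 0 ?C)"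
    by (rule tiling_reduce[OF t2 n0p(2)]) (use n0p in auto)
  moreover have "slice n0 0 ((*) n0 ` D) = D" using n0p by (auto simp: slice_def)
  ultimately show ?thesis using that \<open>B \<le> c\<close> by simp
qed

context prime_base
begin

lemma zr_1: "finite D \<Longrightarrow> D \<noteq> {} \<Longrightarrow> \<not> zr D (Suc 0)"
  by (simp add: zr_def rt_def)

lemma row_of_shift:
  assumes "finite D" "inv_shift D (p ^ x * q ^ Suc y) (p ^ x * q ^ y)" "x' \<le> x"
  shows "zr D (p ^ x' * q ^ Suc y)"
proof -
  have "\<forall>k. q dvd k \<or> ev D (rt (p ^ x * q ^ Suc y) k) = 0"
    using assms(2) unfolding inv_shift_def
    by (subst cnt_shift_invariant_iff[OF assms(1), of _ q "p ^ x * q ^ y"]) (use p1 q1 in auto)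
  moreover have "\<not> q dvd p ^ (x - x')" using pq by (metis prime_dvd_power primes_dvd_imp_eq)
  ultimately have "ev D (rt (p ^ x * q ^ Suc y) (p ^ (x - x') * 1)) = 0" by (metis mult.right_neutral)
  moreover have "p ^ x * q ^ Suc y = p ^ (x - x') * (p ^ x' * q ^ Suc y)"
    using assms(3) by (simp flip: mult.assoc power_add)
  moreover have "rt (p ^ (x - x') * (p ^ x' * q ^ Suc y)) (p ^ (x - x') * 1) = rt (p ^ x' * q ^ Suc y) 1"
    by (rule rt_cancel) simp
  ultimately have "ev D (rt (p ^ x' * q ^ Suc y) 1) = 0" by (simp only:)
  then show ?thesis by (simp add: zr_def)
qed

lemma mixed_of_zr:
  assumes "finite D" "zr D (p ^ Suc x * q ^ Suc y)"
  shows "inv_mixed D (p ^ Suc x * q ^ Suc y) (p ^ x * q ^ Suc y) (p ^ Suc x * q ^ y)"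
proof -
  have "p dvd k \<or> q dvd k \<or> ev D (rt (p ^ Suc x * q ^ Suc y) k) = 0" for k
    using zr_ev[OF assms(2), of k] by blast
  then show ?thesis unfolding inv_mixed_def
    by (subst cnt_mixed_iff[OF assms(1), of _ p _ q, symmetric]) (use p1 q1 in auto)
qed

text \<open>The orders of \<open>rt (p ^ Suc a * q ^ V) k\<close> with p not dividing k are of the
  form \<open>p ^ Suc a * q ^ v\<close> with \<open>v \<le> V\<close>.\<close>

lemma shift_of_column:
  assumes "finite D" "\<And>v. v \<le> V \<Longrightarrow> zr D (p ^ Suc a * q ^ v)"
  shows "inv_shift D (p ^ Suc a * q ^ V) (p ^ a * q ^ V)"
proof -
  have "p dvd k \<or> ev D (rt (p ^ Suc a * q ^ V) k) = 0" for k
    using assms(2)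
  proof (induction V arbitrary: k)
    case 0
    then have "zr D (p ^ Suc a * q ^ 0)" by blast
    then show ?case using zr_ev[of D "Suc a" 0 k] by blast
  next
    case (Suc V)
    show ?case
    proof (cases "q dvd k")
      case True
      then obtain k' where k': "k = q * k'" by blast
      have "rt (q * (p ^ Suc a * q ^ V)) (q * k') = rt (p ^ Suc a * q ^ V) k'"
        using q1 by (intro rt_cancel) simp
      moreover have "p ^ Suc a * q ^ Suc V = q * (p ^ Suc a * q ^ V)" by simp
      moreover have "p dvd k' \<or> ev D (rt (p ^ Suc a * q ^ V) k') = 0" using Suc by simp
      ultimately show ?thesis using k' by (metis dvd_mult)
    next
      case False
      moreover have "zr D (p ^ Suc a * q ^ Suc V)" using Suc.prems by blast
      ultimately show ?thesis using zr_ev[of D "Suc a" "Suc V" k] by blast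
    qed
  qed
  then show ?thesis unfolding inv_shift_def
    by (subst cnt_shift_invariant_iff[OF assms(1), of _ p, symmetric]) (use p1 q1 in auto)
qed

text \<open>Suitable choices of P and Q give diagonals that can meet the zeros in one place only,
  and blocking then forces a zero there.\<close>

lemma zero_type_of_tile:
  assumes tile: "tile_digit_set b D" and D0: "0 \<in> D" "Gcd D = 1"
  obtains A j U where "zero_type (\<lambda>x y. zr D (p ^ x * q ^ y)) A j U"
proof -
  have cD: "card D = b" using tile by (simp add: tile_digit_set_def)
  have fin: "finite D" "D \<noteq> {}" using cD b2 by (auto intro: card_ge_0_finite)
  define S where "S x y = zr D (p ^ x * q ^ y)" for x y
  have hit: "\<exists>m>0. S (\<alpha> * m - P) (m - Q)" for P Q
    unfolding S_def using exponents_of_blocking tile_blocking[OF tile] by blast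
  have S00: "\<not> S 0 0" using zr_1[OF fin] by (simp add: S_def)
  obtain B where B: "\<And>x y. S x y \<Longrightarrow> x \<le> B \<and> y \<le> B"
  proof -
    define B where "B = Max {s. s > 0 \<and> zr D s}"
    have "x \<le> B \<and> y \<le> B" if "S x y" for x y
    proof -
      have le: "p ^ x * q ^ y \<le> B" unfolding B_def
        using that finite_zr[OF fin] by (intro Max_ge) (auto simp: S_def p1 q1 gr0I)
      have "x < p ^ x" "y < q ^ y" using p1 q1 by (auto intro: less_exp order_less_le_trans[OF less_exp power_mono])
      moreover have "p ^ x \<le> p ^ x * q ^ y" "q ^ y \<le> p ^ x * q ^ y" using p1 q1 by auto
      ultimately show ?thesis using le by linarith
    qed
    then show ?thesis using that by blast
  qed
  define A where "A = {a. a > 0 \<and> S a 0}"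
  have finA: "finite A" using B by (intro finite_subset[of A "{..B}"]) (auto simp: A_def)
  have cutA: "Suc a \<in> A \<longleftrightarrow> inv_shift D (p ^ Suc a) (p ^ a)" for a
    using zr_prime_power_iff[OF pq(1) fin(1), of a] by (simp add: A_def S_def)
  \<comment> \<open>Q is so large that the diagonal has height 0 wherever its first exponent is in
    the range of the zeros.\<close>
  have cover: "\<exists>a\<in>A. \<exists>m. \<alpha> * m = a + P" for P
  proof -
    obtain m where m: "m > 0" "S (\<alpha> * m - P) (m - (B + P + 1))" using hit by blast
    have "\<alpha> * m \<le> B + P" using B[OF m(2)] by linarith
    moreover have "m * 1 \<le> m * \<alpha>" using \<alpha> by (intro mult_le_mono2)
    ultimately have "m - (B + P + 1) = 0" by (simp only: mult.commute[of m \<alpha>])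
    then have "S (\<alpha> * m - P) 0" using m by simp
    moreover from this have "\<alpha> * m - P > 0" using S00 by (metis gr0I)
    ultimately show ?thesis unfolding A_def by (intro bexI[of _ "\<alpha> * m - P"] exI[of _ m]) auto
  qed
  \<comment> \<open>Each column is a cut of D, so there are at most \<alpha> of them, while
    \<open>cover\<close> demands one for each residue modulo \<alpha>. Hence there is exactly one
    per residue.\<close>
  have cardA: "card A \<le> \<alpha>"
  proof -
    have "A = Suc ` cuts p D B"
    proof (intro equalityI subsetI)
      fix a assume a: "a \<in> A"
      then obtain a' where a': "a = Suc a'" using gr0_implies_Suc by (auto simp: A_def)
      have "a \<le> B" using a B by (auto simp: A_def)
      then show "a \<in> Suc ` cuts p D B" using a a' cutA by (auto simp: cuts_def)
    qed (auto simp: cuts_def cutA)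
    then have "card A = card (cuts p D B)" by (simp add: card_image)
    moreover have "p ^ card (cuts p D B) dvd p ^ \<alpha> * q"
      using cuts_card_dvd[OF fin(1), of p B] p1 cD b_def by simp
    then have "card (cuts p D B) \<le> \<alpha>" using power_dvd_iff[of _ 0 \<alpha> 1] by simp
    ultimately show ?thesis by simp
  qed
  have residues: "(\<lambda>a. a mod \<alpha>) ` A = {..<\<alpha>}"
  proof (intro equalityI subsetI)
    fix r assume "r \<in> {..<\<alpha>}"
    then have r: "r < \<alpha>" by simp
    obtain a m where am: "a \<in> A" "\<alpha> * m = a + (\<alpha> - r)" using cover by blast
    have "a + \<alpha> = \<alpha> * m + r" using am(2) r by linarith
    then have "a mod \<alpha> = r" using r by (metis mod_add_self2 mod_less mod_mult_self4)
    then show "r \<in> (\<lambda>a. a mod \<alpha>) ` A" using am by blast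
  qed (use \<alpha> in auto)
  then have cardA': "card A = \<alpha>" using card_image_le[OF finA, of "\<lambda>a. a mod \<alpha>"] cardA by simp
  have injA: "a = a'" if "a \<in> A" "a' \<in> A" "a mod \<alpha> = a' mod \<alpha>" for a a'
  proof -
    have "inj_on (\<lambda>a. a mod \<alpha>) A" using finA residues cardA' by (intro eq_card_imp_inj_on) auto
    then show ?thesis using that by (auto dest: inj_onD)
  qed
  \<comment> \<open>Dually, P is so large that the first exponent is truncated to 0 as long as m is
    in the range of the zeros.\<close>
  obtain j where j: "j > 0" "S 0 j"
  proof -
    obtain m where m: "m > 0" "S (\<alpha> * m - \<alpha> * B) (m - 0)" using hit by blast
    have "m \<le> B" using B[OF m(2)] by simp
    then have "\<alpha> * m \<le> \<alpha> * B" by simp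
    then have "S 0 m" using m by simp
    then show ?thesis using that m by blast
  qed
  have cutq: "S 0 (Suc y) \<longleftrightarrow> inv_shift D (q ^ Suc y) (q ^ y)" for y
    using zr_prime_power_iff[OF pq(2) fin(1), of y] by (simp add: S_def)
  have uniq: "y = j" if "S 0 y" for y
  proof -
    have "y > 0" using that S00 by (metis gr0I)
    then obtain y' j' where y: "y = Suc y'" "j = Suc j'" using j gr0_implies_Suc by metis
    have le: "y \<le> B" "j \<le> B" using that j B by auto
    have "q ^ card (cuts q D B) dvd p ^ \<alpha> * q ^ 1"
      using cuts_card_dvd[OF fin(1), of q B] q1 cD b_def by simp
    then have "card (cuts q D B) \<le> 1" using power_dvd_iff[of 0 _ \<alpha> 1] by simp
    moreover have "y' \<in> cuts q D B" "j' \<in> cuts q D B"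
      using that y j le cutq[of y'] cutq[of j'] by (auto simp: cuts_def)
    ultimately have "y' = j'" using card_le_Suc0_iff_eq[OF finite_cuts, of q D B] by auto
    then show ?thesis using y by simp
  qed
  obtain N0 C0 where "tiling N0 D C0" using tile_periodic_tiling[OF tile] by blast
  moreover have "coprime k (card D)" if "coprime k (p * q)" for k
    using that by (simp add: cD b_def)
  ultimately obtain c d C where t: "tiling (p ^ c * q ^ d) D C" and c: "B \<le> c"
    using prime_base_tiling[OF pq] by metis
  \<comment> \<open>Outside the columns the cut at \<open>x - 1\<close> belongs to C, so
    \<open>mixed_zero_is_full\<close> turns a single mixed zero into a row of zeros up to x.\<close>
  have row: "S x' y" if hyp: "S x y" "x > 0" "y > 0" "x \<notin> A" "x' \<le> x" for x x' y
  proof -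
    obtain x0 y0 where xy: "x = Suc x0" "y = Suc y0" using hyp(2,3) gr0_implies_Suc by metis
    have x0: "x0 < c" using B[OF hyp(1)] c xy by simp
    have "\<not> inv_shift D (p ^ Suc x0) (p ^ x0)" using hyp(4) cutA xy by simp
    then have invC: "inv_shift C (p ^ Suc x0) (p ^ x0)"
      using cuts_union[OF pq t] x0 by (auto simp: cuts_def)
    have nq: "\<not> q\<^sup>2 dvd card D"
      using power_dvd_iff[of 0 2 \<alpha> 1] cD b_def by simp
    have "inv_mixed D (p ^ Suc x0 * q ^ Suc y0) (p ^ x0 * q ^ Suc y0) (p ^ Suc x0 * q ^ y0)"
      using hyp(1) xy fin by (intro mixed_of_zr) (simp_all only: S_def)
    then have "inv_shift D (p ^ Suc x0 * q ^ Suc y0) (p ^ Suc x0 * q ^ y0)"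
      by (rule mixed_zero_is_full[OF pq t nq x0 invC])
    then show ?thesis unfolding S_def xy(2)
      by (rule row_of_shift[OF fin(1)]) (use hyp(5) xy in simp)
  qed
  define U where "U = Max {u. \<forall>u'\<le>u. S u' j}"
  have "{u. \<forall>u'\<le>u. S u' j} \<subseteq> {..B}" using B by blast
  then have finU: "finite {u. \<forall>u'\<le>u. S u' j}" by (rule finite_subset) simp
  have U: "\<forall>u\<le>U. S u j"
  proof -
    have "U \<in> {u. \<forall>u'\<le>u. S u' j}" unfolding U_def by (rule Max_in[OF finU]) (use j in auto)
    then show ?thesis by simp
  qed
  have Umax: "x \<le> U" if "\<forall>u'\<le>x. S u' j" for x
    unfolding U_def using finU that by (intro Max_ge) auto
  \<comment> \<open>The diagonal with this P and with \<open>Q = a\<close> passes through (a, v) at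
    \<open>m = m0\<close>. It meets no other column, as columns differ modulo \<alpha>; any further
    zero on it would lie in row j, which it crosses only beyond U.\<close>
  have column: "S a v" if a: "a \<in> A" and v: "v > 0" "U + \<alpha> * v < a + \<alpha> * j" for a v
  proof -
    define m0 where "m0 = a + v"
    define P where "P = \<alpha> * m0 - a"
    have a0: "a > 0" using a by (simp add: A_def)
    have "1 * a \<le> \<alpha> * m0" using \<alpha> by (intro mult_le_mono) (auto simp: m0_def)
    then have P: "\<alpha> * m0 = P + a" by (simp add: P_def)
    obtain m where m: "m > 0" "S (\<alpha> * m - P) (m - a)" using hit by blast
    have same: "m = m0" if x: "\<alpha> * m - P \<in> A"
    proof -
      have "\<alpha> * m - P > 0" using x by (simp add: A_def)
      then have eq: "\<alpha> * m + a = \<alpha> * m0 + (\<alpha> * m - P)" using P by linarith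
      then have "a mod \<alpha> = (\<alpha> * m - P) mod \<alpha>" by (metis mod_mult_self4)
      then have "a = \<alpha> * m - P" using injA a x by blast
      then have "\<alpha> * m = \<alpha> * m0" using eq by linarith
      then show ?thesis using \<alpha> by simp
    qed
    have xA: "\<alpha> * m - P \<in> A" if "m \<le> a"
    proof -
      have s: "S (\<alpha> * m - P) 0" using m(2) that by simp
      then have "\<alpha> * m - P \<noteq> 0" using S00 by metis
      then show ?thesis using s by (simp add: A_def)
    qed
    have "\<not> m \<le> a" using same xA v(1) by (auto simp: m0_def)
    then have y: "m - a > 0" by simp
    have expand: "\<alpha> * m0 = \<alpha> * a + \<alpha> * v" by (simp add: m0_def distrib_left)
    have mj: "\<alpha> * m = \<alpha> * a + \<alpha> * j" if "m - a = j"
      using that y by (metis add_diff_inverse_nat distrib_left not_less_iff_gr_or_eq zero_less_diff less_imp_not_less)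
    consider "\<alpha> * m - P = 0" | "\<alpha> * m - P > 0" "\<alpha> * m - P \<in> A" | "\<alpha> * m - P > 0" "\<alpha> * m - P \<notin> A" by blast
    then show ?thesis
    proof cases
      case 1
      then have "m - a = j" using m uniq by simp
      then have "\<alpha> * a + \<alpha> * j \<le> P" using mj 1 by simp
      then show ?thesis using v(2) P expand by linarith
    next
      case 2
      then have "m = m0" using same by simp
      then show ?thesis using m P by (simp add: m0_def)
    next
      case 3
      have rows: "S x' (m - a)" if "x' \<le> \<alpha> * m - P" for x' using row[OF m(2) 3(1) y 3(2) that] .
      then have "m - a = j" using uniq by blast
      then have "\<alpha> * m - P \<le> U" using rows by (intro Umax) auto
      then show ?thesis using mj[OF \<open>m - a = j\<close>] v(2) P expand by linarith
    qed
  qed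
  \<comment> \<open>Otherwise every column contains a zero at height 1, and the number of elements
    of D divisible by q is a positive multiple of \<open>p ^ \<alpha> * q\<close>. Then q divides
    all of D, against \<open>Gcd D = 1\<close>.\<close>
  have "\<alpha> * (j - 1) \<le> U"
  proof (rule ccontr)
    assume "\<not> ?thesis"
    then have U': "U < \<alpha> * (j - 1)" by simp
    then have j2: "j \<ge> 2" by (cases "j = 1") (use j in auto)
    have "\<alpha> * j = \<alpha> * (j - 1) + \<alpha>" using j by (cases j) auto
    then have cols: "S a 0 \<and> S a 1" if "a \<in> A" for a
      using column[OF that, of 1] U' that by (auto simp: A_def)
    define D' where "D' = slice q 0 D"
    have D': "finite D'" "card D' = cnt D (q ^ 1) 0" using fin q1 by (auto simp: D'_def finite_slice card_slice)
    have "p ^ \<alpha> dvd card D'"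
    proof -
      have "A \<subseteq> Suc ` cuts p D' B"
      proof
        fix a assume a: "a \<in> A"
        then obtain a' where a': "a = Suc a'" using gr0_implies_Suc by (auto simp: A_def)
        have "zr D (p ^ Suc a' * q ^ v)" if "v \<le> 1" for v
          using cols[OF a] a' that by (cases "v = 0") (auto simp: S_def le_Suc_eq)
        then have "inv_shift D (p ^ Suc a' * q ^ 1) (p ^ a' * q ^ 1)" using fin by (intro shift_of_column) auto
        then have "inv_shift D' (p ^ Suc a') (p ^ a')"
          unfolding D'_def using q1 by (intro inv_shift_slice) (auto simp: mult.commute)
        moreover have "a \<le> B" using a B by (auto simp: A_def)
        ultimately show "a \<in> Suc ` cuts p D' B" using a' by (auto simp: cuts_def)
      qed
      then have "card A \<le> card (cuts p D' B)" by (meson surj_card_le finite_cuts)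
      then have "p ^ \<alpha> dvd p ^ card (cuts p D' B)" using cardA' by (simp add: le_imp_power_dvd)
      then show ?thesis using cuts_card_dvd[OF D'(1), of p B] p1 by (meson dvd_trans less_imp_le order_less_trans zero_less_one)
    qed
    moreover have "q dvd card D'"
    proof -
      obtain j' where j': "j = Suc j'" using j gr0_implies_Suc by blast
      have jc: "j' \<in> {u \<in> cuts q D j. 1 \<le> u}" using j j2 cutq[of j'] j' by (auto simp: cuts_def)
      then have "card {u \<in> cuts q D j. 1 \<le> u} \<ge> 1" by (metis (no_types, lifting) Suc_leI card_gt_0_iff empty_iff finite_cuts finite_subset mem_Collect_eq subsetI One_nat_def)
      then have "q ^ 1 dvd q ^ card {u \<in> cuts q D j. 1 \<le> u}" by (rule le_imp_power_dvd)
      also have "\<dots> dvd cnt D (q ^ 1) 0" using fin q1 j2 by (intro cuts_dvd_cnt) auto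
      finally show ?thesis using D' by simp
    qed
    ultimately have "p ^ \<alpha> * q dvd card D'"
      using coprime_pq[of \<alpha> 1] by (intro divides_mult) auto
    moreover have "0 \<in> D'" using D0 by (simp add: D'_def slice_def)
    then have "card D' > 0" using D'(1) by (auto simp: card_gt_0_iff)
    ultimately have "card D \<le> card D'" using cD b_def dvd_imp_le by simp
    then have "card D \<le> card {x \<in> D. [x = 0] (mod q)}" using D' by (simp add: cnt_def)
    then have "{x \<in> D. [x = 0] (mod q)} = D" using fin by (intro card_seteq) auto
    then have "[x = 0] (mod q)" if "x \<in> D" for x using that by blast
    then have "q dvd x" if "x \<in> D" for x using that by (simp add: cong_0_iff)
    then have "q dvd Gcd D" by (rule Gcd_greatest)
    then show False using D0 q1 by simp
  qed
  moreover have "S a v" if "a \<in> A" "v = 0 \<or> U + \<alpha> * v < a + \<alpha> * j" for a v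
    using that column[of a v] by (cases "v = 0") (auto simp: A_def)
  moreover have "a > 0" if "a \<in> A" for a using that by (simp add: A_def)
  ultimately have "zero_type S A j U"
    unfolding zero_type_def using finA cover j(1) U by blast
  then show ?thesis using that unfolding S_def by blast
qed

end

section \<open>Construction of modulo product-forms\<close>

lemma set_cong_of_cnt:
  assumes fin: "finite X" "finite Y" and n: "n > 0" and cnt: "\<And>t. cnt X n t = cnt Y n t"
  shows "set_cong n X Y"
proof -
  have "\<exists>f. bij_betw f {x \<in> X. [x = t] (mod n)} {y \<in> Y. [y = t] (mod n)}" for t
    by (rule finite_same_card_bij[OF _ _ cnt[of t, unfolded cnt_def]]) (use fin in simp_all)
  then obtain f where f: "\<And>t. bij_betw (f t) {x \<in> X. [x = t] (mod n)} {y \<in> Y. [y = t] (mod n)}" by metis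
  define g where "g x = f (x mod n) x" for x
  have g: "g x \<in> Y" "[g x = x] (mod n)" if "x \<in> X" for x
  proof -
    have "g x \<in> {y \<in> Y. [y = x mod n] (mod n)}"
      unfolding g_def using that f[of "x mod n"] by (auto simp: bij_betw_def cong_def)
    then show "g x \<in> Y" "[g x = x] (mod n)" by (auto simp: cong_def)
  qed
  have "bij_betw g X Y"
    unfolding bij_betw_def
  proof
    show "inj_on g X"
    proof (rule inj_onI)
      fix x x' assume *: "x \<in> X" "x' \<in> X" "g x = g x'"
      then have "[x = x'] (mod n)" using g(2) by (metis cong_sym cong_trans)
      then have m: "x' mod n = x mod n" by (simp add: cong_def)
      have "inj_on (f (x mod n)) {z \<in> X. [z = x mod n] (mod n)}" using f unfolding bij_betw_def by blast
      then show "x = x'" using * m unfolding g_def by (auto simp: inj_on_def cong_def)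
    qed
    show "g ` X = Y"
    proof (intro equalityI subsetI)
      fix y assume "y \<in> Y"
      then have "y \<in> f (y mod n) ` {x \<in> X. [x = y mod n] (mod n)}"
        using f[of "y mod n"] by (auto simp: bij_betw_def cong_def)
      then obtain x where x: "x \<in> X" "x mod n = y mod n" "y = f (y mod n) x" by (auto simp: cong_def)
      then have "y = g x" by (simp add: g_def)
      then show "y \<in> g ` X" using x by blast
    qed (use g in auto)
  qed
  then show ?thesis unfolding set_cong_def using g(2) cong_sym by blast
qed

lemma set_cong_refl: "set_cong n X X"
  unfolding set_cong_def by (intro exI[of _ id]) auto

lemma set_cong_dvd: "set_cong n X Y \<Longrightarrow> m dvd n \<Longrightarrow> set_cong m X Y"
  unfolding set_cong_def using cong_dvd_modulus_nat by metis

section \<open>Splitting off an arithmetic progression\<close>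

definition progression :: "nat \<Rightarrow> nat \<Rightarrow> nat set" where
  "progression r h = (\<lambda>i. i * h) ` {..<r}"

lemma finite_progression [simp]: "finite (progression r h)"
  by (simp add: progression_def)

lemma card_progression: "h > 0 \<Longrightarrow> card (progression r h) = r"
  unfolding progression_def by (subst card_image) (auto simp: inj_on_def)

lemma ev_progression: assumes "h > 0" shows "ev (progression r h) z = (\<Sum>i<r. (z ^ h) ^ i)"
proof -
  have "inj_on (\<lambda>i. i * h) {..<r}" using assms by (auto simp: inj_on_def)
  then have "ev (progression r h) z = (\<Sum>i<r. z ^ (i * h))"
    by (simp add: ev_def progression_def sum.reindex)
  also have "\<dots> = (\<Sum>i<r. (z ^ h) ^ i)"
    by (intro sum.cong refl) (metis mult.commute power_mult)
  finally show ?thesis .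
qed

lemma zr_progression_iff:
  assumes "h > 0" "s > 0" "r > 0"
  shows "zr (progression r h) s \<longleftrightarrow> s dvd r * h \<and> \<not> s dvd h"
proof -
  let ?x = "rt s 1 ^ h"
  have x: "?x = 1 \<longleftrightarrow> s dvd h" "?x ^ r = 1 \<longleftrightarrow> s dvd r * h"
    using assms by (simp_all add: rt_power rt_eq_1_iff)
  show ?thesis
  proof (cases "s dvd h")
    case True
    then have "?x = 1" using x by simp
    then show ?thesis using assms True by (simp add: zr_def ev_progression)
  next
    case False
    then have "?x \<noteq> 1" using x by simp
    then have "(\<Sum>i<r. ?x ^ i) = 0 \<longleftrightarrow> ?x ^ r = 1" by (simp add: sum_gp_strict)
    then show ?thesis using False x assms by (simp add: zr_def ev_progression)
  qed
qed

locale shift_invariant =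
  fixes D :: "nat set" and r h :: nat
  assumes fin: "finite D" and r: "r > 0" and h: "h > 0" and inv: "inv_shift D (r * h) h"
begin

text \<open>One out of each r classes modulo \<open>r * h\<close> that the shift by h permutes;
  invariance recovers the others from it.\<close>

definition base :: "nat set" where
  "base = {x \<in> D. x mod (r * h) < h}"

lemma finite_base: "finite base"
  using fin by (simp add: base_def)

lemma base_unique:
  assumes "d \<in> base" "i < r" "[d + i * h = t] (mod (r * h))"
  shows "d mod (r * h) = t mod h" "i = (t mod (r * h)) div h"
proof -
  let ?e = "d mod (r * h)"
  have e: "?e < h" using assms(1) by (simp add: base_def)
  have "?e + i * h < r * h"
  proof -
    have "(i + 1) * h \<le> r * h" using assms(2) by (intro mult_le_mono1) simp
    then show ?thesis using e by simp
  qed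
  moreover have "[?e + i * h = t] (mod (r * h))"
    using assms(3) by (simp add: cong_def mod_add_left_eq)
  ultimately have eq: "t mod (r * h) = ?e + i * h" by (simp add: cong_def)
  have "t mod h = t mod (r * h) mod h" by (simp add: mod_mod_cancel)
  then show "?e = t mod h" using eq e by simp
  show "i = (t mod (r * h)) div h" using eq e h by simp
qed

lemma direct_base: "direct base (progression r h)"
  unfolding direct_def
proof (rule inj_onI, clarify)
  fix d e d' e' assume *: "d \<in> base" "e \<in> progression r h" "d' \<in> base" "e' \<in> progression r h" "d + e = d' + e'"
  obtain i i' where i: "i < r" "e = i * h" "i' < r" "e' = i' * h" using * by (auto simp: progression_def)
  have "i = ((d + e) mod (r * h)) div h" using base_unique(2)[OF *(1) i(1)] i by (simp add: cong_def)
  moreover have "i' = ((d + e) mod (r * h)) div h" using base_unique(2)[OF *(3) i(3)] i * by (simp add: cong_def)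
  ultimately show "d = d' \<and> e = e'" using i * by simp
qed

lemma cnt_sumset: "cnt (sumset base (progression r h)) (r * h) t = cnt D (r * h) t"
proof -
  define i where "i = (t mod (r * h)) div h"
  have i: "i < r" using r h by (simp add: i_def less_mult_imp_div_less)
  have tt: "t mod (r * h) = t mod h + i * h"
    by (metis i_def add.commute div_mult_mod_eq dvd_triv_right mod_mod_cancel)
  have th: "t mod h < h" using h by simp
  also have "h \<le> r * h" using r by simp
  finally have "t mod h < r * h" .
  then have tm: "t mod h mod (r * h) = t mod h" by simp
  have "{y \<in> sumset base (progression r h). [y = t] (mod (r * h))}
     = (\<lambda>d. d + i * h) ` {d \<in> D. [d = t mod h] (mod (r * h))}"
  proof (intro equalityI subsetI)
    fix y assume "y \<in> {y \<in> sumset base (progression r h). [y = t] (mod (r * h))}"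
    then obtain d i' where d: "d \<in> base" "i' < r" "y = d + i' * h" "[d + i' * h = t] (mod (r * h))"
      by (auto simp: sumset_def progression_def)
    have "i' = i" "d mod (r * h) = t mod h" using base_unique[OF d(1,2,4)] by (auto simp: i_def)
    moreover have "d \<in> D" using d by (simp add: base_def)
    ultimately show "y \<in> (\<lambda>d. d + i * h) ` {d \<in> D. [d = t mod h] (mod (r * h))}"
      using d(3) by (intro image_eqI[of _ _ d]) (simp_all add: cong_def tm)
  next
    fix y assume "y \<in> (\<lambda>d. d + i * h) ` {d \<in> D. [d = t mod h] (mod (r * h))}"
    then obtain d where d: "d \<in> D" "[d = t mod h] (mod (r * h))" "y = d + i * h" by blast
    have "d mod (r * h) = t mod h" using d(2) tm by (simp add: cong_def)
    then have "d \<in> base" using d(1) th by (simp add: base_def)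
    moreover have "[d + i * h = t mod h + i * h] (mod (r * h))" using d(2) by (rule cong_add[OF _ cong_refl])
    then have "[y = t] (mod (r * h))" using d(3) tt by (metis cong_def mod_mod_trivial)
    moreover have "i * h \<in> progression r h" using i unfolding progression_def by blast
    ultimately show "y \<in> {y \<in> sumset base (progression r h). [y = t] (mod (r * h))}"
      using d(3) by (auto simp: sumset_def)
  qed
  then have "cnt (sumset base (progression r h)) (r * h) t = card ((\<lambda>d. d + i * h) ` {d \<in> D. [d = t mod h] (mod (r * h))})"
    by (simp add: cnt_def)
  also have "\<dots> = cnt D (r * h) (t mod h)"
    unfolding cnt_def by (rule card_image) (simp add: inj_on_def)
  also have "\<dots> = cnt D (r * h) (t mod h + i * h)" by (rule inv_shift_mult[OF inv, symmetric])
  also have "\<dots> = cnt D (r * h) t" using tt by (intro cnt_cong) (metis cong_def mod_mod_trivial)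
  finally show ?thesis .
qed

lemma set_cong_base: "set_cong (r * h) D (sumset base (progression r h))"
  using fin finite_base r h cnt_sumset
  by (intro set_cong_of_cnt) (auto simp: sumset_def)

lemma card_base: "card D = card base * r"
proof -
  have "card D = card (sumset base (progression r h))"
    using set_cong_base bij_betw_same_card by (auto simp: set_cong_def)
  also have "\<dots> = card base * card (progression r h)"
    using direct_base unfolding direct_def sumset_def by (simp add: card_image card_cartesian_product)
  finally show ?thesis using h by (simp add: card_progression)
qed

text \<open>At roots whose order divides \<open>r * h\<close> the mask polynomial of D has that of
  the progression as a factor, and the progression has no zero of an order dividing h.\<close>

lemma zr_base: assumes "s dvd h" "zr D s" shows "zr base s"
proof -
  have s: "s > 0" using assms(1) h by (intro Nat.gr0I) auto
  have "s dvd r * h" using assms(1) by simp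
  then have "ev D (rt s 1) = ev (sumset base (progression r h)) (rt s 1)"
    using s by (rule set_cong_ev[OF set_cong_base])
  also have "\<dots> = ev base (rt s 1) * ev (progression r h) (rt s 1)" by (rule ev_sumset[OF direct_base])
  finally have "ev base (rt s 1) * ev (progression r h) (rt s 1) = 0" using assms by (simp add: zr_def)
  moreover have "\<not> zr (progression r h) s" using zr_progression_iff[OF h s r] assms(1) by simp
  ultimately show ?thesis by (simp add: zr_def)
qed

end

lemma direct_decomposition_pair:
  assumes "direct X Y"
  shows "direct_decomposition (sumset X Y) 1 (\<lambda>i. if i = 0 then X else Y)"
proof -
  let ?E = "\<lambda>i::nat. if i = 0 then X else Y"
  have bij: "bij_betw (\<lambda>e::nat \<Rightarrow> nat. (e 0, e 1)) (PiE {..1} ?E) (X \<times> Y)"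
    unfolding bij_betw_def
  proof
    show "inj_on (\<lambda>e::nat \<Rightarrow> nat. (e 0, e 1)) (PiE {..1} ?E)"
    proof (rule inj_onI)
      fix e e' :: "nat \<Rightarrow> nat" assume *: "e \<in> PiE {..1} ?E" "e' \<in> PiE {..1} ?E" "(e 0, e 1) = (e' 0, e' 1)"
      show "e = e'" using *(1,2)
      proof (rule PiE_ext)
        fix i :: nat assume "i \<in> {..1}"
        then have "i = 0 \<or> i = 1" by auto
        then show "e i = e' i" using *(3) by auto
      qed
    qed
    show "(\<lambda>e::nat \<Rightarrow> nat. (e 0, e 1)) ` (PiE {..1} ?E) = X \<times> Y"
    proof (intro equalityI subsetI)
      fix z assume "z \<in> X \<times> Y"
      then obtain x y where z: "z = (x, y)" "x \<in> X" "y \<in> Y" by blast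
      define e where "e = (\<lambda>i::nat. if i = 0 then x else if i = 1 then y else undefined)"
      have "e \<in> PiE {..1} ?E" using z by (auto simp: e_def PiE_def extensional_def)
      then show "z \<in> (\<lambda>e::nat \<Rightarrow> nat. (e 0, e 1)) ` (PiE {..1} ?E)"
        using z by (intro image_eqI[of _ _ e]) (auto simp: e_def)
    qed (auto simp: PiE_def Pi_def split: if_splits)
  qed
  have "bij_betw (\<lambda>(x, y). x + y) (X \<times> Y) (sumset X Y)"
    using assms by (simp add: bij_betw_def direct_def sumset_def)
  then have "bij_betw ((\<lambda>(x, y). x + y) \<circ> (\<lambda>e::nat \<Rightarrow> nat. (e 0, e 1))) (PiE {..1} ?E) (sumset X Y)"
    by (rule bij_betw_trans[OF bij])
  moreover have "(\<lambda>(x, y). x + y) \<circ> (\<lambda>e::nat \<Rightarrow> nat. (e 0, e 1)) = (\<lambda>e. \<Sum>i\<le>1. e i)"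
    by (simp add: fun_eq_iff)
  ultimately show ?thesis by (simp add: direct_decomposition_def)
qed

lemma direct_decomposition_single: "direct_decomposition D 0 (\<lambda>_. D)"
proof -
  have "bij_betw (\<lambda>e::nat \<Rightarrow> nat. e 0) (PiE {0} (\<lambda>_. D)) D"
    unfolding bij_betw_def
  proof
    show "inj_on (\<lambda>e::nat \<Rightarrow> nat. e 0) (PiE {0} (\<lambda>_. D))"
      by (rule inj_onI, rule PiE_ext) auto
    show "(\<lambda>e::nat \<Rightarrow> nat. e 0) ` (PiE {0} (\<lambda>_. D)) = D"
    proof (intro equalityI subsetI)
      fix x assume "x \<in> D"
      then show "x \<in> (\<lambda>e::nat \<Rightarrow> nat. e 0) ` (PiE {0} (\<lambda>_. D))"
        by (intro image_eqI[of _ _ "\<lambda>i. if i = 0 then x else undefined"])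
          (auto simp: PiE_def extensional_def)
    qed (auto simp: PiE_def Pi_def)
  qed
  then show ?thesis by (simp add: direct_decomposition_def)
qed

lemma kernel_root_order:
  assumes "cyclotomic s dvd kernel_poly b l S i" "s > 0" "\<And>j t. j \<le> i \<Longrightarrow> t \<in> S j \<Longrightarrow> t > 0"
  obtains j t where "j \<le> i" "t \<in> S j" "s dvd t * b ^ l j"
proof -
  have "poly (kernel_poly b l S i) (rt s 1) = 0" using assms(1,2) cyclotomic_dvd_iff_roots by simp
  then obtain j t where jt: "j \<le> i" "t \<in> S j" "poly (cyclotomic t) (rt s 1 ^ (b ^ l j)) = 0"
    by (rule kernel_rootE)
  have t: "t > 0" using assms(3) jt by blast
  then obtain k where "rt s 1 ^ (b ^ l j) = rt t k" using jt poly_cyclotomic_eq_0_iff by blast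
  then have "(rt s 1 ^ (b ^ l j)) ^ t = 1" using t by (simp add: rt_power rt_eq_1_iff)
  then have "s dvd t * b ^ l j" using assms(2) by (simp add: rt_power rt_eq_1_iff)
  then show ?thesis using that jt by blast
qed

text \<open>One step of the higher-order construction: the coset \<open>progression r (b * h')\<close> on which \<open>D\<close>
  is invariant is pushed down by a factor \<open>b\<close>. Only an upper bound on the cyclotomic factors of the
  kernel is needed, because further factors would only strengthen the congruences.\<close>

lemma higher_order_step:
  assumes inv: "shift_invariant D r (b * h')" and pos: "b > 0" "h' > 0"
    and G: "G = sumset (shift_invariant.base D r (b * h')) (progression r h')"
    and dir: "direct (shift_invariant.base D r (b * h')) (progression r h')"
    and form: "modulo_product_form b k G K"
    and bound: "\<And>s. s > 0 \<Longrightarrow> cyclotomic s dvd K \<Longrightarrow> s dvd r * (b * h')"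
  obtains K' where "modulo_product_form b (Suc k) D K'"
    "\<And>s. s > 0 \<Longrightarrow> cyclotomic s dvd K' \<Longrightarrow> s dvd r * (b * h')"
proof -
  interpret shift_invariant D r "b * h'" by (rule inv)
  define Gs where "Gs = (\<lambda>i::nat. if i = 0 then base else progression r h')"
  define l where "l = (\<lambda>i::nat. if i = 0 then 0 else 1 :: nat)"
  let ?S = "higher_order_indices K Gs"
  let ?K = "kernel_poly b l ?S 1"
  have bnd: "s dvd r * (b * h')" if s: "s > 0" "cyclotomic s dvd ?K" for s
  proof -
    obtain j t where jt: "j \<le> 1" "t \<in> ?S j" "s dvd t * b ^ l j"
      using kernel_root_order[OF s(2,1)] by (auto simp: higher_order_indices_def)
    show ?thesis
    proof (cases "j = 0")
      case True
      then have "s dvd t" using jt by (simp add: l_def)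
      moreover have "t dvd r * (b * h')" using jt bound by (auto simp: higher_order_indices_def)
      ultimately show ?thesis by (rule dvd_trans)
    next
      case False
      then have "t > 0" "zr (progression r h') t"
        using jt cyclotomic_dvd_set_poly by (auto simp: higher_order_indices_def Gs_def)
      then have "t dvd r * h'" using zr_progression_iff pos r by blast
      then have "t * b dvd (r * h') * b" by (rule mult_dvd_mono) simp
      moreover have "s dvd t * b" using jt False by (simp add: l_def)
      ultimately show ?thesis by (metis dvd_trans mult.assoc mult.commute)
    qed
  qed
  have "(*) b ` progression r h' = progression r (b * h')"
    by (auto simp: progression_def image_image mult.left_commute)
  moreover have "cyclotomic_lcm ?K dvd r * (b * h')"
    unfolding cyclotomic_lcm_def by (rule Lcm_least) (use bnd in auto)
  \<comment> \<open>The base is taken unchanged, and D enters only in the last congruence, whose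
    modulus divides \<open>r * (b * h')\<close> by \<open>bnd\<close>.\<close>
  ultimately have "modulo_product b 1 Gs l ?S D"
    unfolding modulo_product_def
    by (intro exI[of _ "\<lambda>i. if i = 0 then base else D"])
      (auto simp: Gs_def l_def set_cong_refl direct_base intro: set_cong_dvd[OF set_cong_base])
  moreover have "direct_decomposition G 1 Gs"
    unfolding G Gs_def by (rule direct_decomposition_pair[OF dir])
  moreover have "mono_on {..1} l" by (auto simp: l_def mono_on_def)
  ultimately have "modulo_product_form b (Suc k) D ?K"
    using form by (intro higher_order) (auto simp: l_def)
  then show ?thesis using that bnd by blast
qed

section \<open>Descent on the type of zeros\<close>

context prime_base
begin

lemma zero_type_cong: "zero_type Z A j U \<Longrightarrow> (\<And>x y. Z x y \<Longrightarrow> Z' x y) \<Longrightarrow> zero_type Z' A j U"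
  unfolding zero_type_def by blast

text \<open>The product of the two mask polynomials is blocking and its exponents are sums from X
  and Y. By \<open>blocking_card\<close> there are at least b different sums, as many as there are
  pairs.\<close>

lemma direct_of_blocking:
  assumes fin: "finite X" "finite Y" and ne: "X \<noteq> {}" "Y \<noteq> {}" and card: "card X * card Y = b"
    and type: "zero_type (\<lambda>x y. zr X (p ^ x * q ^ y) \<or> zr Y (p ^ x * q ^ y)) A j U"
  shows "direct X Y" "card (sumset X Y) = b"
proof -
  let ?P = "set_poly X * set_poly Y"
  have "blocking b (\<lambda>z. poly ?P z = 0)"
  proof (rule blocking_of_exponents[OF _ zero_type_exponents[OF type]])
    fix x y k assume "zr X (p ^ x * q ^ y) \<or> zr Y (p ^ x * q ^ y)" "coprime k (p ^ x * q ^ y)"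
    then show "poly ?P (rt (p ^ x * q ^ y) k) = 0"
      using zr_iff[OF pq_pos] by (auto simp: poly_set_poly)
  qed
  moreover have "poly ?P 1 \<noteq> 0" using fin ne by (simp add: poly_set_poly)
  moreover have "n \<in> sumset X Y" if "coeff ?P n \<noteq> 0" for n
  proof -
    obtain i j where "n = i + j" "coeff (set_poly X) i \<noteq> 0" "coeff (set_poly Y) j \<noteq> 0"
      using \<open>coeff ?P n \<noteq> 0\<close> by (rule coeff_mult_nonzero)
    moreover have "i \<in> W" if "coeff (set_poly W) i \<noteq> 0" "finite W" for W i
      using that by (auto simp: set_poly_def coeff_sum split: if_splits)
    ultimately show ?thesis using fin by (auto simp: sumset_def)
  qed
  moreover have finS: "finite (sumset X Y)" using fin by (simp add: sumset_def)
  ultimately have ge: "b \<le> card (sumset X Y)" using blocking_card[OF b2] by blast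
  have "card (sumset X Y) \<le> card (X \<times> Y)" unfolding sumset_def using fin by (intro card_image_le) auto
  then show c: "card (sumset X Y) = b" using ge card by (simp add: card_cartesian_product)
  show "direct X Y" unfolding direct_def
    using c card fin unfolding sumset_def by (intro eq_card_imp_inj_on) (auto simp: card_cartesian_product)
qed

definition order_bound :: "nat set \<Rightarrow> nat \<Rightarrow> nat \<Rightarrow> nat \<Rightarrow> nat \<Rightarrow> bool" where
  "order_bound A j U X Y \<longleftrightarrow> (\<forall>a\<in>A. a \<le> X) \<and> U \<le> X \<and> j \<le> Y \<and>
     (\<forall>a\<in>A. \<forall>v. U + \<alpha> * v < a + \<alpha> * j \<longrightarrow> v \<le> Y)"

text \<open>The bound on the orders is the invariant that makes the modulus of the next congruence
  divide the modulus of invariance.\<close>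

definition bounded_form :: "nat set \<Rightarrow> nat set \<Rightarrow> nat \<Rightarrow> nat \<Rightarrow> bool" where
  "bounded_form D A j U \<longleftrightarrow> (\<exists>k\<ge>1. \<exists>K. modulo_product_form b k D K \<and>
     (\<forall>X Y. order_bound A j U X Y \<longrightarrow> (\<forall>s>0. cyclotomic s dvd K \<longrightarrow> s dvd p ^ X * q ^ Y)))"

text \<open>G gets its zeros from two sources: orders dividing \<open>b * h'\<close> survive in the
  base, and the progression with difference \<open>h'\<close> adds those that divide
  \<open>r * h'\<close> but not \<open>h'\<close>. The new type must be found among these.\<close>

lemma bounded_form_step:
  assumes D: "finite D" "card D = b" and r: "r > 0" and h': "h' > 0" and L: "r * (b * h') = p ^ Xb * q ^ Yb"
    and inv: "inv_shift D (r * (b * h')) (b * h')"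
    and type: "zero_type (\<lambda>x y. (p ^ x * q ^ y dvd b * h' \<and> zr D (p ^ x * q ^ y)) \<or>
        (p ^ x * q ^ y dvd r * h' \<and> \<not> p ^ x * q ^ y dvd h')) A' j' U'"
    and IH: "\<And>G. card G = b \<Longrightarrow> zero_type (\<lambda>x y. zr G (p ^ x * q ^ y)) A' j' U' \<Longrightarrow> bounded_form G A' j' U'"
    and bnd: "order_bound A' j' U' Xb Yb" "\<And>X Y. order_bound A j U X Y \<Longrightarrow> Xb \<le> X \<and> Yb \<le> Y"
  shows "bounded_form D A j U"
proof -
  have b0: "b > 0" using b2 by simp
  interpret shift_invariant D r "b * h'" using D r h' b0 inv by unfold_locales auto
  let ?G1 = "progression r h'"
  define G where "G = sumset base ?G1"
  have card: "card base * card ?G1 = b" using card_base D(2) h' by (simp add: card_progression)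
  have ne: "base \<noteq> {}" "?G1 \<noteq> {}" using card b0 by auto
  have type': "zero_type (\<lambda>x y. zr base (p ^ x * q ^ y) \<or> zr ?G1 (p ^ x * q ^ y)) A' j' U'"
    by (rule zero_type_cong[OF type]) (use zr_base zr_progression_iff[OF h' _ r] in auto)
  note dir = direct_of_blocking[OF finite_base finite_progression ne card type']
  have "zero_type (\<lambda>x y. zr G (p ^ x * q ^ y)) A' j' U'"
    by (rule zero_type_cong[OF type']) (auto simp: zr_def G_def ev_sumset[OF dir(1)])
  then obtain k K where kK: "k \<ge> 1" "modulo_product_form b k G K"
    "\<And>s. s > 0 \<Longrightarrow> cyclotomic s dvd K \<Longrightarrow> s dvd p ^ Xb * q ^ Yb"
    using IH[of G] dir(2) bnd(1) unfolding bounded_form_def G_def by blast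
  obtain K' where K': "modulo_product_form b (Suc k) D K'"
    "\<And>s. s > 0 \<Longrightarrow> cyclotomic s dvd K' \<Longrightarrow> s dvd r * (b * h')"
    using higher_order_step[OF shift_invariant_axioms b0 h' G_def dir(1) kK(2)] kK(3) L by metis
  have "s dvd p ^ X * q ^ Y" if "order_bound A j U X Y" "s > 0" "cyclotomic s dvd K'" for X Y s
    using K'(2)[OF that(2,3)] bnd(2)[OF that(1)] power_dvd_iff L by (metis dvd_trans)
  then show ?thesis unfolding bounded_form_def using K'(1) by (intro exI[of _ "Suc k"]) auto
qed

text \<open>The zeros at all nontrivial orders dividing b equidistribute D modulo b. As a complete
  residue system it is a first-order form with a single component.\<close>

lemma residue_system_form:
  assumes D: "finite D" "card D = b" and A: "\<alpha> \<in> A" and j: "j > 0"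
    and zeros: "\<And>x y. x \<le> \<alpha> \<Longrightarrow> y \<le> 1 \<Longrightarrow> (x, y) \<noteq> (0, 0) \<Longrightarrow> zr D (p ^ x * q ^ y)"
  shows "bounded_form D A j U"
proof -
  have b0: "b > 0" using b2 by simp
  have "b dvd k \<or> ev D (rt b k) = 0" for k
  proof (cases "b dvd k")
    case False
    then obtain s k' where s: "s > 0" "s dvd b" "coprime k' s" "rt b k = rt s k'" "s > 1"
      using rt_reduced[OF b0, of k] by metis
    then have "s dvd p ^ \<alpha> * q ^ 1" by (simp add: b_def)
    then obtain x y where xy: "x \<le> \<alpha>" "y \<le> 1" "s = p ^ x * q ^ y" by (rule dvd_pq_obtains)
    then have "zr D s" using zeros[of x y] s(5) by (cases "x = 0 \<and> y = 0") auto
    then show ?thesis using s zr_iff by simp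
  qed simp
  then have shift: "cnt D b (t + 1) = cnt D b t" for t
    using cnt_shift_invariant_iff[OF D(1), of b b 1] b0 by simp
  have const: "cnt D b t = cnt D b 0" for t
  proof (induction t)
    case (Suc t)
    then show ?case using shift[of t] by simp
  qed simp
  have "(\<Sum>i<b. cnt D b 0) = (\<Sum>i<b. cnt D b i)" by (intro sum.cong refl const[symmetric])
  also have "\<dots> = b" using sum_cnt[OF D(1) b0] D(2) by simp
  finally have "b * cnt D b 0 = b" by simp
  then have c1: "cnt D b t = 1" for t using const[of t] b0 by simp
  have "cnt {0..<b} b t = 1" for t
  proof -
    have "{x \<in> {0..<b}. [x = t] (mod b)} = {t mod b}" using b0 by (auto simp: cong_def)
    then show ?thesis by (simp add: cnt_def)
  qed
  then have sc: "set_cong b D {0..<b}" using D b0 c1 by (intro set_cong_of_cnt) auto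
  let ?S = "first_order_indices b (\<lambda>_. D)"
  let ?K = "kernel_poly b (\<lambda>_. 0) ?S 0"
  have "modulo_product b 0 (\<lambda>_. D) (\<lambda>_. 0) ?S D"
    unfolding modulo_product_def by (intro exI[of _ "\<lambda>_. D"]) (auto simp: set_cong_refl)
  then have form: "modulo_product_form b 1 D ?K"
    using sc direct_decomposition_single by (intro first_order) (auto simp: mono_on_def)
  have "s dvd p ^ X * q ^ Y" if hyp: "order_bound A j U X Y" "s > 0" "cyclotomic s dvd ?K" for X Y s
  proof -
    obtain i t where "t \<in> ?S i" "s dvd t * b ^ 0"
      using kernel_root_order[OF hyp(3,2)] by (auto simp: first_order_indices_def)
    then have "s dvd b" by (auto simp: first_order_indices_def intro: dvd_trans)
    moreover have "p ^ \<alpha> * q ^ 1 dvd p ^ X * q ^ Y"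
      unfolding power_dvd_iff using hyp(1) A j by (auto simp: order_bound_def)
    ultimately show ?thesis using b_def by (metis dvd_trans power_one_right)
  qed
  then show ?thesis unfolding bounded_form_def using form by (intro exI[of _ 1]) auto
qed

lemma shift_of_row:
  assumes "finite D" "\<And>u. u \<le> U \<Longrightarrow> zr D (p ^ u * q ^ Suc y)"
  shows "inv_shift D (q * (p ^ U * q ^ y)) (p ^ U * q ^ y)"
proof -
  \<comment> \<open>Rows become columns when p and q are exchanged; 1 and \<open>q * p\<close> are
    placeholder values for the exponent and the base.\<close>
  interpret sw: prime_base q p 1 "q * p" using pq by unfold_locales auto
  have "inv_shift D (q ^ Suc y * p ^ U) (q ^ y * p ^ U)"
    using assms by (intro sw.shift_of_column) (auto simp: mult.commute)
  then show ?thesis by (simp add: mult_ac)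
qed

text \<open>If \<open>U < Max A\<close>, then the zeros in the column \<open>Max A\<close> are moved to \<open>Max A - \<alpha>\<close>; otherwise
  the row \<open>j\<close> is moved to \<open>j - 1\<close>, or for \<open>j = 1\<close> shortened to \<open>U = Max A - 1\<close> first. The process
  ends at \<open>A = {1..\<alpha>}\<close> and \<open>j = 1\<close>, a complete residue system modulo \<open>b\<close>.\<close>

lemma zero_type_form:
  assumes "card D = b" "zero_type (\<lambda>x y. zr D (p ^ x * q ^ y)) A j U"
  shows "bounded_form D A j U"
  using assms
proof (induction "\<Sum>A + j" arbitrary: D A j U rule: less_induct)
  case less
  have cD: "card D = b" and fin: "finite D" using less.prems b2 by (auto intro: card_ge_0_finite)
  have type: "finite A" "\<And>a. a \<in> A \<Longrightarrow> a > 0" "\<And>P. \<exists>a\<in>A. \<exists>m. \<alpha> * m = a + P" "j > 0" "\<alpha> * (j - 1) \<le> U"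
    using less.prems(2) by (auto simp: zero_type_def)
  have rows: "\<And>U. zero_type (\<lambda>x y. zr D (p ^ x * q ^ y)) A j U \<Longrightarrow> u \<le> U \<Longrightarrow> zr D (p ^ u * q ^ j)" for u
    by (auto simp: zero_type_def)
  have cols: "\<And>U. zero_type (\<lambda>x y. zr D (p ^ x * q ^ y)) A j U \<Longrightarrow> a \<in> A \<Longrightarrow> v = 0 \<or> U + \<alpha> * v < a + \<alpha> * j \<Longrightarrow> zr D (p ^ a * q ^ v)" for a v
    unfolding zero_type_def by blast
  have A0: "A \<noteq> {}" using type(3) by blast
  define a where "a = Max A"
  have a: "a \<in> A" "\<And>a'. a' \<in> A \<Longrightarrow> a' \<le> a" using type(1) A0 by (auto simp: a_def)
  have a0: "a > 0" using type(2) a by blast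
  \<comment> \<open>When no column exceeds \<alpha>, the presence of every residue modulo \<alpha>
    makes each of 1, ..., \<alpha> a column.\<close>
  have full: "x \<in> A" if "a \<le> \<alpha>" "0 < x" "x \<le> \<alpha>" for x
  proof -
    obtain a' m where am: "a' \<in> A" "\<alpha> * m = a' + (\<alpha> - x)" using type(3) by blast
    have "0 < a'" "a' \<le> \<alpha>" using am type(2) a that by (auto intro: order_trans)
    then have "\<alpha> * m > 0" "\<alpha> * m < \<alpha> * 2" using am(2) that by linarith+
    then have "m > 0" "m < 2" by auto
    then have "m = 1" by simp
    then have "a' = x" using am(2) that by simp
    then show ?thesis using am by simp
  qed
  have base: "bounded_form D A j U" if aj: "a \<le> \<alpha>" "j = 1"
  proof (rule residue_system_form[OF fin cD _ type(4)])
    show "\<alpha> \<in> A" using full aj \<alpha> by simp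
    fix x y :: nat assume xy: "x \<le> \<alpha>" "y \<le> 1" "(x, y) \<noteq> (0, 0)"
    show "zr D (p ^ x * q ^ y)"
    proof (cases "y = 0")
      case True
      then show ?thesis using cols[OF less.prems(2), of x 0] full[of x] aj xy by simp
    next
      case False
      then have y: "y = 1" using xy by simp
      show ?thesis
      proof (cases "x \<le> U")
        case True
        then show ?thesis using rows[OF less.prems(2)] aj y by simp
      next
        case False
        then have "x \<in> A" using full[of x] aj xy by simp
        then show ?thesis using cols[OF less.prems(2), of x 1] False aj y by simp
      qed
    qed
  qed
  have step_p: "bounded_form D A j U'" if U': "zero_type (\<lambda>x y. zr D (p ^ x * q ^ y)) A j U'" "U' < a" "\<alpha> < a" for U'
  proof -
    \<comment> \<open>The height up to which the type guarantees zeros in column a;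
      \<open>h'\<close> is then chosen so that \<open>p * (b * h')\<close> becomes
      \<open>p ^ a * q ^ V\<close>.\<close>
    define V where "V = j + (a - U' - 1) div \<alpha>"
    have V: "U' + \<alpha> * v < a + \<alpha> * j \<longleftrightarrow> v \<le> V" for v
    proof (cases "v \<le> j")
      case True
      then have "\<alpha> * v \<le> \<alpha> * j" by simp
      then have "U' + \<alpha> * v < a + \<alpha> * j" using U'(2) by linarith
      then show ?thesis using True by (simp add: V_def)
    next
      case False
      have "\<alpha> * v = \<alpha> * (v - j) + \<alpha> * j" using False by (simp flip: distrib_left)
      then have "U' + \<alpha> * v < a + \<alpha> * j \<longleftrightarrow> (v - j) * \<alpha> \<le> a - U' - 1" using U'(2) by (auto simp: mult.commute)
      also have "\<dots> \<longleftrightarrow> v - j \<le> (a - U' - 1) div \<alpha>" using \<alpha> by (simp add: less_eq_div_iff_mult_less_eq)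
      also have "\<dots> \<longleftrightarrow> v \<le> V" using False by (auto simp: V_def)
      finally show ?thesis .
    qed
    have jV: "j \<le> V" by (simp add: V_def)
    define a' where "a' = a - \<alpha>"
    have a': "a = a' + \<alpha>" "a' > 0" using U'(3) by (auto simp: a'_def)
    define h' where "h' = p ^ (a' - 1) * q ^ (V - 1)"
    have bh: "b * h' = p ^ (a - 1) * q ^ V"
    proof -
      have "a - 1 = \<alpha> + (a' - 1)" "V = Suc (V - 1)" using a' type(4) jV by auto
      then have "p ^ (a - 1) = p ^ \<alpha> * p ^ (a' - 1)" "q ^ V = q * q ^ (V - 1)"
        by (metis power_add, metis power_Suc)
      then show ?thesis by (simp add: b_def h'_def)
    qed
    have ph: "p * h' = p ^ a' * q ^ (V - 1)" using a'(2) by (simp add: h'_def power_eq_if)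
    have L: "p * (b * h') = p ^ a * q ^ V" unfolding bh using a0 by (simp add: power_eq_if)
    \<comment> \<open>The progression supplies the column \<open>a' = a - \<alpha>\<close> with
      heights up to \<open>V - 1\<close>; the rest of the type lies to the left of a and survives in
      the base.\<close>
    define A' where "A' = insert a' (A - {a})"
    show ?thesis
    proof (rule bounded_form_step[where r = p and h' = h' and A' = A' and j' = j and U' = U' and Xb = a and Yb = V])
      show "finite D" "card D = b" "p > 0" "h' > 0" "p * (b * h') = p ^ a * q ^ V"
        using fin cD L by (simp_all add: h'_def)
      have "inv_shift D (p ^ Suc (a - 1) * q ^ V) (p ^ (a - 1) * q ^ V)"
        using fin cols[OF U'(1) a(1)] V a0 by (intro shift_of_column) auto
      then show "inv_shift D (p * (b * h')) (b * h')" unfolding bh by (simp add: mult.assoc)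
      show "zero_type (\<lambda>x y. (p ^ x * q ^ y dvd b * h' \<and> zr D (p ^ x * q ^ y)) \<or>
        (p ^ x * q ^ y dvd p * h' \<and> \<not> p ^ x * q ^ y dvd h')) A' j U'"
        unfolding bh ph unfolding h'_def power_dvd_iff zero_type_def
      proof (intro conjI allI ballI impI)
        show "finite A'" "0 < j" "\<alpha> * (j - 1) \<le> U'" using type U' by (auto simp: A'_def zero_type_def)
        show "0 < z" if "z \<in> A'" for z using that a' type(2) by (auto simp: A'_def)
        show "\<exists>z\<in>A'. \<exists>m. \<alpha> * m = z + P" for P
        proof -
          obtain z m where zm: "z \<in> A" "\<alpha> * m = z + P" using type(3) by blast
          show ?thesis
          proof (cases "z = a")
            case True
            then have "m > 0" using zm a0 by (intro Nat.gr0I) auto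
            then have "\<alpha> * m = \<alpha> * (m - 1) + \<alpha>" by (cases m) auto
            then have "\<alpha> * (m - 1) = a' + P" using zm True a' by simp
            then show ?thesis by (auto simp: A'_def)
          qed (use zm in \<open>auto simp: A'_def\<close>)
        qed
        show "(u \<le> a - 1 \<and> j \<le> V) \<and> zr D (p ^ u * q ^ j) \<or> (u \<le> a' \<and> j \<le> V - 1) \<and> \<not> (u \<le> a' - 1 \<and> j \<le> V - 1)"
          if "u \<le> U'" for u
        proof (intro disjI1 conjI)
          show "u \<le> a - 1" using that U'(2) by linarith
        qed (use that jV rows[OF U'(1)] in auto)
        fix z v assume z: "z \<in> A'" and v: "v = 0 \<or> U' + \<alpha> * v < z + \<alpha> * j"
        show "(z \<le> a - 1 \<and> v \<le> V) \<and> zr D (p ^ z * q ^ v) \<or> (z \<le> a' \<and> v \<le> V - 1) \<and> \<not> (z \<le> a' - 1 \<and> v \<le> V - 1)"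
        proof (cases "z = a'")
          case True
          have "v \<le> V - 1"
          proof (cases "v = 0")
            case False
            then have "U' + \<alpha> * Suc v < a + \<alpha> * j" using v True a'(1) by simp
            then have "Suc v \<le> V" using V by blast
            then show ?thesis by simp
          qed simp
          moreover have "\<not> a' \<le> a' - 1" using a'(2) by linarith
          ultimately show ?thesis using True by simp
        next
          case False
          then have zA: "z \<in> A" "z \<noteq> a" using z by (auto simp: A'_def)
          then have "z < a" using a(2) by (simp add: le_neq_implies_less)
          then have "z \<le> a - 1" by linarith
          moreover have "v \<le> V"
          proof (cases "v = 0")
            case False
            then have "U' + \<alpha> * v < a + \<alpha> * j" using v \<open>z < a\<close> by linarith
            then show ?thesis using V by blast
          qed simp
          ultimately show ?thesis using cols[OF U'(1) zA(1) v] by simp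
        qed
      qed
      show "bounded_form G A' j U'" if "card G = b" "zero_type (\<lambda>x y. zr G (p ^ x * q ^ y)) A' j U'" for G
      proof (rule less.hyps[OF _ that])
        have "\<Sum>A' \<le> a' + \<Sum>(A - {a})" using type(1) by (simp add: A'_def sum.insert_if)
        moreover have "\<Sum>A = a + \<Sum>(A - {a})" using type(1) a(1) by (simp add: sum.remove)
        ultimately show "\<Sum>A' + j < \<Sum>A + j" using a'(1) \<alpha> by simp
      qed
      show "order_bound A' j U' a V"
        unfolding order_bound_def
      proof (intro conjI ballI allI impI)
        show "z \<le> a" if "z \<in> A'" for z using that a(2) a'(1) by (auto simp: A'_def)
        then have "v \<le> V" if "z \<in> A'" "U' + \<alpha> * v < z + \<alpha> * j" for z v
          using that V[of v] by (meson add_le_mono1 order_less_le_trans)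
        then show "\<And>z v. z \<in> A' \<Longrightarrow> U' + \<alpha> * v < z + \<alpha> * j \<Longrightarrow> v \<le> V" by blast
      qed (use U' jV in auto)
      show "a \<le> X \<and> V \<le> Y" if "order_bound A j U' X Y" for X Y
        using that a(1) V[of V] unfolding order_bound_def by blast
    qed
  qed
  show ?case
  proof (cases "U < a")
    case True
    show ?thesis
    proof (cases "\<alpha> < a")
      case True
      then show ?thesis using step_p less.prems(2) \<open>U < a\<close> by blast
    next
      case False
      then have "\<alpha> * (j - 1) < \<alpha> * 1" using type(5) \<open>U < a\<close> by linarith
      then have "j - 1 < 1" by simp
      then have "j = 1" using type(4) by simp
      then show ?thesis using base False by simp
    qed
  next
    case Ua: False
    show ?thesis
    proof (cases "j = 1")
      case True
      show ?thesis
      proof (cases "\<alpha> < a")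
        case True
        \<comment> \<open>A row at height 1 cannot be lowered. Ending it at \<open>a - 1\<close>
          lets its point (a, 1) count for the column a, so that the column step applies.\<close>
        have "zero_type (\<lambda>x y. zr D (p ^ x * q ^ y)) A j (a - 1)"
          unfolding zero_type_def
        proof (intro conjI allI ballI impI)
          show "zr D (p ^ u * q ^ j)" if "u \<le> a - 1" for u using rows[OF less.prems(2)] that Ua by simp
          fix z v assume z: "z \<in> A" and v: "v = 0 \<or> a - 1 + \<alpha> * v < z + \<alpha> * j"
          show "zr D (p ^ z * q ^ v)"
          proof (cases "v = 0")
            case True
            then show ?thesis using cols[OF less.prems(2) z, of 0] by simp
          next
            case False
            then have lt: "a - 1 + \<alpha> * v < z + \<alpha>" using v \<open>j = 1\<close> by simp
            have "z \<le> a" using a(2) z by simp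
            have "\<not> 2 \<le> v"
            proof
              assume "2 \<le> v"
              then have "\<alpha> * 2 \<le> \<alpha> * v" by (rule mult_le_mono2)
              then show False using lt \<open>z \<le> a\<close> \<alpha> by linarith
            qed
            then have "v = 1" using False by simp
            then have "z = a" using lt \<open>z \<le> a\<close> by simp
            then show ?thesis using rows[OF less.prems(2), of a] Ua \<open>v = 1\<close> \<open>j = 1\<close> by simp
          qed
        qed (use type \<open>j = 1\<close> in auto)
        then have "bounded_form D A j (a - 1)" using step_p a0 True by simp
        moreover have "order_bound A j (a - 1) X Y" if "order_bound A j U X Y" for X Y
          unfolding order_bound_def
        proof (intro conjI ballI allI impI)
          fix z v assume z: "z \<in> A" and v: "a - 1 + \<alpha> * v < z + \<alpha> * j"
          have "a - 1 + \<alpha> * v < z + \<alpha>" using v \<open>j = 1\<close> by simp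
          then have "\<alpha> * v < \<alpha> * 2" using a(2)[OF z] a0 \<alpha> by linarith
          then have "v \<le> 1" by simp
          then show "v \<le> Y" using that \<open>j = 1\<close> by (auto simp: order_bound_def)
        qed (use that Ua in \<open>auto simp: order_bound_def\<close>)
        ultimately show ?thesis unfolding bounded_form_def by blast
      qed (use base \<open>j = 1\<close> in simp)
    next
      case False
      define j' where "j' = j - 1"
      have j: "j = Suc j'" "j' > 0" using False type(4) by (auto simp: j'_def)
      have "\<alpha> * 1 \<le> \<alpha> * j'" using j(2) by (intro mult_le_mono2) simp
      then have "\<alpha> \<le> U" using type(5) unfolding j'_def by linarith
      define U' where "U' = U - \<alpha>"
      have U': "U = U' + \<alpha>" using \<open>\<alpha> \<le> U\<close> by (simp add: U'_def)
      \<comment> \<open>The end of the row moves along its diagonal, so the extent of the columns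
        stays the same.\<close>
      have colj: "U' + \<alpha> * v < z + \<alpha> * j' \<longleftrightarrow> U + \<alpha> * v < z + \<alpha> * j" for z v
        by (simp add: U' j)
      have vj: "v \<le> j'" if "z \<in> A" "U + \<alpha> * v < z + \<alpha> * j" for z v
      proof -
        have "\<alpha> * v < \<alpha> * j" using that a(2)[OF that(1)] Ua by linarith
        then have "v < j" by simp
        then show ?thesis using j by simp
      qed
      \<comment> \<open>The progression with difference \<open>h'\<close> supplies the row
        \<open>j'\<close> up to \<open>U'\<close>, while the columns lie in \<open>{..U}\<close>
        below height j and survive in the base.\<close>
      define h' where "h' = p ^ U' * q ^ (j' - 1)"
      have bh: "b * h' = p ^ U * q ^ j'"
      proof -
        have "p ^ U = p ^ \<alpha> * p ^ U'" "q ^ j' = q * q ^ (j' - 1)"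
          using U' j(2) by (metis add.commute power_add, metis Suc_diff_1 power_Suc)
        then show ?thesis by (simp add: b_def h'_def)
      qed
      have qh: "q * h' = p ^ U' * q ^ j'" using j(2) by (simp add: h'_def power_eq_if)
      have L: "q * (b * h') = p ^ U * q ^ j" unfolding bh by (simp add: j)
      show ?thesis
      proof (rule bounded_form_step[where r = q and h' = h' and A' = A and j' = j' and U' = U' and Xb = U and Yb = j])
        show "finite D" "card D = b" "q > 0" "h' > 0" "q * (b * h') = p ^ U * q ^ j"
          using fin cD L by (simp_all add: h'_def)
        show "inv_shift D (q * (b * h')) (b * h')"
          unfolding bh using fin rows[OF less.prems(2)] j by (intro shift_of_row) auto
        show "zero_type (\<lambda>x y. (p ^ x * q ^ y dvd b * h' \<and> zr D (p ^ x * q ^ y)) \<or>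
          (p ^ x * q ^ y dvd q * h' \<and> \<not> p ^ x * q ^ y dvd h')) A j' U'"
          unfolding bh qh unfolding h'_def power_dvd_iff zero_type_def
        proof (intro conjI allI ballI impI)
          show "\<alpha> * (j' - 1) \<le> U'" using type(5) U' j by (cases j') auto
          fix z v assume z: "z \<in> A" and v: "v = 0 \<or> U' + \<alpha> * v < z + \<alpha> * j'"
          have "v \<le> j'" using v vj[OF z] colj by auto
          moreover have "z \<le> U" using a(2)[OF z] Ua by simp
          ultimately show "(z \<le> U \<and> v \<le> j') \<and> zr D (p ^ z * q ^ v) \<or> (z \<le> U' \<and> v \<le> j') \<and> \<not> (z \<le> U' \<and> v \<le> j' - 1)"
            using cols[OF less.prems(2) z] v colj by auto
        qed (use type j in auto)
        show "bounded_form G A j' U'" if "card G = b" "zero_type (\<lambda>x y. zr G (p ^ x * q ^ y)) A j' U'" for G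
          by (rule less.hyps[OF _ that]) (simp add: j)
        show "order_bound A j' U' U j"
          unfolding order_bound_def
        proof (intro conjI ballI allI impI)
          show "z \<le> U" if "z \<in> A" for z using a(2)[OF that] Ua by simp
          show "v \<le> j" if "z \<in> A" "U' + \<alpha> * v < z + \<alpha> * j'" for z v using vj that colj j by fastforce
        qed (use U' j in auto)
        show "U \<le> X \<and> j \<le> Y" if "order_bound A j U X Y" for X Y using that by (simp add: order_bound_def)
      qed
    qed
  qed
qed

end

theorem theorem1p3:
  fixes p q \<alpha> b :: nat and D :: "nat set"
  assumes "prime p" "prime q" "p \<noteq> q" "\<alpha> \<ge> 1"
    and "b = p ^ \<alpha> * q"
    and "0 \<in> D" "Gcd D = 1" "card D = p ^ \<alpha> * q"
  shows "tile_digit_set b D \<longleftrightarrow> (\<exists>k\<ge>1. \<exists>K. modulo_product_form b k D K)"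
proof -
  interpret prime_base p q \<alpha> b using assms by unfold_locales
  show ?thesis
  proof
    assume "tile_digit_set b D"
    then obtain A j U where "zero_type (\<lambda>x y. zr D (p ^ x * q ^ y)) A j U"
      using zero_type_of_tile assms(6,7) by blast
    then have "bounded_form D A j U" using zero_type_form assms(5,8) by blast
    then show "\<exists>k\<ge>1. \<exists>K. modulo_product_form b k D K" unfolding bounded_form_def by blast
  next
    assume "\<exists>k\<ge>1. \<exists>K. modulo_product_form b k D K"
    then show "tile_digit_set b D" using modulo_product_form_tile b2 by blast
  qed
qed

end
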